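(* Let $G$ be a residually finite ICC group, and let $\{G_n\}_{n\in\mathbb{N}}$ be a decreasing sequence of finite index normal subgroups of $G$ with trivial intersection. Suppose that $G\curvearrowright X:=\varprojlim(G/G_n,\mu_n)$ is the associated profinite action. Then every von Neumann algebra $\mathsf{P}$ such that $L(G)<\mathsf{P}<L^\infty(X)\rtimes G$ is of the form $\mathsf{P}=L^\infty(Y)\rtimes G$, where $Y$ is a $G$-factor of $X$.
   Context: All groups are discrete and countable; ICC means infinite conjugacy classes. $\mu_n$ is the normalized counting measure on the finite set $G/G_n$, $G$ acts on $G/G_n$ by left translation, and $X$ carries the inverse limit probability measure and action. $L(G)$ is the group von Neumann algebra, viewed inside the crossed product $L^\infty(X)\rtimes G$. Inclusions of von Neumann algebras are unital. A $G$-factor $Y$ of $X$ is a quotient of the probability measure preserving action $G\curvearrowright X$, with $L^\infty(Y)$ identified with the corresponding $G$-invariant von Neumann subalgebra of $L^\infty(X)$. *)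

theory Defs
  imports
    "HOL-Probability.Probability"
    "HOL-Algebra.Left_Coset"
    "HOL-Algebra.Group_Action"
begin

section \<open>Groups and profinite actions\<close>

definition ICC :: "('g, 'm) monoid_scheme \<Rightarrow> bool" where
  "ICC G \<longleftrightarrow> (\<forall>g \<in> carrier G - {\<one>\<^bsub>G\<^esub>}.
     infinite {h \<otimes>\<^bsub>G\<^esub> g \<otimes>\<^bsub>G\<^esub> inv\<^bsub>G\<^esub> h | h. h \<in> carrier G})"

definition residually_finite :: "('g, 'm) monoid_scheme \<Rightarrow> bool" where
  "residually_finite G \<longleftrightarrow> (\<forall>g \<in> carrier G - {\<one>\<^bsub>G\<^esub>}.
     \<exists>H. H \<lhd> G \<and> finite (lcosets\<^bsub>G\<^esub> H) \<and> g \<notin> H)"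

text \<open>
  The inverse limit of the finite sets \<open>G / N n\<close>: the bonding map from \<open>G / N (Suc n)\<close> to
  \<open>G / N n\<close> sends a coset \<open>C = g N (Suc n)\<close> to \<open>C N n = g N n\<close>.
\<close>

definition inverse_limit :: "('g, 'm) monoid_scheme \<Rightarrow> (nat \<Rightarrow> 'g set) \<Rightarrow> (nat \<Rightarrow> 'g set) set" where
  "inverse_limit G N =
     {x. \<forall>n. x n \<in> lcosets\<^bsub>G\<^esub> (N n) \<and> x n = x (Suc n) <#>\<^bsub>G\<^esub> N n}"

text \<open>
  \<open>X\<close> is the inverse limit equipped with the inverse limit of the normalized counting measures:
  its \<open>\<sigma>\<close>-algebra is generated by the coordinate projections, each of which maps \<open>X\<close> onto
  \<open>(G / N n, \<mu>\<^sub>n)\<close> in a measure preserving way. Such a measure exists and is unique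
  (Kolmogorov), so the predicate determines \<open>X\<close>.
\<close>

definition inverse_limit_space ::
    "('g, 'm) monoid_scheme \<Rightarrow> (nat \<Rightarrow> 'g set) \<Rightarrow> (nat \<Rightarrow> 'g set) measure \<Rightarrow> bool" where
  "inverse_limit_space G N X \<longleftrightarrow>
     space X = inverse_limit G N \<and>
     sets X = sigma_sets (inverse_limit G N)
       {{x \<in> inverse_limit G N. x n = C} | n C. C \<in> lcosets\<^bsub>G\<^esub> (N n)} \<and>
     (\<forall>n. distr X (uniform_count_measure (lcosets\<^bsub>G\<^esub> (N n))) (\<lambda>x. x n)
            = uniform_count_measure (lcosets\<^bsub>G\<^esub> (N n)))"

definition translation :: "('g, 'm) monoid_scheme \<Rightarrow> 'g \<Rightarrow> (nat \<Rightarrow> 'g set) \<Rightarrow> (nat \<Rightarrow> 'g set)" where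
  "translation G g x = (\<lambda>n. g <#\<^bsub>G\<^esub> x n)"

definition pmp_action :: "('g, 'm) monoid_scheme \<Rightarrow> 'y measure \<Rightarrow> ('g \<Rightarrow> 'y \<Rightarrow> 'y) \<Rightarrow> bool" where
  "pmp_action G Y \<beta> \<longleftrightarrow>
     prob_space Y \<and> group_action G (space Y) \<beta> \<and>
     (\<forall>g \<in> carrier G. \<beta> g \<in> measurable Y Y \<and> distr Y Y (\<beta> g) = Y)"

definition factor_map ::
    "('g, 'm) monoid_scheme \<Rightarrow> 'x measure \<Rightarrow> ('g \<Rightarrow> 'x \<Rightarrow> 'x) \<Rightarrow>
       'y measure \<Rightarrow> ('g \<Rightarrow> 'y \<Rightarrow> 'y) \<Rightarrow> ('x \<Rightarrow> 'y) \<Rightarrow> bool" where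
  "factor_map G X \<alpha> Y \<beta> \<pi> \<longleftrightarrow>
     \<pi> \<in> measurable X Y \<and> distr X Y \<pi> = Y \<and>
     (\<forall>g \<in> carrier G. \<forall>x \<in> space X. \<pi> (\<alpha> g x) = \<beta> g (\<pi> x))"

section \<open>Bounded operators on \<open>L\<^sup>2\<close> and von Neumann algebras\<close>

text \<open>
  Elements of the Hilbert space \<open>L\<^sup>2(M)\<close> are represented by square integrable functions, and
  operators by maps between functions, equality being equality almost everywhere. Values of an
  operator outside \<open>L\<^sup>2(M)\<close> are irrelevant. A set of operators in the usual sense corresponds to
  a set of representatives that is closed under changing the representative; commutants, hence
  von Neumann algebras as defined below, are always of this form, so equality of
  von Neumann algebras is literal equality of sets.
\<close>

definition L2 :: "'a measure \<Rightarrow> ('a \<Rightarrow> complex) set" where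
  "L2 M = {f \<in> borel_measurable M. integrable M (\<lambda>x. (cmod (f x))\<^sup>2)}"

definition L2_inner :: "'a measure \<Rightarrow> ('a \<Rightarrow> complex) \<Rightarrow> ('a \<Rightarrow> complex) \<Rightarrow> complex" where
  "L2_inner M f g = (\<integral>x. f x * cnj (g x) \<partial>M)"

definition L2_norm :: "'a measure \<Rightarrow> ('a \<Rightarrow> complex) \<Rightarrow> real" where
  "L2_norm M f = sqrt (\<integral>x. (cmod (f x))\<^sup>2 \<partial>M)"

text \<open>Additivity and boundedness force \<open>T f = T g\<close> a.e. whenever \<open>f = g\<close> a.e.\<close>

definition bounded_ops :: "'a measure \<Rightarrow> (('a \<Rightarrow> complex) \<Rightarrow> ('a \<Rightarrow> complex)) set" where
  "bounded_ops M = {T.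
     (\<forall>f \<in> L2 M. T f \<in> L2 M) \<and>
     (\<forall>f \<in> L2 M. \<forall>g \<in> L2 M. AE x in M. T (\<lambda>y. f y + g y) x = T f x + T g x) \<and>
     (\<forall>c. \<forall>f \<in> L2 M. AE x in M. T (\<lambda>y. c * f y) x = c * T f x) \<and>
     (\<exists>C. \<forall>f \<in> L2 M. L2_norm M (T f) \<le> C * L2_norm M f)}"

definition is_adjoint ::
    "'a measure \<Rightarrow> (('a \<Rightarrow> complex) \<Rightarrow> ('a \<Rightarrow> complex)) \<Rightarrow> (('a \<Rightarrow> complex) \<Rightarrow> ('a \<Rightarrow> complex)) \<Rightarrow> bool" where
  "is_adjoint M T S \<longleftrightarrow>
     (\<forall>f \<in> L2 M. \<forall>g \<in> L2 M. L2_inner M (T f) g = L2_inner M f (S g))"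

definition commutant ::
    "'a measure \<Rightarrow> (('a \<Rightarrow> complex) \<Rightarrow> ('a \<Rightarrow> complex)) set \<Rightarrow> (('a \<Rightarrow> complex) \<Rightarrow> ('a \<Rightarrow> complex)) set" where
  "commutant M \<A> =
     {T \<in> bounded_ops M. \<forall>A \<in> \<A>. \<forall>f \<in> L2 M. AE x in M. T (A f) x = A (T f) x}"

text \<open>
  A von Neumann algebra is a self-adjoint set of bounded operators equal to its bicommutant; being a
  commutant, it is a subalgebra containing the identity of \<open>L\<^sup>2(M)\<close>, so all inclusions
  between von Neumann algebras on \<open>L\<^sup>2(M)\<close> are unital.
\<close>

definition von_neumann_algebra ::
    "'a measure \<Rightarrow> (('a \<Rightarrow> complex) \<Rightarrow> ('a \<Rightarrow> complex)) set \<Rightarrow> bool" where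
  "von_neumann_algebra M \<A> \<longleftrightarrow>
     \<A> \<subseteq> bounded_ops M \<and>
     (\<forall>T \<in> \<A>. \<forall>S \<in> bounded_ops M. is_adjoint M T S \<longrightarrow> S \<in> \<A>) \<and>
     commutant M (commutant M \<A>) = \<A>"

definition vN_generated ::
    "'a measure \<Rightarrow> (('a \<Rightarrow> complex) \<Rightarrow> ('a \<Rightarrow> complex)) set \<Rightarrow> (('a \<Rightarrow> complex) \<Rightarrow> ('a \<Rightarrow> complex)) set" where
  "vN_generated M S = \<Inter>{\<A>. von_neumann_algebra M \<A> \<and> S \<subseteq> \<A>}"

section \<open>Crossed products\<close>

definition Linf :: "'a measure \<Rightarrow> ('a \<Rightarrow> complex) set" where
  "Linf M = {f \<in> borel_measurable M. \<exists>C. AE x in M. cmod (f x) \<le> C}"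

text \<open>
  The crossed product of \<open>L\<^sup>\<infinity>(X)\<close> by \<open>G\<close> acts on \<open>L\<^sup>2(X) \<otimes> \<ell>\<^sup>2(G) = L\<^sup>2(X \<times> G)\<close>, with
  \<open>f \<in> L\<^sup>\<infinity>(X)\<close> acting as \<open>f \<otimes> 1\<close> and \<open>g \<in> G\<close> acting as the unitary
  \<open>u\<^sub>g = \<sigma>\<^sub>g \<otimes> \<lambda>\<^sub>g\<close>, the tensor product of the Koopman operator of the action \<open>\<alpha>\<close>
  and the left regular representation. In particular
  \<open>u\<^sub>g f u\<^sub>g\<^sup>* = \<sigma>\<^sub>g(f)\<close>, where \<open>\<sigma>\<^sub>g(f)(x) = f(g\<^sup>-\<^sup>1 x)\<close>.
\<close>

definition crossed_base :: "('g, 'm) monoid_scheme \<Rightarrow> 'x measure \<Rightarrow> ('x \<times> 'g) measure" where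
  "crossed_base G X = X \<Otimes>\<^sub>M count_space (carrier G)"

definition mult_op :: "('x \<Rightarrow> complex) \<Rightarrow> ('x \<times> 'g \<Rightarrow> complex) \<Rightarrow> ('x \<times> 'g \<Rightarrow> complex)" where
  "mult_op f \<xi> = (\<lambda>(x, h). f x * \<xi> (x, h))"

definition group_unitary ::
    "('g, 'm) monoid_scheme \<Rightarrow> ('g \<Rightarrow> 'x \<Rightarrow> 'x) \<Rightarrow> 'g \<Rightarrow> ('x \<times> 'g \<Rightarrow> complex) \<Rightarrow> ('x \<times> 'g \<Rightarrow> complex)" where
  "group_unitary G \<alpha> g \<xi> = (\<lambda>(x, h). \<xi> (\<alpha> (inv\<^bsub>G\<^esub> g) x, inv\<^bsub>G\<^esub> g \<otimes>\<^bsub>G\<^esub> h))"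

text \<open>\<open>L(G)\<close> inside the crossed product.\<close>

definition group_vN ::
    "('g, 'm) monoid_scheme \<Rightarrow> 'x measure \<Rightarrow> ('g \<Rightarrow> 'x \<Rightarrow> 'x) \<Rightarrow>
       (('x \<times> 'g \<Rightarrow> complex) \<Rightarrow> ('x \<times> 'g \<Rightarrow> complex)) set" where
  "group_vN G X \<alpha> = vN_generated (crossed_base G X) (group_unitary G \<alpha> ` carrier G)"

definition crossed_product ::
    "('g, 'm) monoid_scheme \<Rightarrow> 'x measure \<Rightarrow> ('g \<Rightarrow> 'x \<Rightarrow> 'x) \<Rightarrow>
       (('x \<times> 'g \<Rightarrow> complex) \<Rightarrow> ('x \<times> 'g \<Rightarrow> complex)) set" where
  "crossed_product G X \<alpha> =
     vN_generated (crossed_base G X) (mult_op ` Linf X \<union> group_unitary G \<alpha> ` carrier G)"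

text \<open>
  For a factor map \<open>\<pi>\<close> from \<open>X\<close> to \<open>Y\<close>, the algebra \<open>L\<^sup>\<infinity>(Y)\<close> is identified with the
  functions \<open>f \<circ> \<pi>\<close> in \<open>L\<^sup>\<infinity>(X)\<close>, and its crossed product by \<open>G\<close> with the subalgebra of the
  crossed product of \<open>L\<^sup>\<infinity>(X)\<close> that these functions and \<open>G\<close> generate.
\<close>

definition factor_crossed_product ::
    "('g, 'm) monoid_scheme \<Rightarrow> 'x measure \<Rightarrow> ('g \<Rightarrow> 'x \<Rightarrow> 'x) \<Rightarrow> 'y measure \<Rightarrow> ('x \<Rightarrow> 'y) \<Rightarrow>
       (('x \<times> 'g \<Rightarrow> complex) \<Rightarrow> ('x \<times> 'g \<Rightarrow> complex)) set" where
  "factor_crossed_product G X \<alpha> Y \<pi> =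
     vN_generated (crossed_base G X)
       (mult_op ` {f \<circ> \<pi> | f. f \<in> Linf Y} \<union> group_unitary G \<alpha> ` carrier G)"

end

theory Submission
  imports Defs
begin

text \<open>
  Let \<open>vacuum = 1 \<otimes> \<delta>\<^sub>1\<close>, and let \<open>e\<close> be the projection onto the closure of \<open>P vacuum\<close>. It commutes with
  conjugation by the group unitaries. The normal subgroup \<open>N n\<close> acts trivially on \<open>G / N n\<close>, so \<open>e\<close> maps the functions on \<open>G / N n\<close>
  to vectors fixed by conjugation by \<open>N n\<close>. As \<open>G\<close> is ICC and \<open>N n\<close> has finite index, all nontrivial
  \<open>N n\<close>-conjugacy classes are infinite, so these vectors are supported on the identity; there they are
  \<open>N n\<close>-invariant functions on \<open>X\<close>, that is, functions on \<open>G / N n\<close>. Hence the conditional expectation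
  onto \<open>P\<close> maps \<open>L\<^sup>\<infinity>(X)\<close> into itself, and \<open>P\<close> is generated by \<open>G\<close> and \<open>P \<inter> L\<^sup>\<infinity>(X)\<close>. As \<open>Y\<close> one can take
  the set \<open>X\<close> with the \<open>\<sigma>\<close>-algebra of those sets whose indicator functions belong to \<open>P\<close>.
\<close>

section \<open>Square integrable functions\<close>

text \<open>Two obstacles shape the proof. A vector in the closure of \<open>P vacuum\<close> need
  not come from a bounded operator; but the projection of a cylinder indicator turns out to be
  \<open>b \<otimes> \<delta>\<^sub>1\<close> for a function \<open>b\<close> on a finite set, and
  multiplication by \<open>b\<close> is bounded. That operator must then be shown to belong to
  \<open>P\<close>, although only its vacuum vector is known to be a limit of vectors
  \<open>p vacuum\<close>, without any bound on the norms of the operators \<open>p\<close>. This is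
  \<open>bicommutant_vacuum_closed\<close>: operators commuting with all right multiplications are
  twisted convolutions, so their matrix coefficients depend on the vacuum vector alone, and
  continuously. The same closedness makes the sets with indicators in \<open>P\<close> a
  sigma-algebra, and it finally puts \<open>P\<close> into every von Neumann algebra containing
  \<open>G\<close> and the bounded functions on \<open>Y\<close>. Since operators act on
  representatives of functions, their identities are kept as statements almost everywhere and tested
  by inner products.\<close>

lemma borel_measurable_cnj [measurable (raw)]:
  "f \<in> borel_measurable M \<Longrightarrow> (\<lambda>x. cnj (f x)) \<in> borel_measurable M"
  by (rule measurable_compose[where N = borel]) (auto intro!: borel_measurable_continuous_onI continuous_intros)

lemma L2_measurable: "f \<in> L2 M \<Longrightarrow> f \<in> borel_measurable M"
  and L2_integrable: "f \<in> L2 M \<Longrightarrow> integrable M (\<lambda>x. (cmod (f x))\<^sup>2)"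
  by (auto simp: L2_def)

lemma cmod_add_sq_le: "(cmod (a + b))\<^sup>2 \<le> 2 * (cmod a)\<^sup>2 + 2 * (cmod b)\<^sup>2"
proof -
  have "(cmod (a + b))\<^sup>2 \<le> (cmod a + cmod b)\<^sup>2"
    by (intro power_mono norm_triangle_ineq) auto
  also have "\<dots> \<le> 2 * (cmod a)\<^sup>2 + 2 * (cmod b)\<^sup>2"
    using sum_squares_bound[of "cmod a" "cmod b"] by (simp add: power2_sum)
  finally show ?thesis .
qed

lemma L2_add:
  assumes "f \<in> L2 M" "g \<in> L2 M"
  shows "(\<lambda>x. f x + g x) \<in> L2 M"
proof -
  note [measurable] = assms[THEN L2_measurable]
  have "integrable M (\<lambda>x. 2 * (cmod (f x))\<^sup>2 + 2 * (cmod (g x))\<^sup>2)"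
    using assms by (intro Bochner_Integration.integrable_add integrable_mult_right) (auto simp: L2_def)
  then have "integrable M (\<lambda>x. (cmod (f x + g x))\<^sup>2)"
    by (rule Bochner_Integration.integrable_bound) (auto intro!: AE_I2 cmod_add_sq_le)
  then show ?thesis by (simp add: L2_def)
qed

lemma L2_scale: "f \<in> L2 M \<Longrightarrow> (\<lambda>x. c * f x) \<in> L2 M"
  unfolding L2_def by (auto simp: norm_mult power_mult_distrib)

lemma L2_zero: "(\<lambda>x. 0) \<in> L2 M"
  unfolding L2_def by auto

lemma L2_diff: "f \<in> L2 M \<Longrightarrow> g \<in> L2 M \<Longrightarrow> (\<lambda>x. f x - g x) \<in> L2 M"
  using L2_add[of f M "\<lambda>x. (-1) * g x"] L2_scale[of g M "-1"] by simp

lemmas L2_intros = L2_add L2_scale L2_zero L2_diff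

lemma L2_inner_integrable:
  assumes "f \<in> L2 M" "g \<in> L2 M"
  shows "integrable M (\<lambda>x. f x * cnj (g x))"
proof (rule Bochner_Integration.integrable_bound)
  show "integrable M (\<lambda>x. (cmod (f x))\<^sup>2 + (cmod (g x))\<^sup>2)"
    using assms by (intro Bochner_Integration.integrable_add L2_integrable)
  show "(\<lambda>x. f x * cnj (g x)) \<in> borel_measurable M"
    using assms[THEN L2_measurable] by (intro borel_measurable_times borel_measurable_cnj)
  have "cmod (f x * cnj (g x)) \<le> norm ((cmod (f x))\<^sup>2 + (cmod (g x))\<^sup>2)" for x
  proof -
    have "cmod (f x) * cmod (g x) \<le> 2 * cmod (f x) * cmod (g x)" by simp
    also have "\<dots> \<le> (cmod (f x))\<^sup>2 + (cmod (g x))\<^sup>2"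
      by (rule sum_squares_bound)
    finally show ?thesis by (simp add: norm_mult)
  qed
  then show "AE x in M. cmod (f x * cnj (g x)) \<le> norm ((cmod (f x))\<^sup>2 + (cmod (g x))\<^sup>2)"
    by simp
qed

lemma L2_inner_add_left:
  "f \<in> L2 M \<Longrightarrow> g \<in> L2 M \<Longrightarrow> h \<in> L2 M \<Longrightarrow>
    L2_inner M (\<lambda>x. f x + g x) h = L2_inner M f h + L2_inner M g h"
  unfolding L2_inner_def
  by (simp add: distrib_right L2_inner_integrable Bochner_Integration.integral_add)

lemma L2_inner_add_right:
  "f \<in> L2 M \<Longrightarrow> g \<in> L2 M \<Longrightarrow> h \<in> L2 M \<Longrightarrow>
    L2_inner M h (\<lambda>x. f x + g x) = L2_inner M h f + L2_inner M h g"
  unfolding L2_inner_def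
  by (simp add: distrib_left L2_inner_integrable Bochner_Integration.integral_add)

lemma L2_inner_diff_left:
  "f \<in> L2 M \<Longrightarrow> g \<in> L2 M \<Longrightarrow> h \<in> L2 M \<Longrightarrow>
    L2_inner M (\<lambda>x. f x - g x) h = L2_inner M f h - L2_inner M g h"
  unfolding L2_inner_def
  by (simp add: left_diff_distrib L2_inner_integrable Bochner_Integration.integral_diff)

lemma L2_inner_diff_right:
  "f \<in> L2 M \<Longrightarrow> g \<in> L2 M \<Longrightarrow> h \<in> L2 M \<Longrightarrow>
    L2_inner M h (\<lambda>x. f x - g x) = L2_inner M h f - L2_inner M h g"
  unfolding L2_inner_def
  by (simp add: right_diff_distrib L2_inner_integrable Bochner_Integration.integral_diff)

lemma L2_inner_scale_left: "L2_inner M (\<lambda>x. c * f x) g = c * L2_inner M f g"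
  unfolding L2_inner_def by (simp add: mult.assoc)

lemma L2_inner_scale_right: "L2_inner M f (\<lambda>x. c * g x) = cnj c * L2_inner M f g"
  unfolding L2_inner_def by (simp add: mult.left_commute)

lemma L2_inner_cnj: "L2_inner M g f = cnj (L2_inner M f g)"
  unfolding L2_inner_def by (subst Bochner_Integration.integral_cnj[symmetric]) (simp add: mult.commute)

lemma L2_norm_nonneg: "0 \<le> L2_norm M f"
  unfolding L2_norm_def by simp

lemma L2_norm_sq: "(L2_norm M f)\<^sup>2 = (\<integral>x. (cmod (f x))\<^sup>2 \<partial>M)"
  unfolding L2_norm_def by simp

lemma L2_inner_self: "L2_inner M f f = of_real ((L2_norm M f)\<^sup>2)"
  unfolding L2_inner_def L2_norm_sq integral_complex_of_real[symmetric]
  by (intro Bochner_Integration.integral_cong) (auto simp: complex_norm_square simp del: of_real_power)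

lemma L2_norm_cong_AE:
  assumes "f \<in> borel_measurable M" "g \<in> borel_measurable M" "AE x in M. f x = g x"
  shows "L2_norm M f = L2_norm M g"
  unfolding L2_norm_def using assms by (intro arg_cong[where f = sqrt] integral_cong_AE) auto

lemma L2_inner_cong_AE:
  assumes "f \<in> L2 M" "f' \<in> L2 M" "g \<in> L2 M" "g' \<in> L2 M"
    "AE x in M. f x = f' x" "AE x in M. g x = g' x"
  shows "L2_inner M f g = L2_inner M f' g'"
  unfolding L2_inner_def
  by (intro integral_cong_AE borel_measurable_integrable L2_inner_integrable) (use assms in auto)

lemma L2_norm_eq_0_iff:
  assumes "f \<in> L2 M"
  shows "L2_norm M f = 0 \<longleftrightarrow> (AE x in M. f x = 0)"
  using integral_nonneg_eq_0_iff_AE[OF L2_integrable[OF assms]] by (simp add: L2_norm_def)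

lemma L2_inner_self_eq_0:
  assumes "f \<in> L2 M" "L2_inner M f f = 0"
  shows "AE x in M. f x = 0"
  using assms L2_norm_eq_0_iff[of f M] by (simp add: L2_inner_self)

lemma L2_norm_scale: "L2_norm M (\<lambda>x. c * f x) = cmod c * L2_norm M f"
  unfolding L2_norm_def by (simp add: norm_mult power_mult_distrib real_sqrt_mult)

lemma L2_norm_minus_commute: "L2_norm M (\<lambda>x. f x - g x) = L2_norm M (\<lambda>x. g x - f x)"
  unfolding L2_norm_def by (simp add: norm_minus_commute)

lemma L2_norm_add_sq:
  assumes "f \<in> L2 M" "g \<in> L2 M"
  shows "(L2_norm M (\<lambda>x. f x + g x))\<^sup>2 = (L2_norm M f)\<^sup>2 + 2 * Re (L2_inner M f g) + (L2_norm M g)\<^sup>2"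
proof -
  have "complex_of_real ((L2_norm M (\<lambda>x. f x + g x))\<^sup>2)
      = L2_inner M f f + L2_inner M f g + (L2_inner M g f + L2_inner M g g)"
    unfolding L2_inner_self[symmetric]
    by (subst L2_inner_add_left L2_inner_add_right; (intro L2_intros assms)?)+ simp
  also have "\<dots> = of_real ((L2_norm M f)\<^sup>2 + 2 * Re (L2_inner M f g) + (L2_norm M g)\<^sup>2)"
    unfolding L2_inner_self L2_inner_cnj[of M g f] by (simp add: complex_eq_iff)
  finally show ?thesis
    using of_real_eq_iff by blast
qed

lemma L2_norm_diff_sq:
  assumes "f \<in> L2 M" "g \<in> L2 M"
  shows "(L2_norm M (\<lambda>x. f x - g x))\<^sup>2 = (L2_norm M f)\<^sup>2 - 2 * Re (L2_inner M f g) + (L2_norm M g)\<^sup>2"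
  using L2_norm_add_sq[OF assms(1) L2_scale[OF assms(2), of "-1"]] L2_norm_scale[of M "-1" g]
    L2_inner_scale_right[of M f "-1" g] by simp

text \<open>The vector \<open>f - t z g\<close>, with \<open>z\<close> the inner product itself and
  \<open>t\<close> real, has nonnegative squared norm, and the factor \<open>z\<close> makes the
  cross term real. The quadratic inequality in \<open>t\<close> is then evaluated at a single
  point.\<close>

lemma L2_Cauchy_Schwarz:
  assumes f: "f \<in> L2 M" and g: "g \<in> L2 M"
  shows "cmod (L2_inner M f g) \<le> L2_norm M f * L2_norm M g"
proof -
  define z where "z = L2_inner M f g"
  have *: "0 \<le> (L2_norm M f)\<^sup>2 - 2 * t * (cmod z)\<^sup>2 + t\<^sup>2 * (cmod z)\<^sup>2 * (L2_norm M g)\<^sup>2" for t :: real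
  proof -
    have "0 \<le> (L2_norm M (\<lambda>x. f x - (of_real t * z) * g x))\<^sup>2" by simp
    also have "\<dots> = (L2_norm M f)\<^sup>2 - 2 * Re (cnj (of_real t * z) * z) + (cmod (of_real t * z) * L2_norm M g)\<^sup>2"
      by (subst L2_norm_diff_sq; (intro L2_intros assms)?)
        (simp add: L2_inner_scale_right L2_norm_scale z_def)
    also have "cnj (of_real t * z) * z = of_real (t * (cmod z)\<^sup>2)"
      using complex_norm_square[of z] by (simp add: mult.commute mult.left_commute)
    finally show ?thesis by (simp add: power_mult_distrib norm_mult)
  qed
  have "(cmod z)\<^sup>2 \<le> (L2_norm M f * L2_norm M g)\<^sup>2"
  proof (cases "L2_norm M g = 0")
    case True
    have "(cmod z)\<^sup>2 = 0"
    proof (rule ccontr)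
      assume "(cmod z)\<^sup>2 \<noteq> 0"
      \<comment> \<open>At this value of \<open>t\<close> the right-hand side of \<open>*\<close>
        equals \<open>-1\<close>.\<close>
      then show False
        using *[of "((L2_norm M f)\<^sup>2 + 1) / (2 * (cmod z)\<^sup>2)"] True by simp
    qed
    then show ?thesis by simp
  next
    case False
    \<comment> \<open>The value of \<open>t\<close> is the minimizer of the quadratic.\<close>
    then show ?thesis
      using *[of "1 / (L2_norm M g)\<^sup>2"]
      by (simp add: power2_eq_square divide_simps split: if_splits) (simp add: algebra_simps)
  qed
  then show ?thesis
    unfolding z_def by (rule power2_le_imp_le) (simp add: L2_norm_nonneg)
qed

lemma L2_norm_triangle:
  assumes "f \<in> L2 M" "g \<in> L2 M"
  shows "L2_norm M (\<lambda>x. f x + g x) \<le> L2_norm M f + L2_norm M g"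
proof (rule power2_le_imp_le)
  have "Re (L2_inner M f g) \<le> L2_norm M f * L2_norm M g"
    by (rule order_trans[OF complex_Re_le_cmod L2_Cauchy_Schwarz[OF assms]])
  then show "(L2_norm M (\<lambda>x. f x + g x))\<^sup>2 \<le> (L2_norm M f + L2_norm M g)\<^sup>2"
    unfolding L2_norm_add_sq[OF assms] by (simp add: power2_sum)
qed (simp add: L2_norm_nonneg)

lemma L2_norm_triangle_diff:
  assumes "f \<in> L2 M" "g \<in> L2 M" "h \<in> L2 M"
  shows "L2_norm M (\<lambda>x. f x - h x) \<le> L2_norm M (\<lambda>x. f x - g x) + L2_norm M (\<lambda>x. g x - h x)"
  using L2_norm_triangle[OF L2_diff[OF assms(1,2)] L2_diff[OF assms(2,3)]] by simp

lemma L2_inner_tendsto_left: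
  assumes "\<And>k. f k \<in> L2 M" "w \<in> L2 M" "g \<in> L2 M"
    and "(\<lambda>k. L2_norm M (\<lambda>x. f k x - w x)) \<longlonglongrightarrow> 0"
  shows "(\<lambda>k. L2_inner M (f k) g) \<longlonglongrightarrow> L2_inner M w g"
proof (rule LIM_zero_cancel, rule Lim_null_comparison)
  show "\<forall>\<^sub>F k in sequentially. norm (L2_inner M (f k) g - L2_inner M w g) \<le> L2_norm M (\<lambda>x. f k x - w x) * L2_norm M g"
    using L2_Cauchy_Schwarz[OF L2_diff[OF assms(1,2)] assms(3)] by (simp add: L2_inner_diff_left assms)
  show "(\<lambda>k. L2_norm M (\<lambda>x. f k x - w x) * L2_norm M g) \<longlonglongrightarrow> 0"
    using tendsto_mult_right[OF assms(4), of "L2_norm M g"] by simp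
qed

lemma L2_inner_tendsto_right:
  assumes "\<And>k. f k \<in> L2 M" "w \<in> L2 M" "g \<in> L2 M"
    and "(\<lambda>k. L2_norm M (\<lambda>x. f k x - w x)) \<longlonglongrightarrow> 0"
  shows "(\<lambda>k. L2_inner M g (f k)) \<longlonglongrightarrow> L2_inner M g w"
  using tendsto_cnj[OF L2_inner_tendsto_left[OF assms]] by (simp flip: L2_inner_cnj)

section \<open>Completeness and orthogonal projection\<close>

lemma nn_integral_cmod_sq:
  assumes "f \<in> L2 M"
  shows "(\<integral>\<^sup>+x. ennreal ((cmod (f x))\<^sup>2) \<partial>M) = ennreal ((L2_norm M f)\<^sup>2)"
  unfolding L2_norm_sq using L2_integrable[OF assms] by (intro nn_integral_eq_integral) auto

lemma L2I_nn_integral: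
  assumes "f \<in> borel_measurable M" "(\<integral>\<^sup>+x. ennreal ((cmod (f x))\<^sup>2) \<partial>M) \<le> ennreal (c\<^sup>2)" "0 \<le> c"
  shows "f \<in> L2 M" "L2_norm M f \<le> c"
proof -
  show *: "f \<in> L2 M"
  proof -
    have "integrable M (\<lambda>x. (cmod (f x))\<^sup>2)"
    proof (rule integrableI_bounded)
      show "(\<integral>\<^sup>+x. ennreal (norm ((cmod (f x))\<^sup>2)) \<partial>M) < \<infinity>"
        using le_less_trans[OF assms(2) ennreal_less_top] by simp
    qed (use assms(1) in measurable)
    with assms(1) show ?thesis by (simp add: L2_def)
  qed
  have "(L2_norm M f)\<^sup>2 \<le> c\<^sup>2"
    using assms(2) unfolding nn_integral_cmod_sq[OF *] by simp
  then show "L2_norm M f \<le> c"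
    using assms(3) by (rule power2_le_imp_le)
qed

text \<open>Riesz-Fischer argument: a subsequence whose steps decay like \<open>4^-k\<close>
  converges pointwise almost everywhere, and Fatou's lemma turns the Cauchy estimate into norm
  convergence of the whole sequence.\<close>

proposition L2_complete:
  assumes f: "\<And>k. f k \<in> L2 M"
    and cauchy: "\<And>e. e > 0 \<Longrightarrow> \<exists>K. \<forall>m\<ge>K. \<forall>n\<ge>K. L2_norm M (\<lambda>x. f m x - f n x) < e"
  shows "\<exists>w \<in> L2 M. (\<lambda>k. L2_norm M (\<lambda>x. f k x - w x)) \<longlonglongrightarrow> 0"
proof -
  have "\<exists>K. \<forall>m\<ge>K. \<forall>n\<ge>K. L2_norm M (\<lambda>x. f m x - f n x) < (1/4) ^ k" for k
    using cauchy[of "(1/4)^k"] by simp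
  then obtain \<kappa> where \<kappa>: "\<And>k m n. \<lbrakk>m \<ge> \<kappa> k; n \<ge> \<kappa> k\<rbrakk> \<Longrightarrow> L2_norm M (\<lambda>x. f m x - f n x) < (1/4) ^ k"
    by metis
  \<comment> \<open>Adding up the thresholds puts both \<open>r k\<close> and
    \<open>r (Suc k)\<close> beyond \<open>\<kappa> k\<close>; the summand \<open>k\<close> lets the
    subsequence pass any given bound.\<close>
  define r where "r k = (\<Sum>j\<le>k. \<kappa> j) + k" for k
  have r_ge: "\<kappa> k \<le> r k" "\<kappa> k \<le> r (Suc k)" "k \<le> r k" for k
    unfolding r_def using member_le_sum[of k "{..k}" \<kappa>] member_le_sum[of k "{..Suc k}" \<kappa>] by auto
  define d where "d k x = f (r (Suc k)) x - f (r k) x" for k x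
  have d: "d k \<in> L2 M" for k
    unfolding d_def by (intro L2_intros f)
  have meas[measurable]: "d k \<in> borel_measurable M" "f k \<in> borel_measurable M" for k
    using d f by (auto simp: L2_def)
  have d_le: "L2_norm M (d k) \<le> (1/4) ^ k" for k
    unfolding d_def using \<kappa>[of k "r (Suc k)" "r k"] r_ge by (simp add: less_imp_le)
  \<comment> \<open>The weight \<open>4 ^ k\<close> is beaten by the square of
    \<open>(1/4) ^ k\<close>, yet it is large enough that a finite sum at \<open>x\<close> forces
    \<open>d k x\<close> to decay like \<open>2^-k\<close>.\<close>
  have "(\<integral>\<^sup>+x. (\<Sum>k. ennreal (4 ^ k * (cmod (d k x))\<^sup>2)) \<partial>M) = (\<Sum>k. \<integral>\<^sup>+x. ennreal (4 ^ k * (cmod (d k x))\<^sup>2) \<partial>M)"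
    by (intro nn_integral_suminf) simp
  also have "\<dots> = (\<Sum>k. ennreal (4 ^ k * (L2_norm M (d k))\<^sup>2))"
    by (intro suminf_cong) (simp add: ennreal_mult nn_integral_cmult nn_integral_cmod_sq[OF d])
  also have "\<dots> \<le> (\<Sum>k. ennreal ((1/4) ^ k))"
  proof (intro suminf_le ennreal_leI)
    fix k
    have "(L2_norm M (d k))\<^sup>2 \<le> ((1/4) ^ k)\<^sup>2"
      using d_le[of k] L2_norm_nonneg[of M "d k"] by (intro power_mono)
    then show "4 ^ k * (L2_norm M (d k))\<^sup>2 \<le> (1/4) ^ k"
      by (simp add: field_simps power2_eq_square)
  qed auto
  also have "\<dots> = ennreal (\<Sum>k. (1/4) ^ k)"
    by (intro suminf_ennreal2) (auto intro: summable_geometric)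
  finally have "(\<integral>\<^sup>+x. (\<Sum>k. ennreal (4 ^ k * (cmod (d k x))\<^sup>2)) \<partial>M) \<noteq> \<infinity>"
    by (auto simp: top_unique)
  then have "AE x in M. (\<Sum>k. ennreal (4 ^ k * (cmod (d k x))\<^sup>2)) \<noteq> \<infinity>"
    by (intro nn_integral_noteq_infinite) auto
  then have conv: "AE x in M. convergent (\<lambda>k. f (r k) x)"
  proof eventually_elim
    case (elim x)
    have le_suminf: "a k \<le> (\<Sum>k. a k)" for a :: "nat \<Rightarrow> ennreal" and k
      using sum_le_suminf[of a "{k}"] by simp
    have "\<exists>C\<ge>0. s = ennreal C" if "s \<noteq> \<infinity>" for s
      using that by (cases s) auto
    from this[OF elim] obtain C where C: "0 \<le> C" "(\<Sum>k. ennreal (4 ^ k * (cmod (d k x))\<^sup>2)) = ennreal C"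
      by blast
    have "norm (d k x) \<le> sqrt C * (1/2) ^ k" for k
    proof -
      have "ennreal (4 ^ k * (cmod (d k x))\<^sup>2) \<le> (\<Sum>k. ennreal (4 ^ k * (cmod (d k x))\<^sup>2))"
        by (rule le_suminf)
      then have "4 ^ k * (cmod (d k x))\<^sup>2 \<le> C"
        unfolding C(2) using C(1) by (simp only: ennreal_le_iff)
      then have "(2 ^ k * cmod (d k x))\<^sup>2 \<le> C"
        by (simp add: power_mult_distrib power_even_eq[symmetric] power_mult)
      then have "2 ^ k * cmod (d k x) \<le> sqrt C"
        by (rule real_le_rsqrt)
      then have "2 ^ k * cmod (d k x) * (1/2) ^ k \<le> sqrt C * (1/2) ^ k"
        by (rule mult_right_mono) simp
      moreover have "2 ^ k * (1/2) ^ k = (1::real)"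
        by (simp only: power_mult_distrib[symmetric]) simp
      then have "2 ^ k * cmod (d k x) * (1/2) ^ k = cmod (d k x)"
        by (metis mult.assoc mult.commute mult_1)
      ultimately show ?thesis by (simp only:)
    qed
    note bnd = this
    have "summable (\<lambda>k. d k x)"
    proof (rule summable_comparison_test')
      show "summable (\<lambda>k. sqrt C * (1/2) ^ k)"
        by (intro summable_mult summable_geometric) simp
      show "norm (d k x) \<le> sqrt C * (1/2) ^ k" if "k \<ge> 0" for k
        by (rule bnd)
    qed
    then have "convergent (\<lambda>n. \<Sum>k<n. d k x)"
      by (rule iffD1[OF summable_iff_convergent])
    moreover have "(\<Sum>k<n. d k x) = f (r n) x - f (r 0) x" for n
      unfolding d_def by (rule sum_lessThan_telescope)
    ultimately show ?case
      by (simp only: convergent_diff_const_right_iff)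
  qed
  define w where "w x = lim (\<lambda>k. f (r k) x)" for x
  have [measurable]: "w \<in> borel_measurable M"
    unfolding w_def by measurable
  have lim: "AE x in M. (\<lambda>k. f (r k) x) \<longlonglongrightarrow> w x"
    using conv by eventually_elim (simp add: w_def convergent_LIMSEQ_iff)
  \<comment> \<open>Fatou's lemma along \<open>r\<close>. The bound is stated for the nonnegative
    integral because square integrability of \<open>w\<close> is only derived from it.\<close>
  have bound: "(\<integral>\<^sup>+x. ennreal ((cmod (f n x - w x))\<^sup>2) \<partial>M) \<le> ennreal (e\<^sup>2)"
    if e: "e > 0" and K: "\<And>m. m \<ge> K \<Longrightarrow> L2_norm M (\<lambda>x. f n x - f m x) < e" for n e K
  proof -
    have "(\<integral>\<^sup>+x. ennreal ((cmod (f n x - w x))\<^sup>2) \<partial>M)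
        = (\<integral>\<^sup>+x. liminf (\<lambda>k. ennreal ((cmod (f n x - f (r k) x))\<^sup>2)) \<partial>M)"
    proof (rule nn_integral_cong_AE)
      show "AE x in M. ennreal ((cmod (f n x - w x))\<^sup>2) = liminf (\<lambda>k. ennreal ((cmod (f n x - f (r k) x))\<^sup>2))"
        using lim
      proof eventually_elim
        case (elim x)
        then have "(\<lambda>k. ennreal ((cmod (f n x - f (r k) x))\<^sup>2)) \<longlonglongrightarrow> ennreal ((cmod (f n x - w x))\<^sup>2)"
          by (intro tendsto_ennrealI tendsto_power tendsto_norm tendsto_diff tendsto_const)
        then show ?case
          by (metis lim_imp_Liminf trivial_limit_sequentially)
      qed
    qed
    also have "\<dots> \<le> liminf (\<lambda>k. \<integral>\<^sup>+x. ennreal ((cmod (f n x - f (r k) x))\<^sup>2) \<partial>M)"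
      by (intro nn_integral_liminf) simp
    also have "\<dots> \<le> ennreal (e\<^sup>2)"
    proof (rule Liminf_le)
      have "(\<integral>\<^sup>+x. ennreal ((cmod (f n x - f (r k) x))\<^sup>2) \<partial>M) \<le> ennreal (e\<^sup>2)" if "k \<ge> K" for k
      proof -
        have "L2_norm M (\<lambda>x. f n x - f (r k) x) < e"
          using K[of "r k"] r_ge(3)[of k] that by simp
        then show ?thesis
          unfolding nn_integral_cmod_sq[OF L2_diff[OF f f]]
          by (intro ennreal_leI power_mono less_imp_le L2_norm_nonneg)
      qed
      then show "\<forall>\<^sub>F k in sequentially. (\<integral>\<^sup>+x. ennreal ((cmod (f n x - f (r k) x))\<^sup>2) \<partial>M) \<le> ennreal (e\<^sup>2)"
        by (auto simp: eventually_sequentially)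
    qed simp
    finally show ?thesis .
  qed
  have 1: "\<exists>K. \<forall>n\<ge>K. (\<lambda>x. f n x - w x) \<in> L2 M \<and> L2_norm M (\<lambda>x. f n x - w x) \<le> e" if e: "e > 0" for e
  proof -
    obtain K where K: "\<And>m n. m \<ge> K \<Longrightarrow> n \<ge> K \<Longrightarrow> L2_norm M (\<lambda>x. f m x - f n x) < e"
      using cauchy[OF e] by blast
    show ?thesis
    proof (intro exI[of _ K] allI impI)
      fix n assume "n \<ge> K"
      then have "(\<integral>\<^sup>+x. ennreal ((cmod (f n x - w x))\<^sup>2) \<partial>M) \<le> ennreal (e\<^sup>2)"
        using K by (intro bound[OF e]) auto
      then show "(\<lambda>x. f n x - w x) \<in> L2 M \<and> L2_norm M (\<lambda>x. f n x - w x) \<le> e"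
        using e by (intro conjI L2I_nn_integral) auto
    qed
  qed
  obtain K where "(\<lambda>x. f K x - w x) \<in> L2 M"
    using 1[of 1] by auto
  then have "w \<in> L2 M"
    using L2_diff[OF f[of K], of "\<lambda>x. f K x - w x"] by simp
  moreover have "(\<lambda>k. L2_norm M (\<lambda>x. f k x - w x)) \<longlonglongrightarrow> 0"
  proof (rule LIMSEQ_I)
    fix e :: real assume "e > 0"
    then obtain K where "\<forall>n\<ge>K. L2_norm M (\<lambda>x. f n x - w x) \<le> e / 2"
      using 1[of "e/2"] by auto
    with \<open>e > 0\<close> show "\<exists>no. \<forall>n\<ge>no. norm (L2_norm M (\<lambda>x. f n x - w x) - 0) < e"
      by (intro exI[of _ K]) (force simp: L2_norm_nonneg)
  qed
  ultimately show ?thesis by blast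
qed

text \<open>Closedness is left out: the instances are the vectors \<open>p vacuum\<close> with
  \<open>p\<close> in an algebra, and these need not form a closed set.\<close>

definition subspace_L2 :: "'a measure \<Rightarrow> ('a \<Rightarrow> complex) set \<Rightarrow> bool" where
  "subspace_L2 M V \<longleftrightarrow> V \<subseteq> L2 M \<and> V \<noteq> {} \<and>
     (\<forall>f \<in> V. \<forall>g \<in> V. (\<lambda>x. f x + g x) \<in> V) \<and> (\<forall>c. \<forall>f \<in> V. (\<lambda>x. c * f x) \<in> V)"

text \<open>A minimizing sequence is Cauchy by the parallelogram law, and a variation in the
  direction \<open>u\<close> shows that the remainder is orthogonal to \<open>V\<close>. The
  approximating sequence belongs to the conclusion because later arguments need the operators behind
  the vectors \<open>v k\<close>.\<close>

proposition L2_projection: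
  assumes V: "subspace_L2 M V" and f: "f \<in> L2 M"
  shows "\<exists>w v. w \<in> L2 M \<and> (\<forall>k. v k \<in> V) \<and> (\<lambda>k. L2_norm M (\<lambda>x. v k x - w x)) \<longlonglongrightarrow> 0 \<and>
    (\<forall>u\<in>V. L2_inner M (\<lambda>x. f x - w x) u = 0)"
proof -
  have VL: "\<And>u. u \<in> V \<Longrightarrow> u \<in> L2 M"
    and V_add: "\<And>u v. u \<in> V \<Longrightarrow> v \<in> V \<Longrightarrow> (\<lambda>x. u x + v x) \<in> V"
    and V_scale: "\<And>c u. u \<in> V \<Longrightarrow> (\<lambda>x. c * u x) \<in> V" and "V \<noteq> {}"
    using V by (auto simp: subspace_L2_def)
  define d where "d = (INF u\<in>V. (L2_norm M (\<lambda>x. f x - u x))\<^sup>2)"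
  have bdd: "bdd_below ((\<lambda>u. (L2_norm M (\<lambda>x. f x - u x))\<^sup>2) ` V)"
    by (auto intro!: bdd_belowI[where m = 0])
  have d_le: "d \<le> (L2_norm M (\<lambda>x. f x - u x))\<^sup>2" if "u \<in> V" for u
    unfolding d_def by (intro cINF_lower bdd that)
  have "\<exists>u\<in>V. (L2_norm M (\<lambda>x. f x - u x))\<^sup>2 < d + 1 / real (Suc k)" for k
    unfolding d_def using cINF_less_iff[OF \<open>V \<noteq> {}\<close> bdd, of "d + 1 / real (Suc k)"]
    by (simp add: d_def)
  then obtain v where vV: "\<And>k. v k \<in> V"
    and v_less: "\<And>k. (L2_norm M (\<lambda>x. f x - v k x))\<^sup>2 < d + 1 / real (Suc k)"
    by metis
  have v: "v k \<in> L2 M" for k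
    using vV VL by blast
  have parallelogram: "(L2_norm M (\<lambda>x. v m x - v n x))\<^sup>2 \<le> 2 / real (Suc m) + 2 / real (Suc n)" for m n
  proof -
    have fm: "(\<lambda>x. f x - v m x) \<in> L2 M" and fn: "(\<lambda>x. f x - v n x) \<in> L2 M"
      by (intro L2_diff f v)+
    \<comment> \<open>The midpoint of two near-minimizers lies in \<open>V\<close>, which bounds the
      norm of the sum of the two remainders from below.\<close>
    have "(\<lambda>x. (1/2) * v m x + (1/2) * v n x) \<in> V"
      by (intro V_add V_scale vV)
    then have "d \<le> (L2_norm M (\<lambda>x. f x - ((1/2) * v m x + (1/2) * v n x)))\<^sup>2"
      by (rule d_le)
    also have "(\<lambda>x. f x - ((1/2) * v m x + (1/2) * v n x)) = (\<lambda>x. (1/2) * ((f x - v m x) + (f x - v n x)))"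
      by (auto simp: algebra_simps)
    also have "(L2_norm M \<dots>)\<^sup>2 = (L2_norm M (\<lambda>x. (f x - v m x) + (f x - v n x)))\<^sup>2 / 4"
      by (subst L2_norm_scale) (simp add: power_divide)
    finally have "4 * d \<le> (L2_norm M (\<lambda>x. (f x - v m x) + (f x - v n x)))\<^sup>2" by simp
    moreover have "(\<lambda>x. v m x - v n x) = (\<lambda>x. (f x - v n x) - (f x - v m x))" by auto
    ultimately have "(L2_norm M (\<lambda>x. v m x - v n x))\<^sup>2
        \<le> 2 * (L2_norm M (\<lambda>x. f x - v m x))\<^sup>2 + 2 * (L2_norm M (\<lambda>x. f x - v n x))\<^sup>2 - 4 * d"
      using L2_norm_add_sq[OF fm fn] L2_norm_diff_sq[OF fn fm]
        L2_inner_cnj[of M "\<lambda>x. f x - v n x" "\<lambda>x. f x - v m x"] by simp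
    then show ?thesis
      using v_less[of m] v_less[of n] by linarith
  qed
  have cauchy: "\<exists>K. \<forall>m\<ge>K. \<forall>n\<ge>K. L2_norm M (\<lambda>x. v m x - v n x) < e" if e: "e > 0" for e
  proof -
    obtain K where K: "4 / e\<^sup>2 < real (Suc K)"
      by (meson less_trans lessI of_nat_less_iff reals_Archimedean2)
    have "L2_norm M (\<lambda>x. v m x - v n x) < e" if "m \<ge> K" "n \<ge> K" for m n
    proof -
      have "2 / real (Suc m) \<le> 2 / real (Suc K)" "2 / real (Suc n) \<le> 2 / real (Suc K)"
        using that by (auto intro!: divide_left_mono)
      then have "(L2_norm M (\<lambda>x. v m x - v n x))\<^sup>2 \<le> 4 / real (Suc K)"
        using parallelogram[of m n] by simp
      also have "\<dots> < e\<^sup>2"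
        using K e by (simp add: divide_less_eq mult.commute)
      finally show ?thesis
        using e by (simp add: power_less_imp_less_base)
    qed
    then show ?thesis by blast
  qed
  obtain w where w: "w \<in> L2 M" and lim: "(\<lambda>k. L2_norm M (\<lambda>x. v k x - w x)) \<longlonglongrightarrow> 0"
    using L2_complete[of v M, OF v cauchy] by blast
  define z where "z x = f x - w x" for x
  have z: "z \<in> L2 M"
    unfolding z_def by (intro L2_diff f w)
  \<comment> \<open>\<open>z - c u\<close> is the limit of \<open>f - (v k + c u)\<close>, whose
    squared norm is at least \<open>d\<close>, while that of \<open>z\<close> is at most
    \<open>d\<close>.\<close>
  have z_le: "(L2_norm M z)\<^sup>2 \<le> (L2_norm M (\<lambda>x. z x - c * u x))\<^sup>2" if u: "u \<in> V" for c u
  proof -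
    have up: "d \<le> (L2_norm M (\<lambda>x. z x - c * u x))\<^sup>2"
    proof (rule LIMSEQ_le_const)
      have "(\<lambda>k. (L2_norm M (\<lambda>x. z x - c * u x) + L2_norm M (\<lambda>x. v k x - w x))\<^sup>2)
          \<longlonglongrightarrow> (L2_norm M (\<lambda>x. z x - c * u x) + 0)\<^sup>2"
        by (intro tendsto_intros lim)
      then show "(\<lambda>k. (L2_norm M (\<lambda>x. z x - c * u x) + L2_norm M (\<lambda>x. v k x - w x))\<^sup>2)
          \<longlonglongrightarrow> (L2_norm M (\<lambda>x. z x - c * u x))\<^sup>2" by simp
      have "d \<le> (L2_norm M (\<lambda>x. z x - c * u x) + L2_norm M (\<lambda>x. v k x - w x))\<^sup>2" for k
      proof -
        have "d \<le> (L2_norm M (\<lambda>x. f x - (v k x + c * u x)))\<^sup>2"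
          by (intro d_le V_add V_scale vV u)
        also have "(\<lambda>x. f x - (v k x + c * u x)) = (\<lambda>x. (z x - c * u x) + (w x - v k x))"
          by (auto simp: z_def)
        also have "(L2_norm M \<dots>)\<^sup>2 \<le> (L2_norm M (\<lambda>x. z x - c * u x) + L2_norm M (\<lambda>x. w x - v k x))\<^sup>2"
          by (intro power_mono L2_norm_triangle L2_norm_nonneg L2_diff L2_scale z VL u w v)
        finally show ?thesis
          using L2_norm_minus_commute[of M w "v k"] by simp
      qed
      then show "\<exists>K. \<forall>k\<ge>K. d \<le> (L2_norm M (\<lambda>x. z x - c * u x) + L2_norm M (\<lambda>x. v k x - w x))\<^sup>2"
        by blast
    qed
    have "(L2_norm M z)\<^sup>2 \<le> d"
    proof (rule LIMSEQ_le)
      have "L2_norm M z \<le> sqrt (d + 1 / real (Suc k)) + L2_norm M (\<lambda>x. v k x - w x)" for k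
      proof -
        have "L2_norm M z \<le> L2_norm M (\<lambda>x. f x - v k x) + L2_norm M (\<lambda>x. v k x - w x)"
          unfolding z_def by (rule L2_norm_triangle_diff[OF f v w])
        moreover have "L2_norm M (\<lambda>x. f x - v k x) \<le> sqrt (d + 1 / real (Suc k))"
          using v_less[of k] by (intro real_le_rsqrt less_imp_le)
        ultimately show ?thesis by simp
      qed
      then have "(L2_norm M z)\<^sup>2 \<le> (sqrt (d + 1 / real (Suc k)) + L2_norm M (\<lambda>x. v k x - w x))\<^sup>2" for k
        by (intro power_mono L2_norm_nonneg)
      then show "\<exists>K. \<forall>k\<ge>K. (L2_norm M z)\<^sup>2 \<le> (sqrt (d + 1 / real (Suc k)) + L2_norm M (\<lambda>x. v k x - w x))\<^sup>2"
        by blast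
      have "0 \<le> d"
        unfolding d_def using \<open>V \<noteq> {}\<close> by (intro cINF_greatest) auto
      have "(\<lambda>k. (sqrt (d + 1 / real (Suc k)) + L2_norm M (\<lambda>x. v k x - w x))\<^sup>2) \<longlonglongrightarrow> (sqrt (d + 0) + 0)\<^sup>2"
        by (intro tendsto_intros lim) (use LIMSEQ_inverse_real_of_nat in \<open>simp add: divide_inverse\<close>)
      then show "(\<lambda>k. (sqrt (d + 1 / real (Suc k)) + L2_norm M (\<lambda>x. v k x - w x))\<^sup>2) \<longlonglongrightarrow> d"
        using \<open>0 \<le> d\<close> by simp
    qed (rule tendsto_const)
    with up show ?thesis by simp
  qed
  have "L2_inner M z u = 0" if u: "u \<in> V" for u
  proof (rule ccontr)
    assume nz: "L2_inner M z u \<noteq> 0"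
    define a where "a = L2_inner M z u"
    \<comment> \<open>The summand 1 keeps the denominator positive when \<open>u\<close> is zero
      almost everywhere. With \<open>c = a / s\<close> the cross term gains
      \<open>2 |a|^2 / s\<close>, and the quadratic term costs at most half of that.\<close>
    define s where "s = (L2_norm M u)\<^sup>2 + 1"
    have s: "s > 0" "(L2_norm M u)\<^sup>2 \<le> s"
      unfolding s_def by (auto intro: add_nonneg_pos)
    define c where "c = a / of_real s"
    have "(L2_norm M z)\<^sup>2 \<le> (L2_norm M (\<lambda>x. z x - c * u x))\<^sup>2"
      by (rule z_le[OF u])
    also have "\<dots> = (L2_norm M z)\<^sup>2 - 2 * Re (cnj c * a) + (cmod c * L2_norm M u)\<^sup>2"
      by (subst L2_norm_diff_sq[OF z L2_scale[OF VL[OF u]]])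
        (simp add: L2_inner_scale_right L2_norm_scale a_def)
    also have "cnj c * a = of_real ((cmod a)\<^sup>2 / s)"
      using complex_norm_square[of a] by (simp add: c_def mult.commute)
    also have "(cmod c * L2_norm M u)\<^sup>2 = (cmod a)\<^sup>2 / s * ((L2_norm M u)\<^sup>2 / s)"
      using s by (simp add: c_def norm_divide power_mult_distrib power_divide power2_eq_square)
    finally have "2 * ((cmod a)\<^sup>2 / s) \<le> (cmod a)\<^sup>2 / s * ((L2_norm M u)\<^sup>2 / s)"
      by simp
    also have "\<dots> \<le> (cmod a)\<^sup>2 / s * 1"
      using s by (intro mult_left_mono) auto
    finally have "(cmod a)\<^sup>2 / s \<le> 0" by simp
    with s nz show False
      by (simp add: a_def divide_le_0_iff)
  qed
  then show ?thesis
    using w vV lim unfolding z_def by blast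
qed

lemma L2_inner_orthogonal_limit:
  assumes "\<And>k. v k \<in> L2 M" "w \<in> L2 M" "(\<lambda>k. L2_norm M (\<lambda>x. v k x - w x)) \<longlonglongrightarrow> 0"
    and "z \<in> L2 M" "\<And>k. L2_inner M z (v k) = 0"
  shows "L2_inner M z w = 0"
  using LIMSEQ_unique[OF L2_inner_tendsto_right[OF assms(1,2,4,3)], of 0] assms(5) by simp

text \<open>The remainder of the projection is orthogonal to \<open>V\<close>, hence zero, so the
  approximating sequence converges to \<open>f\<close> itself.\<close>

proposition L2_dense:
  assumes V: "subspace_L2 M V"
    and total: "\<And>z. z \<in> L2 M \<Longrightarrow> (\<And>u. u \<in> V \<Longrightarrow> L2_inner M z u = 0) \<Longrightarrow> AE x in M. z x = 0"
    and f: "f \<in> L2 M"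
  shows "\<exists>v. (\<forall>k. v k \<in> V) \<and> (\<lambda>k. L2_norm M (\<lambda>x. v k x - f x)) \<longlonglongrightarrow> 0"
proof -
  obtain w v where w: "w \<in> L2 M" and v: "\<forall>k. v k \<in> V"
    and lim: "(\<lambda>k. L2_norm M (\<lambda>x. v k x - w x)) \<longlonglongrightarrow> 0"
    and orth: "\<forall>u\<in>V. L2_inner M (\<lambda>x. f x - w x) u = 0"
    using L2_projection[OF V f] by blast
  have vL: "v k \<in> L2 M" for k
    using v V by (auto simp: subspace_L2_def)
  have "AE x in M. f x - w x = 0"
    by (intro total orth[rule_format] L2_diff f w)
  then have "L2_norm M (\<lambda>x. v k x - w x) = L2_norm M (\<lambda>x. v k x - f x)" for k
    by (intro L2_norm_cong_AE L2_measurable L2_diff vL f w) auto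
  with lim have "(\<lambda>k. L2_norm M (\<lambda>x. v k x - f x)) \<longlonglongrightarrow> 0" by simp
  with v show ?thesis by blast
qed

section \<open>Bounded operators and commutants\<close>

definition total_L2 :: "'a measure \<Rightarrow> ('a \<Rightarrow> complex) set \<Rightarrow> bool" where
  "total_L2 M D \<longleftrightarrow> D \<subseteq> L2 M \<and>
     (\<forall>z \<in> L2 M. (\<forall>u \<in> D. L2_inner M z u = 0) \<longrightarrow> (AE x in M. z x = 0))"

text \<open>The kernel is a subspace containing \<open>D\<close>, hence dense, and the bound carries
  the vanishing over to limits. In the applications \<open>\<psi>\<close> is built from inner
  products, which are exactly additive although operators are additive only almost
  everywhere.\<close>

lemma L2_functional_eq_0:
  assumes D: "total_L2 M D"
    and add: "\<And>f g. f \<in> L2 M \<Longrightarrow> g \<in> L2 M \<Longrightarrow> \<psi> (\<lambda>x. f x + g x) = \<psi> f + \<psi> g"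
    and scale: "\<And>c f. f \<in> L2 M \<Longrightarrow> \<psi> (\<lambda>x. c * f x) = c * \<psi> f"
    and bound: "\<And>f. f \<in> L2 M \<Longrightarrow> cmod (\<psi> f) \<le> C * L2_norm M f"
    and zero: "\<And>u. u \<in> D \<Longrightarrow> \<psi> u = 0"
    and f: "f \<in> L2 M"
  shows "\<psi> f = 0"
proof -
  define V where "V = {f \<in> L2 M. \<psi> f = 0}"
  have "\<psi> (\<lambda>x. 0 * f x) = 0"
    using scale[OF f, of 0] by simp
  then have "(\<lambda>x. 0) \<in> V"
    by (simp add: V_def L2_zero)
  then have V: "subspace_L2 M V"
    unfolding subspace_L2_def by (auto simp: V_def L2_add L2_scale add scale)
  have "D \<subseteq> V"
    using zero D by (auto simp: V_def total_L2_def)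
  have "AE x in M. z x = 0" if "z \<in> L2 M" "\<And>u. u \<in> V \<Longrightarrow> L2_inner M z u = 0" for z
    using D that \<open>D \<subseteq> V\<close> unfolding total_L2_def by blast
  then obtain v where v: "\<forall>k. v k \<in> V" and lim: "(\<lambda>k. L2_norm M (\<lambda>x. v k x - f x)) \<longlonglongrightarrow> 0"
    using L2_dense[OF V _ f] by blast
  have "cmod (\<psi> f) \<le> C * L2_norm M (\<lambda>x. v k x - f x)" for k
  proof -
    have vk: "v k \<in> L2 M" "\<psi> (v k) = 0"
      using v by (auto simp: V_def)
    have "\<psi> (\<lambda>x. v k x + (-1) * f x) = - \<psi> f"
      using add[OF vk(1) L2_scale[OF f, of "-1"]] scale[OF f, of "-1"] vk(2) by simp
    moreover have "cmod (\<psi> (\<lambda>x. v k x - f x)) \<le> C * L2_norm M (\<lambda>x. v k x - f x)"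
      by (rule bound[OF L2_diff[OF vk(1) f]])
    ultimately show ?thesis by simp
  qed
  then have "cmod (\<psi> f) \<le> C * 0"
    by (intro LIMSEQ_le_const[OF tendsto_mult_left[OF lim, of C]]) blast
  then show ?thesis by simp
qed

lemma bounded_ops_L2: "T \<in> bounded_ops M \<Longrightarrow> f \<in> L2 M \<Longrightarrow> T f \<in> L2 M"
  and bounded_ops_add: "T \<in> bounded_ops M \<Longrightarrow> f \<in> L2 M \<Longrightarrow> g \<in> L2 M \<Longrightarrow>
    AE x in M. T (\<lambda>y. f y + g y) x = T f x + T g x"
  and bounded_ops_scale: "T \<in> bounded_ops M \<Longrightarrow> f \<in> L2 M \<Longrightarrow> AE x in M. T (\<lambda>y. c * f y) x = c * T f x"
  by (auto simp: bounded_ops_def)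

lemma bounded_ops_bound:
  assumes "T \<in> bounded_ops M"
  shows "\<exists>C\<ge>0. \<forall>f \<in> L2 M. L2_norm M (T f) \<le> C * L2_norm M f"
proof -
  obtain C where C: "\<forall>f \<in> L2 M. L2_norm M (T f) \<le> C * L2_norm M f"
    using assms unfolding bounded_ops_def by blast
  have "L2_norm M (T f) \<le> max C 0 * L2_norm M f" if "f \<in> L2 M" for f
    by (rule order_trans[OF C[rule_format, OF that]]) (intro mult_right_mono L2_norm_nonneg, simp)
  then show ?thesis
    by (intro exI[of _ "max C 0"]) simp
qed

lemma bounded_ops_diff:
  assumes "T \<in> bounded_ops M" "f \<in> L2 M" "g \<in> L2 M"
  shows "AE x in M. T (\<lambda>y. f y - g y) x = T f x - T g x"
  using bounded_ops_add[OF assms(1,2) L2_scale[OF assms(3), of "-1"]]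
    bounded_ops_scale[OF assms(1,3), of "-1"]
  by eventually_elim simp

lemma bounded_ops_norm_diff:
  assumes "T \<in> bounded_ops M" "f \<in> L2 M" "g \<in> L2 M"
  shows "L2_norm M (\<lambda>x. T f x - T g x) = L2_norm M (T (\<lambda>y. f y - g y))"
proof (rule L2_norm_cong_AE)
  show "AE x in M. T f x - T g x = T (\<lambda>y. f y - g y) x"
    using bounded_ops_diff[OF assms] by eventually_elim simp
qed (intro L2_measurable L2_diff bounded_ops_L2[OF assms(1)] assms)+

lemma bounded_ops_cong:
  assumes T: "T \<in> bounded_ops M" and fg: "f \<in> L2 M" "g \<in> L2 M" and eq: "AE x in M. f x = g x"
  shows "AE x in M. T f x = T g x"
proof -
  obtain C where C: "\<forall>f\<in>L2 M. L2_norm M (T f) \<le> C * L2_norm M f"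
    using bounded_ops_bound[OF T] by blast
  have d: "(\<lambda>x. f x - g x) \<in> L2 M" "(\<lambda>x. T f x - T g x) \<in> L2 M"
    by (intro L2_diff fg bounded_ops_L2[OF T])+
  have "L2_norm M (\<lambda>x. f x - g x) = 0"
    unfolding L2_norm_eq_0_iff[OF d(1)] using eq by simp
  then have "L2_norm M (\<lambda>x. T f x - T g x) \<le> 0"
    using C[rule_format, OF d(1)] unfolding bounded_ops_norm_diff[OF T fg] by simp
  then have "L2_norm M (\<lambda>x. T f x - T g x) = 0"
    using L2_norm_nonneg[of M "\<lambda>x. T f x - T g x"] by simp
  then show ?thesis
    unfolding L2_norm_eq_0_iff[OF d(2)] by simp
qed

lemma bounded_ops_tendsto:
  assumes T: "T \<in> bounded_ops M" and "\<And>k. v k \<in> L2 M" "w \<in> L2 M"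
    and lim: "(\<lambda>k. L2_norm M (\<lambda>x. v k x - w x)) \<longlonglongrightarrow> 0"
  shows "(\<lambda>k. L2_norm M (\<lambda>x. T (v k) x - T w x)) \<longlonglongrightarrow> 0"
proof -
  obtain C where C: "\<forall>f\<in>L2 M. L2_norm M (T f) \<le> C * L2_norm M f"
    using bounded_ops_bound[OF T] by blast
  show ?thesis
  proof (rule Lim_null_comparison)
    show "\<forall>\<^sub>F k in sequentially. norm (L2_norm M (\<lambda>x. T (v k) x - T w x)) \<le> C * L2_norm M (\<lambda>x. v k x - w x)"
      using C[rule_format, OF L2_diff[OF assms(2,3)]] by (simp add: bounded_ops_norm_diff[OF T] assms(2,3) L2_norm_nonneg)
    show "(\<lambda>k. C * L2_norm M (\<lambda>x. v k x - w x)) \<longlonglongrightarrow> 0"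
      using tendsto_mult_left[OF lim, of C] by simp
  qed
qed

text \<open>Pairing \<open>T - S\<close> with the fixed error vector \<open>z = T f - S f\<close>
  gives a bounded functional that vanishes on \<open>D\<close>; its value at \<open>f\<close> is the
  squared norm of \<open>z\<close>.\<close>

lemma bounded_ops_eqI_total:
  assumes D: "total_L2 M D" and T: "T \<in> bounded_ops M" and S: "S \<in> bounded_ops M"
    and eq: "\<And>u. u \<in> D \<Longrightarrow> AE x in M. T u x = S u x" and f: "f \<in> L2 M"
  shows "AE x in M. T f x = S f x"
proof -
  define z where "z x = T f x - S f x" for x
  have z: "z \<in> L2 M"
    unfolding z_def by (intro L2_diff bounded_ops_L2[OF T] bounded_ops_L2[OF S] f)
  obtain C1 where C1: "C1 \<ge> 0" "\<forall>f\<in>L2 M. L2_norm M (T f) \<le> C1 * L2_norm M f"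
    using bounded_ops_bound[OF T] by blast
  obtain C2 where C2: "C2 \<ge> 0" "\<forall>f\<in>L2 M. L2_norm M (S f) \<le> C2 * L2_norm M f"
    using bounded_ops_bound[OF S] by blast
  define \<psi> where "\<psi> f = L2_inner M (T f) z - L2_inner M (S f) z" for f
  have "\<psi> f = 0"
  proof (rule L2_functional_eq_0[OF D _ _ _ _ f])
    show "\<psi> (\<lambda>x. f x + g x) = \<psi> f + \<psi> g" if fg: "f \<in> L2 M" "g \<in> L2 M" for f g
    proof -
      have "L2_inner M (R (\<lambda>x. f x + g x)) z = L2_inner M (R f) z + L2_inner M (R g) z"
        if R: "R \<in> bounded_ops M" for R
        unfolding L2_inner_add_left[OF bounded_ops_L2[OF R fg(1)] bounded_ops_L2[OF R fg(2)] z, symmetric]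
        by (intro L2_inner_cong_AE bounded_ops_add[OF R] L2_add bounded_ops_L2[OF R] fg z) simp
      from this[OF T] this[OF S] show ?thesis by (simp add: \<psi>_def)
    qed
    show "\<psi> (\<lambda>x. c * f x) = c * \<psi> f" if f: "f \<in> L2 M" for c f
    proof -
      have "L2_inner M (R (\<lambda>x. c * f x)) z = c * L2_inner M (R f) z" if R: "R \<in> bounded_ops M" for R
        unfolding L2_inner_scale_left[symmetric]
        by (intro L2_inner_cong_AE bounded_ops_scale[OF R] L2_scale bounded_ops_L2[OF R] f z) simp
      from this[OF T] this[OF S] show ?thesis by (simp add: \<psi>_def right_diff_distrib)
    qed
    show "cmod (\<psi> f) \<le> ((C1 + C2) * L2_norm M z) * L2_norm M f" if f: "f \<in> L2 M" for f
    proof -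
      have "cmod (\<psi> f) \<le> cmod (L2_inner M (T f) z) + cmod (L2_inner M (S f) z)"
        unfolding \<psi>_def by (rule norm_triangle_ineq4)
      also have "\<dots> \<le> L2_norm M (T f) * L2_norm M z + L2_norm M (S f) * L2_norm M z"
        by (intro add_mono L2_Cauchy_Schwarz bounded_ops_L2[OF T] bounded_ops_L2[OF S] f z)
      also have "\<dots> \<le> (C1 * L2_norm M f) * L2_norm M z + (C2 * L2_norm M f) * L2_norm M z"
        by (intro add_mono mult_right_mono C1(2)[rule_format] C2(2)[rule_format] f L2_norm_nonneg)
      finally show ?thesis by (simp add: algebra_simps)
    qed
    show "\<psi> u = 0" if "u \<in> D" for u
    proof -
      have "u \<in> L2 M" using D that by (auto simp: total_L2_def)
      then have "L2_inner M (T u) z = L2_inner M (S u) z"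
        by (intro L2_inner_cong_AE eq that bounded_ops_L2[OF T] bounded_ops_L2[OF S] z) simp_all
      then show ?thesis by (simp add: \<psi>_def)
    qed
  qed
  then have "L2_inner M z z = 0"
    using L2_inner_diff_left[OF bounded_ops_L2[OF T f] bounded_ops_L2[OF S f] z]
    by (simp add: \<psi>_def flip: z_def)
  from L2_inner_self_eq_0[OF z this] show ?thesis
    by (simp add: z_def)
qed

lemma bounded_ops_plus:
  assumes S: "S \<in> bounded_ops M" and T: "T \<in> bounded_ops M"
  shows "(\<lambda>\<xi> x. S \<xi> x + T \<xi> x) \<in> bounded_ops M"
proof -
  obtain C1 where C1: "\<forall>f\<in>L2 M. L2_norm M (S f) \<le> C1 * L2_norm M f"
    using bounded_ops_bound[OF S] by blast
  obtain C2 where C2: "\<forall>f\<in>L2 M. L2_norm M (T f) \<le> C2 * L2_norm M f"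
    using bounded_ops_bound[OF T] by blast
  show ?thesis
    unfolding bounded_ops_def
  proof (intro CollectI conjI ballI allI)
    fix f assume f: "f \<in> L2 M"
    show "(\<lambda>x. S f x + T f x) \<in> L2 M"
      by (intro L2_add bounded_ops_L2[OF S] bounded_ops_L2[OF T] f)
    show "AE x in M. S (\<lambda>y. c * f y) x + T (\<lambda>y. c * f y) x = c * (S f x + T f x)" for c
      using bounded_ops_scale[OF S f, of c] bounded_ops_scale[OF T f, of c]
      by eventually_elim (simp add: distrib_left)
    show "AE x in M. S (\<lambda>y. f y + g y) x + T (\<lambda>y. f y + g y) x = S f x + T f x + (S g x + T g x)"
      if g: "g \<in> L2 M" for g
      using bounded_ops_add[OF S f g] bounded_ops_add[OF T f g] by eventually_elim simp
  next
    have "L2_norm M (\<lambda>x. S f x + T f x) \<le> (C1 + C2) * L2_norm M f" if f: "f \<in> L2 M" for f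
      using L2_norm_triangle[OF bounded_ops_L2[OF S f] bounded_ops_L2[OF T f]] C1[rule_format, OF f] C2[rule_format, OF f]
      by (simp add: distrib_right)
    then show "\<exists>C. \<forall>f\<in>L2 M. L2_norm M (\<lambda>x. S f x + T f x) \<le> C * L2_norm M f" by blast
  qed
qed

lemma bounded_ops_smult:
  assumes T: "T \<in> bounded_ops M"
  shows "(\<lambda>\<xi> x. c * T \<xi> x) \<in> bounded_ops M"
proof -
  obtain C where C: "\<forall>f\<in>L2 M. L2_norm M (T f) \<le> C * L2_norm M f"
    using bounded_ops_bound[OF T] by blast
  show ?thesis
    unfolding bounded_ops_def
  proof (intro CollectI conjI ballI allI)
    fix f assume f: "f \<in> L2 M"
    show "(\<lambda>x. c * T f x) \<in> L2 M"
      by (intro L2_scale bounded_ops_L2[OF T] f)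
    show "AE x in M. c * T (\<lambda>y. a * f y) x = a * (c * T f x)" for a
      using bounded_ops_scale[OF T f, of a] by eventually_elim simp
    show "AE x in M. c * T (\<lambda>y. f y + g y) x = c * T f x + c * T g x" if g: "g \<in> L2 M" for g
      using bounded_ops_add[OF T f g] by eventually_elim (simp add: distrib_left)
  next
    have "L2_norm M (\<lambda>x. c * T f x) \<le> (cmod c * C) * L2_norm M f" if f: "f \<in> L2 M" for f
      using mult_left_mono[OF C[rule_format, OF f], of "cmod c"] by (simp add: L2_norm_scale)
    then show "\<exists>C. \<forall>f\<in>L2 M. L2_norm M (\<lambda>x. c * T f x) \<le> C * L2_norm M f" by blast
  qed
qed

lemma bounded_ops_comp:
  assumes S: "S \<in> bounded_ops M" and T: "T \<in> bounded_ops M"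
  shows "(\<lambda>\<xi>. S (T \<xi>)) \<in> bounded_ops M"
proof -
  obtain C1 where C1: "C1 \<ge> 0" "\<forall>f\<in>L2 M. L2_norm M (S f) \<le> C1 * L2_norm M f"
    using bounded_ops_bound[OF S] by blast
  obtain C2 where C2: "\<forall>f\<in>L2 M. L2_norm M (T f) \<le> C2 * L2_norm M f"
    using bounded_ops_bound[OF T] by blast
  note L2s = bounded_ops_L2[OF S] bounded_ops_L2[OF T]
  show ?thesis
    unfolding bounded_ops_def
  proof (intro CollectI conjI ballI allI)
    fix f assume f: "f \<in> L2 M"
    show "S (T f) \<in> L2 M"
      by (intro L2s f)
    show "AE x in M. S (T (\<lambda>y. c * f y)) x = c * S (T f) x" for c
      using bounded_ops_cong[OF S _ _ bounded_ops_scale[OF T f, of c]]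
        bounded_ops_scale[OF S L2s(2)[OF f], of c] L2_scale f L2s by force
    show "AE x in M. S (T (\<lambda>y. f y + g y)) x = S (T f) x + S (T g) x" if g: "g \<in> L2 M" for g
      using bounded_ops_cong[OF S _ _ bounded_ops_add[OF T f g]]
        bounded_ops_add[OF S L2s(2)[OF f] L2s(2)[OF g]] L2_add f g L2s by force
  next
    have "L2_norm M (S (T f)) \<le> (C1 * C2) * L2_norm M f" if f: "f \<in> L2 M" for f
      using C1(2)[rule_format, OF L2s(2)[OF f]] mult_left_mono[OF C2[rule_format, OF f] C1(1)] by simp
    then show "\<exists>C. \<forall>f\<in>L2 M. L2_norm M (S (T f)) \<le> C * L2_norm M f" by blast
  qed
qed

section \<open>Commutants and von Neumann algebras\<close>

lemma commutant_subset_bounded: "commutant M \<A> \<subseteq> bounded_ops M"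
  by (auto simp: commutant_def)

lemma commutantD:
  "T \<in> commutant M \<A> \<Longrightarrow> A \<in> \<A> \<Longrightarrow> f \<in> L2 M \<Longrightarrow> AE x in M. T (A f) x = A (T f) x"
  by (simp add: commutant_def)

lemma commutant_plus:
  assumes \<A>: "\<A> \<subseteq> bounded_ops M" and S: "S \<in> commutant M \<A>" and T: "T \<in> commutant M \<A>"
  shows "(\<lambda>\<xi> x. S \<xi> x + T \<xi> x) \<in> commutant M \<A>"
  unfolding commutant_def
proof (intro CollectI conjI ballI)
  have b: "S \<in> bounded_ops M" "T \<in> bounded_ops M"
    using S T commutant_subset_bounded by blast+
  then show "(\<lambda>\<xi> x. S \<xi> x + T \<xi> x) \<in> bounded_ops M"
    by (rule bounded_ops_plus)
  fix A f assume A: "A \<in> \<A>" and f: "f \<in> L2 M"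
  then have "A \<in> bounded_ops M" using \<A> by blast
  from bounded_ops_add[OF this bounded_ops_L2[OF b(1) f] bounded_ops_L2[OF b(2) f]]
    commutantD[OF S A f] commutantD[OF T A f]
  show "AE x in M. S (A f) x + T (A f) x = A (\<lambda>x. S f x + T f x) x"
    by eventually_elim simp
qed

lemma commutant_smult:
  assumes \<A>: "\<A> \<subseteq> bounded_ops M" and T: "T \<in> commutant M \<A>"
  shows "(\<lambda>\<xi> x. c * T \<xi> x) \<in> commutant M \<A>"
  unfolding commutant_def
proof (intro CollectI conjI ballI)
  have b: "T \<in> bounded_ops M"
    using T commutant_subset_bounded by blast
  then show "(\<lambda>\<xi> x. c * T \<xi> x) \<in> bounded_ops M"
    by (rule bounded_ops_smult)
  fix A f assume A: "A \<in> \<A>" and f: "f \<in> L2 M"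
  then have "A \<in> bounded_ops M" using \<A> by blast
  from bounded_ops_scale[OF this bounded_ops_L2[OF b f], of c] commutantD[OF T A f]
  show "AE x in M. c * T (A f) x = A (\<lambda>x. c * T f x) x"
    by eventually_elim simp
qed

lemma commutant_comp:
  assumes \<A>: "\<A> \<subseteq> bounded_ops M" and S: "S \<in> commutant M \<A>" and T: "T \<in> commutant M \<A>"
  shows "(\<lambda>\<xi>. S (T \<xi>)) \<in> commutant M \<A>"
  unfolding commutant_def
proof (intro CollectI conjI ballI)
  have b: "S \<in> bounded_ops M" "T \<in> bounded_ops M"
    using S T commutant_subset_bounded by blast+
  then show "(\<lambda>\<xi>. S (T \<xi>)) \<in> bounded_ops M"
    by (rule bounded_ops_comp)
  fix A f assume A: "A \<in> \<A>" and f: "f \<in> L2 M"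
  then have Ab: "A \<in> bounded_ops M" using \<A> by blast
  have "AE x in M. S (T (A f)) x = S (A (T f)) x"
    by (rule bounded_ops_cong[OF b(1) bounded_ops_L2[OF b(2) bounded_ops_L2[OF Ab f]]
      bounded_ops_L2[OF Ab bounded_ops_L2[OF b(2) f]] commutantD[OF T A f]])
  with commutantD[OF S A bounded_ops_L2[OF b(2) f]]
  show "AE x in M. S (T (A f)) x = A (S (T f)) x"
    by eventually_elim simp
qed

text \<open>Operators act on representatives, so a commutant must absorb changes on null sets; this
  is what lets equality of algebras be equality of sets.\<close>

lemma commutant_cong:
  assumes \<A>: "\<A> \<subseteq> bounded_ops M" and T: "T \<in> commutant M \<A>"
    and S: "S \<in> bounded_ops M" "\<And>f. f \<in> L2 M \<Longrightarrow> AE x in M. S f x = T f x"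
  shows "S \<in> commutant M \<A>"
  unfolding commutant_def
proof (intro CollectI conjI ballI S)
  have b: "T \<in> bounded_ops M"
    using T commutant_subset_bounded by blast
  fix A f assume A: "A \<in> \<A>" and f: "f \<in> L2 M"
  then have Ab: "A \<in> bounded_ops M" using \<A> by blast
  then have "AE x in M. A (S f) x = A (T f) x"
    by (intro bounded_ops_cong[OF Ab] bounded_ops_L2[OF S(1)] bounded_ops_L2[OF b] S f)
  with S(2)[OF bounded_ops_L2[OF Ab f]] commutantD[OF T A f]
  show "AE x in M. S (A f) x = A (S f) x"
    by eventually_elim simp
qed

lemma commutant_antimono: "\<A> \<subseteq> \<B> \<Longrightarrow> commutant M \<B> \<subseteq> commutant M \<A>"
  by (auto simp: commutant_def)

lemma subset_bicommutant:
  assumes "\<A> \<subseteq> bounded_ops M"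
  shows "\<A> \<subseteq> commutant M (commutant M \<A>)"
proof
  fix A assume A: "A \<in> \<A>"
  have "AE x in M. A (B f) x = B (A f) x" if "B \<in> commutant M \<A>" "f \<in> L2 M" for B f
    using commutantD[OF that(1) A that(2)] by eventually_elim simp
  then show "A \<in> commutant M (commutant M \<A>)"
    using A assms unfolding commutant_def[of M "commutant M \<A>"] by blast
qed

text \<open>The third commutant equals the first. For stability under adjoints, the error vector
  \<open>S A f - A S f\<close> is paired with itself: \<open>S\<close> and \<open>A\<close> pass to
  the other side as \<open>T\<close> and \<open>B\<close>, which commute.\<close>

lemma von_neumann_algebra_commutant:
  assumes \<A>: "\<A> \<subseteq> bounded_ops M"
    and adj: "\<And>A. A \<in> \<A> \<Longrightarrow> \<exists>B \<in> \<A>. is_adjoint M A B"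
  shows "von_neumann_algebra M (commutant M \<A>)"
  unfolding von_neumann_algebra_def
proof (intro conjI ballI impI)
  show "commutant M \<A> \<subseteq> bounded_ops M"
    by (rule commutant_subset_bounded)
  then show "commutant M (commutant M (commutant M \<A>)) = commutant M \<A>"
    using commutant_antimono[OF subset_bicommutant[OF \<A>]] subset_bicommutant by blast
next
  fix T S assume T: "T \<in> commutant M \<A>" and S: "S \<in> bounded_ops M" and TS: "is_adjoint M T S"
  have b: "T \<in> bounded_ops M"
    using T commutant_subset_bounded by blast
  have "AE x in M. S (A f) x = A (S f) x" if A: "A \<in> \<A>" and f: "f \<in> L2 M" for A f
  proof -
    obtain B where B: "B \<in> \<A>" "is_adjoint M A B"
      using adj[OF A] by blast
    have Ab: "A \<in> bounded_ops M" "B \<in> bounded_ops M"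
      using A B(1) \<A> by auto
    note L2s = bounded_ops_L2[OF Ab(1)] bounded_ops_L2[OF Ab(2)] bounded_ops_L2[OF S] bounded_ops_L2[OF b]
    define z where "z x = S (A f) x - A (S f) x" for x
    have z: "z \<in> L2 M"
      unfolding z_def by (intro L2_diff L2s f)
    have S': "L2_inner M (S u) v = L2_inner M u (T v)" if "u \<in> L2 M" "v \<in> L2 M" for u v
      using TS that L2_inner_cnj[of M "S u" v] L2_inner_cnj[of M u "T v"] by (simp add: is_adjoint_def)
    have A': "L2_inner M (A u) v = L2_inner M u (B v)" if "u \<in> L2 M" "v \<in> L2 M" for u v
      using B(2) that by (simp add: is_adjoint_def)
    have "L2_inner M (S (A f)) z = L2_inner M f (B (T z))"
      by (simp add: S' A' L2s f z)
    also have "\<dots> = L2_inner M f (T (B z))"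
      by (rule L2_inner_cong_AE)
        (use commutantD[OF T B(1) z] in \<open>auto intro!: L2s f z\<close>)
    also have "\<dots> = L2_inner M (A (S f)) z"
      by (simp add: S' A' L2s f z)
    finally have "L2_inner M z z = 0"
      using L2_inner_diff_left[OF L2s(3)[OF L2s(1)[OF f]] L2s(1)[OF L2s(3)[OF f]] z]
      by (simp flip: z_def)
    from L2_inner_self_eq_0[OF z this] show ?thesis
      by (simp add: z_def)
  qed
  with S show "S \<in> commutant M \<A>"
    by (simp add: commutant_def)
qed

text \<open>A set equal to its bicommutant is the commutant of a set of bounded operators and
  inherits the closure properties of such commutants.\<close>

lemma bicommutant_closed:
  assumes \<A>: "commutant M (commutant M \<A>) = \<A>"
  shows "S \<in> \<A> \<Longrightarrow> T \<in> \<A> \<Longrightarrow> (\<lambda>\<xi> x. S \<xi> x + T \<xi> x) \<in> \<A>"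
    and "T \<in> \<A> \<Longrightarrow> (\<lambda>\<xi> x. c * T \<xi> x) \<in> \<A>"
    and "S \<in> \<A> \<Longrightarrow> T \<in> \<A> \<Longrightarrow> (\<lambda>\<xi>. S (T \<xi>)) \<in> \<A>"
    and "T \<in> \<A> \<Longrightarrow> S \<in> bounded_ops M \<Longrightarrow> (\<And>f. f \<in> L2 M \<Longrightarrow> AE x in M. S f x = T f x) \<Longrightarrow> S \<in> \<A>"
  using commutant_plus[OF commutant_subset_bounded, of S M \<A> T]
    commutant_smult[OF commutant_subset_bounded, of T M \<A> c]
    commutant_comp[OF commutant_subset_bounded, of S M \<A> T]
    commutant_cong[OF commutant_subset_bounded, of T M \<A> S]
  unfolding \<A> by blast+

text \<open>Phrased for any set closed under sums and multiples, in order to cover the intersection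
  of \<open>P\<close> with another algebra.\<close>

lemma subspace_L2_orbit:
  assumes "\<A> \<subseteq> bounded_ops M" "\<A> \<noteq> {}" "\<xi> \<in> L2 M"
    and "\<And>S T. S \<in> \<A> \<Longrightarrow> T \<in> \<A> \<Longrightarrow> (\<lambda>\<xi> x. S \<xi> x + T \<xi> x) \<in> \<A>"
    and "\<And>c T. T \<in> \<A> \<Longrightarrow> (\<lambda>\<xi> x. c * T \<xi> x) \<in> \<A>"
  shows "subspace_L2 M {T \<xi> | T. T \<in> \<A>}"
  unfolding subspace_L2_def
proof (intro conjI ballI allI)
  show "{T \<xi> |T. T \<in> \<A>} \<subseteq> L2 M"
    using assms(1,3) bounded_ops_L2 by blast
  show "{T \<xi> |T. T \<in> \<A>} \<noteq> {}"
    using assms(2) by blast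
  fix f assume "f \<in> {T \<xi> |T. T \<in> \<A>}"
  then obtain S where S: "f = S \<xi>" "S \<in> \<A>" by blast
  show "(\<lambda>x. c * f x) \<in> {T \<xi> |T. T \<in> \<A>}" for c
    using assms(5)[OF S(2), of c] S(1) by (intro CollectI exI[of _ "\<lambda>\<xi> x. c * S \<xi> x"]) simp
  fix g assume "g \<in> {T \<xi> |T. T \<in> \<A>}"
  then obtain T where T: "g = T \<xi>" "T \<in> \<A>" by blast
  show "(\<lambda>x. f x + g x) \<in> {T \<xi> |T. T \<in> \<A>}"
    using assms(4)[OF S(2) T(2)] S(1) T(1) by (intro CollectI exI[of _ "\<lambda>\<xi> x. S \<xi> x + T \<xi> x"]) simp
qed

lemma identity_bicommutant:
  assumes "commutant M (commutant M \<A>) = \<A>"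
  shows "(\<lambda>\<xi>. \<xi>) \<in> \<A>"
proof -
  have "(\<lambda>\<xi>. \<xi>) \<in> bounded_ops M"
    unfolding bounded_ops_def by (auto intro!: exI[of _ 1])
  then have "(\<lambda>\<xi>. \<xi>) \<in> commutant M (commutant M \<A>)"
    unfolding commutant_def[of M "commutant M \<A>"] by simp
  with assms show ?thesis by simp
qed

lemma vN_generated_superset: "S \<subseteq> vN_generated M S"
  by (auto simp: vN_generated_def)

lemma vN_generated_least: "von_neumann_algebra M \<A> \<Longrightarrow> S \<subseteq> \<A> \<Longrightarrow> vN_generated M S \<subseteq> \<A>"
  by (auto simp: vN_generated_def)

section \<open>Operators induced by measure preserving maps\<close>

definition measure_preserving_self :: "'a measure \<Rightarrow> ('a \<Rightarrow> 'a) \<Rightarrow> bool" where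
  "measure_preserving_self M \<tau> \<longleftrightarrow> \<tau> \<in> measurable M M \<and> distr M M \<tau> = M"

lemma L2_norm_comp:
  assumes \<tau>: "measure_preserving_self M \<tau>" and f: "f \<in> L2 M"
  shows "(\<lambda>x. f (\<tau> x)) \<in> L2 M" "L2_norm M (\<lambda>x. f (\<tau> x)) = L2_norm M f"
proof -
  have m[measurable]: "\<tau> \<in> measurable M M" "f \<in> borel_measurable M" and d: "distr M M \<tau> = M"
    using \<tau> f by (auto simp: measure_preserving_self_def L2_def)
  have "integrable (distr M M \<tau>) (\<lambda>x. (cmod (f x))\<^sup>2)"
    unfolding d by (rule L2_integrable[OF f])
  then have "integrable M (\<lambda>x. (cmod (f (\<tau> x)))\<^sup>2)"
    by (rule integrable_distr[OF m(1)])
  then show "(\<lambda>x. f (\<tau> x)) \<in> L2 M"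
    by (simp add: L2_def)
  have "(\<integral>x. (cmod (f x))\<^sup>2 \<partial>distr M M \<tau>) = (\<integral>x. (cmod (f (\<tau> x)))\<^sup>2 \<partial>M)"
    by (rule integral_distr[OF m(1)]) simp
  then show "L2_norm M (\<lambda>x. f (\<tau> x)) = L2_norm M f"
    unfolding d by (simp add: L2_norm_def)
qed

lemma L2_mult_bounded:
  assumes f: "f \<in> L2 M" and \<phi>: "\<phi> \<in> borel_measurable M" and C: "AE x in M. cmod (\<phi> x) \<le> C"
  shows "(\<lambda>x. \<phi> x * f x) \<in> L2 M" "L2_norm M (\<lambda>x. \<phi> x * f x) \<le> \<bar>C\<bar> * L2_norm M f"
proof -
  note [measurable] = L2_measurable[OF f] \<phi>
  have "AE x in M. ennreal ((cmod (\<phi> x * f x))\<^sup>2) \<le> ennreal (C\<^sup>2) * ennreal ((cmod (f x))\<^sup>2)"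
    using C
  proof eventually_elim
    case (elim x)
    have "(cmod (\<phi> x * f x))\<^sup>2 \<le> C\<^sup>2 * (cmod (f x))\<^sup>2"
      unfolding norm_mult power_mult_distrib by (intro mult_right_mono power_mono elim) auto
    then show ?case
      by (metis ennreal_leI ennreal_mult'' zero_le_power2)
  qed
  then have "(\<integral>\<^sup>+x. ennreal ((cmod (\<phi> x * f x))\<^sup>2) \<partial>M) \<le> (\<integral>\<^sup>+x. ennreal (C\<^sup>2) * ennreal ((cmod (f x))\<^sup>2) \<partial>M)"
    by (rule nn_integral_mono_AE)
  also have "\<dots> = ennreal ((\<bar>C\<bar> * L2_norm M f)\<^sup>2)"
    by (subst nn_integral_cmult) (simp_all add: nn_integral_cmod_sq[OF f] power_mult_distrib ennreal_mult)
  finally have *: "(\<integral>\<^sup>+x. ennreal ((cmod (\<phi> x * f x))\<^sup>2) \<partial>M) \<le> ennreal ((\<bar>C\<bar> * L2_norm M f)\<^sup>2)" .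
  have m: "(\<lambda>x. \<phi> x * f x) \<in> borel_measurable M" "0 \<le> \<bar>C\<bar> * L2_norm M f"
    by (simp_all add: L2_norm_nonneg)
  show "(\<lambda>x. \<phi> x * f x) \<in> L2 M" "L2_norm M (\<lambda>x. \<phi> x * f x) \<le> \<bar>C\<bar> * L2_norm M f"
    by (rule L2I_nn_integral[OF m(1) * m(2)])+
qed

text \<open>Group unitaries, right translations, and left and right multiplication by functions are
  all of this form, which settles their boundedness together.\<close>

lemma bounded_ops_weighted_composition:
  assumes \<tau>: "measure_preserving_self M \<tau>" and \<phi>: "\<phi> \<in> borel_measurable M" and C: "AE x in M. cmod (\<phi> x) \<le> C"
  shows "(\<lambda>f x. \<phi> x * f (\<tau> x)) \<in> bounded_ops M"
  unfolding bounded_ops_def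
proof (intro CollectI conjI ballI allI)
  have "L2_norm M (\<lambda>x. \<phi> x * f (\<tau> x)) \<le> \<bar>C\<bar> * L2_norm M f" if f: "f \<in> L2 M" for f
    using L2_mult_bounded(2)[OF L2_norm_comp(1)[OF \<tau> f] \<phi> C] L2_norm_comp(2)[OF \<tau> f] by simp
  then show "\<exists>C. \<forall>f\<in>L2 M. L2_norm M (\<lambda>x. \<phi> x * f (\<tau> x)) \<le> C * L2_norm M f" by blast
  show "(\<lambda>x. \<phi> x * f (\<tau> x)) \<in> L2 M" if "f \<in> L2 M" for f
    by (rule L2_mult_bounded(1)[OF L2_norm_comp(1)[OF \<tau> that] \<phi> C])
qed (simp_all add: distrib_left mult.left_commute)

lemma L2_inner_comp:
  assumes \<tau>: "measure_preserving_self M \<tau>" and f: "f \<in> L2 M" and g: "g \<in> L2 M"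
  shows "L2_inner M (\<lambda>x. f (\<tau> x)) (\<lambda>x. g (\<tau> x)) = L2_inner M f g"
proof -
  have m: "\<tau> \<in> measurable M M" and d: "distr M M \<tau> = M"
    using \<tau> by (auto simp: measure_preserving_self_def)
  have "(\<integral>x. f x * cnj (g x) \<partial>distr M M \<tau>) = (\<integral>x. f (\<tau> x) * cnj (g (\<tau> x)) \<partial>M)"
    by (rule integral_distr[OF m borel_measurable_integrable[OF L2_inner_integrable[OF f g]]])
  then show ?thesis
    unfolding d L2_inner_def by (rule sym)
qed

section \<open>The profinite action\<close>

lemma mult_op_eq: "mult_op f = (\<lambda>\<xi> z. f (fst z) * \<xi> z)"
  by (auto simp: fun_eq_iff mult_op_def)

locale profinite_action = group G for G (structure) +
  fixes N :: "nat \<Rightarrow> 'a set" and X :: "(nat \<Rightarrow> 'a set) measure"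
  assumes countable_G: "countable (carrier G)"
    and ICC_G: "ICC G"
    and normal_N: "\<And>n. N n \<lhd> G"
    and finite_index: "\<And>n. finite (lcosets\<^bsub>G\<^esub> (N n))"
    and decseq_N: "decseq N"
    and inverse_limit_X: "inverse_limit_space G N X"
begin

abbreviation act :: "'a \<Rightarrow> (nat \<Rightarrow> 'a set) \<Rightarrow> (nat \<Rightarrow> 'a set)" where
  "act \<equiv> translation G"

abbreviation cosets :: "nat \<Rightarrow> 'a set set" where
  "cosets n \<equiv> lcosets\<^bsub>G\<^esub> (N n)"

definition cylinder :: "nat \<Rightarrow> 'a set \<Rightarrow> (nat \<Rightarrow> 'a set) set" where
  "cylinder n C = {x \<in> inverse_limit G N. x n = C}"

section \<open>Cosets and points of the inverse limit\<close>

lemma subgroup_N: "subgroup (N n) G"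
  using normal_N[of n] by (rule normal_imp_subgroup)

lemma N_subset: "N n \<subseteq> carrier G"
  by (rule subgroup.subset[OF subgroup_N])

lemma N_carrier: "g \<in> N n \<Longrightarrow> g \<in> carrier G"
  using N_subset by blast

lemma one_N: "\<one> \<in> N n"
  by (rule subgroup.one_closed[OF subgroup_N])

lemma cosets_subset: "C \<in> cosets n \<Longrightarrow> C \<subseteq> carrier G"
  using l_coset_subset_G[OF N_subset] by (auto simp: LCOSETS_def)

lemma coset_eq: "C \<in> cosets n \<Longrightarrow> c \<in> C \<Longrightarrow> C = c <# N n"
  using l_repr_independence[OF _ _ subgroup_N] by (auto simp: LCOSETS_def)

lemma coset_nonempty: "C \<in> cosets n \<Longrightarrow> C \<noteq> {}"
  using lcos_self[OF _ subgroup_N] by (auto simp: LCOSETS_def)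

lemma cosets_intersect: "C \<in> cosets n \<Longrightarrow> D \<in> cosets n \<Longrightarrow> C \<inter> D \<noteq> {} \<Longrightarrow> C = D"
  using coset_eq by blast

lemma cosets_nonempty: "cosets n \<noteq> {}"
  using one_closed by (auto simp: LCOSETS_def)

lemma cosets_translate:
  assumes "g \<in> carrier G" "C \<in> cosets n"
  shows "g <# C \<in> cosets n"
proof -
  obtain a where a: "a \<in> carrier G" "C = a <# N n"
    using assms(2) by (auto simp: LCOSETS_def)
  then have "g <# C = (g \<otimes> a) <# N n"
    using lcos_m_assoc[OF N_subset assms(1)] by simp
  moreover have "g \<otimes> a \<in> carrier G"
    using assms(1) a by simp
  ultimately show ?thesis by (auto simp: LCOSETS_def)
qed

text \<open>\<open>g c = c (c\<^sup>-\<^sup>1 g c)\<close>, and normality puts the bracket into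
  \<open>N n\<close>.\<close>

lemma coset_translate_N:
  assumes "g \<in> N n" "C \<in> cosets n"
  shows "g <# C = C"
proof -
  obtain c where c: "c \<in> C"
    using coset_nonempty[OF assms(2)] by blast
  then have cG: "c \<in> carrier G" and gG: "g \<in> carrier G"
    using cosets_subset[OF assms(2)] N_carrier[OF assms(1)] by auto
  have "inv c \<otimes> g \<otimes> c \<in> N n"
    using normal.inv_op_closed1[OF normal_N cG assms(1)] .
  then have "c \<otimes> (inv c \<otimes> g \<otimes> c) \<in> c <# N n"
    by (auto simp: l_coset_def)
  also have "c \<otimes> (inv c \<otimes> g \<otimes> c) = g \<otimes> c"
    using cG gG by (simp add: m_assoc[symmetric])
  also have "c <# N n = C"
    using coset_eq[OF assms(2) c] by simp
  finally have "g \<otimes> c \<in> C" .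
  moreover have "g \<otimes> c \<in> g <# C"
    using c by (auto simp: l_coset_def)
  ultimately show ?thesis
    using cosets_intersect[OF cosets_translate[OF gG assms(2)] assms(2)] by blast
qed

lemma inverse_limit_coset: "x \<in> inverse_limit G N \<Longrightarrow> x n \<in> cosets n"
  and inverse_limit_step: "x \<in> inverse_limit G N \<Longrightarrow> x n = x (Suc n) <#> N n"
  unfolding inverse_limit_def by blast+

lemma inverse_limit_antimono:
  assumes x: "x \<in> inverse_limit G N" and "m \<le> n"
  shows "x n \<subseteq> x m"
proof (rule lift_Suc_antimono_le[OF _ \<open>m \<le> n\<close>])
  fix k
  have "y = y \<otimes> \<one>" if "y \<in> x (Suc k)" for y
    using cosets_subset[OF inverse_limit_coset[OF x]] that by (metis r_one subsetD)
  then have "x (Suc k) \<subseteq> x (Suc k) <#> N k"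
    using one_N[of k] unfolding set_mult_def by blast
  also have "\<dots> = x k"
    using inverse_limit_step[OF x, of k] by (rule sym)
  finally show "x (Suc k) \<subseteq> x k" .
qed

text \<open>\<open>x n\<close> is a nonempty subset of \<open>x m\<close>, and cosets of level
  \<open>m\<close> are disjoint. Bonding maps thereby become inclusions of cosets, which is how
  cylinders of different levels are compared.\<close>

lemma inverse_limit_coord_iff:
  assumes x: "x \<in> inverse_limit G N" and "m \<le> n" and D: "D \<in> cosets m"
  shows "x m = D \<longleftrightarrow> x n \<subseteq> D"
  using inverse_limit_antimono[OF x \<open>m \<le> n\<close>] coset_nonempty[OF inverse_limit_coset[OF x]]
    cosets_intersect[OF inverse_limit_coset[OF x] D] by blast

lemma act_closed:
  assumes g: "g \<in> carrier G" and x: "x \<in> inverse_limit G N"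
  shows "act g x \<in> inverse_limit G N"
proof -
  have "g <# x n = (g <# x (Suc n)) <#> N n" for n
  proof -
    have "g <# x n = {g} <#> (x (Suc n) <#> N n)"
      unfolding l_coset_eq_set_mult using inverse_limit_step[OF x, of n] by (rule arg_cong)
    also have "\<dots> = ({g} <#> x (Suc n)) <#> N n"
      using set_mult_assoc[of "{g}" "x (Suc n)" "N n"] g
        cosets_subset[OF inverse_limit_coset[OF x]] N_subset by simp
    finally show ?thesis by (simp add: l_coset_eq_set_mult)
  qed
  then show ?thesis
    using cosets_translate[OF g inverse_limit_coset[OF x]] unfolding inverse_limit_def translation_def by blast
qed

lemma act_one: "x \<in> inverse_limit G N \<Longrightarrow> act \<one> x = x"
  using cosets_subset[OF inverse_limit_coset] by (auto simp: translation_def lcos_mult_one)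

lemma act_mult:
  "g \<in> carrier G \<Longrightarrow> h \<in> carrier G \<Longrightarrow> x \<in> inverse_limit G N \<Longrightarrow> act (g \<otimes> h) x = act g (act h x)"
  using cosets_subset[OF inverse_limit_coset] by (auto simp: translation_def lcos_m_assoc)

lemma act_inv_cancel:
  assumes "g \<in> carrier G" "x \<in> inverse_limit G N"
  shows "act g (act (inv g) x) = x" "act (inv g) (act g x) = x"
  using act_mult[of g "inv g" x] act_mult[of "inv g" g x] assms by (auto simp: act_one)

section \<open>The invariant measure on the inverse limit\<close>

lemma space_X: "space X = inverse_limit G N"
  and sets_X: "sets X = sigma_sets (inverse_limit G N) {cylinder n C | n C. C \<in> cosets n}"
  using inverse_limit_X by (auto simp: inverse_limit_space_def cylinder_def)

lemma cylinder_sets: "C \<in> cosets n \<Longrightarrow> cylinder n C \<in> sets X"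
  unfolding sets_X by (intro sigma_sets.Basic) auto

lemma coord_measurable: "(\<lambda>x. x n) \<in> measurable X (count_space (cosets n))"
proof (subst measurable_count_space_eq2[OF finite_index], intro conjI ballI)
  show "(\<lambda>x. x n) \<in> space X \<rightarrow> cosets n"
    by (auto simp: space_X inverse_limit_coset)
  show "(\<lambda>x. x n) -` {C} \<inter> space X \<in> sets X" if "C \<in> cosets n" for C
  proof -
    have "(\<lambda>x. x n) -` {C} \<inter> space X = cylinder n C"
      by (auto simp: space_X cylinder_def)
    then show ?thesis using cylinder_sets[OF that] by simp
  qed
qed

lemma coord_measurable': "(\<lambda>x. x n) \<in> measurable X (uniform_count_measure (cosets n))"
  using coord_measurable by (simp cong: measurable_cong_sets add: sets_uniform_count_measure_count_space)

lemma emeasure_cylinder: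
  assumes "C \<in> cosets n"
  shows "emeasure X (cylinder n C) = ennreal (1 / card (cosets n))"
proof -
  have "emeasure (uniform_count_measure (cosets n)) {C} = emeasure X ((\<lambda>x. x n) -` {C} \<inter> space X)"
    using inverse_limit_X emeasure_distr[OF coord_measurable', of "{C}" n] assms
    by (simp add: inverse_limit_space_def sets_uniform_count_measure)
  also have "(\<lambda>x. x n) -` {C} \<inter> space X = cylinder n C"
    by (auto simp: space_X cylinder_def)
  finally show ?thesis
    using assms emeasure_uniform_count_measure[OF finite_index, of "{C}" n] by simp
qed

lemma prob_space_X: "prob_space X"
proof (rule prob_space_distrD[OF coord_measurable'[of 0]])
  show "prob_space (distr X (uniform_count_measure (cosets 0)) (\<lambda>x. x 0))"
    using inverse_limit_X prob_space_uniform_count_measure[OF finite_index cosets_nonempty]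
    by (simp add: inverse_limit_space_def)
qed

sublocale X: prob_space X
  by (rule prob_space_X)

lemma cylinder_Int:
  assumes "C \<in> cosets m" "D \<in> cosets n" "m \<le> n"
  shows "cylinder m C \<inter> cylinder n D = (if D \<subseteq> C then cylinder n D else {})"
proof (rule Set.set_eqI)
  fix x
  show "x \<in> cylinder m C \<inter> cylinder n D \<longleftrightarrow> x \<in> (if D \<subseteq> C then cylinder n D else {})"
    using inverse_limit_coord_iff[of x m n C] assms unfolding cylinder_def by (cases "D \<subseteq> C") auto
qed

lemma cylinder_split:
  assumes "m \<le> n" "D \<in> cosets m"
  shows "cylinder m D = (\<Union>C\<in>{C \<in> cosets n. C \<subseteq> D}. cylinder n C)"
proof (rule Set.set_eqI)
  fix x
  show "x \<in> cylinder m D \<longleftrightarrow> x \<in> (\<Union>C\<in>{C \<in> cosets n. C \<subseteq> D}. cylinder n C)"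
    using inverse_limit_coord_iff[of x m n D] inverse_limit_coset[of x n] assms
    by (auto simp: cylinder_def)
qed

lemma space_split: "inverse_limit G N = (\<Union>C\<in>cosets n. cylinder n C)"
  by (auto simp: cylinder_def inverse_limit_coset)

lemma cylinder_disjoint: "C \<noteq> D \<Longrightarrow> cylinder n C \<inter> cylinder n D = {}"
  by (auto simp: cylinder_def)

lemma cosets_translate_eq:
  assumes "g \<in> carrier G" "C \<in> cosets n" "D \<in> cosets n"
  shows "g <# C = D \<longleftrightarrow> C = inv g <# D"
  using assms cosets_subset[OF assms(2)] cosets_subset[OF assms(3)]
  by (auto simp: lcos_m_assoc lcos_mult_one)

lemma act_vimage_cylinder:
  assumes g: "g \<in> carrier G" and C: "C \<in> cosets n"
  shows "act g -` cylinder n C \<inter> inverse_limit G N = cylinder n (inv g <# C)"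
  using cosets_translate_eq[OF g inverse_limit_coset C] act_closed[OF g]
  by (auto simp: cylinder_def translation_def)

text \<open>The empty set is needed for stability under intersection; the whole space is the
  exhausting cover in the uniqueness theorem for measures.\<close>

definition pi_system :: "(nat \<Rightarrow> 'a set) set set" where
  "pi_system = {{}, inverse_limit G N} \<union> {cylinder n C | n C. C \<in> cosets n}"

lemma pi_system_Pow: "pi_system \<subseteq> Pow (inverse_limit G N)"
  by (auto simp: pi_system_def cylinder_def)

lemma sets_X_pi: "sets X = sigma_sets (inverse_limit G N) pi_system"
  unfolding sets_X
proof (rule sigma_sets_eqI)
  fix a assume "a \<in> pi_system"
  then show "a \<in> sigma_sets (inverse_limit G N) {cylinder n C | n C. C \<in> cosets n}"
    by (auto simp: pi_system_def intro: sigma_sets.Empty sigma_sets_top)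
qed (auto simp: pi_system_def)

lemma cylinder_Int_pi:
  assumes C: "C \<in> cosets m" and D: "D \<in> cosets n"
  shows "cylinder m C \<inter> cylinder n D \<in> pi_system"
proof (cases "m \<le> n")
  case True
  show ?thesis
    unfolding cylinder_Int[OF C D True] pi_system_def using D by auto
next
  case False
  then have "n \<le> m" by simp
  show ?thesis
    unfolding Int_commute[of "cylinder m C"] cylinder_Int[OF D C \<open>n \<le> m\<close>] pi_system_def using C by auto
qed

lemma Int_stable_pi: "Int_stable pi_system"
proof (rule Int_stableI)
  fix a b assume ab: "a \<in> pi_system" "b \<in> pi_system"
  then have sub: "a \<subseteq> inverse_limit G N" "b \<subseteq> inverse_limit G N"
    using pi_system_Pow by blast+
  consider "a = {} \<or> b = {}" | "a = inverse_limit G N" | "b = inverse_limit G N"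
    | m n C D where "a = cylinder m C" "C \<in> cosets m" "b = cylinder n D" "D \<in> cosets n"
    using ab unfolding pi_system_def by blast
  then show "a \<inter> b \<in> pi_system"
  proof cases
    case 1
    then show ?thesis by (auto simp: pi_system_def)
  next
    case 2
    with sub(2) have "a \<inter> b = b" by blast
    with ab show ?thesis by simp
  next
    case 3
    with sub(1) have "a \<inter> b = a" by blast
    with ab show ?thesis by simp
  next
    case 4
    then show ?thesis using cylinder_Int_pi by simp
  qed
qed

lemma act_measurable:
  assumes g: "g \<in> carrier G"
  shows "act g \<in> measurable X X"
proof (rule measurable_sigma_sets[OF sets_X_pi pi_system_Pow])
  show "act g \<in> space X \<rightarrow> inverse_limit G N"
    using act_closed[OF g] by (auto simp: space_X)
  fix A assume "A \<in> pi_system"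
  then consider "A = {}" | "A = inverse_limit G N" | n C where "C \<in> cosets n" "A = cylinder n C"
    by (auto simp: pi_system_def)
  then show "act g -` A \<inter> space X \<in> sets X"
  proof cases
    case 2
    then have "act g -` A \<inter> space X = space X"
      using act_closed[OF g] by (auto simp: space_X)
    then show ?thesis by simp
  next
    case 3
    then show ?thesis
      using act_vimage_cylinder[OF g] cylinder_sets cosets_translate[OF inv_closed[OF g]] by (simp add: space_X)
  qed simp
qed

text \<open>Translation permutes the cylinders of each level, and these all have the same
  mass.\<close>

lemma act_distr:
  assumes g: "g \<in> carrier G"
  shows "distr X X (act g) = X"
proof (rule measure_eqI_generator_eq[OF Int_stable_pi pi_system_Pow, of _ _ "\<lambda>_. inverse_limit G N"])
  fix A assume A: "A \<in> pi_system"
  have AX: "A \<in> sets X"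
    using A unfolding sets_X_pi by (rule sigma_sets.Basic)
  have *: "emeasure (distr X X (act g)) A = emeasure X (act g -` A \<inter> inverse_limit G N)"
    using emeasure_distr[OF act_measurable[OF g] AX] by (simp add: space_X)
  consider "A = {}" | "A = inverse_limit G N" | n C where "C \<in> cosets n" "A = cylinder n C"
    using A by (auto simp: pi_system_def)
  then show "emeasure (distr X X (act g)) A = emeasure X A"
  proof cases
    case 2
    then have "act g -` A \<inter> inverse_limit G N = A"
      using act_closed[OF g] 2 by auto
    with * show ?thesis by simp
  next
    case 3
    then show ?thesis
      unfolding * using act_vimage_cylinder[OF g] emeasure_cylinder cosets_translate[OF inv_closed[OF g]] by simp
  qed simp
next
  show "emeasure (distr X X (act g)) (inverse_limit G N) \<noteq> \<infinity>"
    using emeasure_distr[OF act_measurable[OF g] sets.top] by (simp add: space_X)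
qed (auto simp: sets_X_pi pi_system_def)

lemma act_preserving: "g \<in> carrier G \<Longrightarrow> measure_preserving_self X (act g)"
  by (simp add: measure_preserving_self_def act_measurable act_distr)

section \<open>Functions invariant under a subgroup of finite index\<close>

text \<open>The sets over which \<open>u\<close> has integral zero form a Dynkin system, and the
  cylinders generate the sigma-algebra.\<close>

lemma AE_zero_cylinders:
  fixes u :: "(nat \<Rightarrow> 'a set) \<Rightarrow> complex"
  assumes u: "integrable X u"
    and zero: "\<And>n C. C \<in> cosets n \<Longrightarrow> (\<integral>x\<in>cylinder n C. u x \<partial>X) = 0"
  shows "AE x in X. u x = 0"
proof (rule X.density_zero[OF u])
  \<comment> \<open>Passing to complements needs the total integral, which is the finite sum over
    the cylinders of level 0.\<close>
  have top: "(\<integral>x\<in>inverse_limit G N. u x \<partial>X) = 0"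
  proof -
    have "(\<integral>x\<in>(\<Union>C\<in>cosets 0. cylinder 0 C). u x \<partial>X) = (\<Sum>C\<in>cosets 0. \<integral>x\<in>cylinder 0 C. u x \<partial>X)"
      by (intro set_integral_finite_Union finite_index)
        (auto simp: disjoint_family_on_def cylinder_disjoint cylinder_sets intro!: set_integrable_restrict_space integrable_mult_indicator u simp: set_integrable_def)
    then show ?thesis
      unfolding space_split[of 0, symmetric] by (simp add: zero)
  qed
  fix A assume "A \<in> sets X"
  then have "A \<in> sigma_sets (inverse_limit G N) pi_system"
    by (simp add: sets_X_pi)
  with Int_stable_pi pi_system_Pow show "(\<integral>x\<in>A. u x \<partial>X) = 0"
  proof (induction rule: sigma_sets_induct_disjoint)
    case (basic A)
    then show ?case
      using top zero unfolding pi_system_def by (auto simp: set_lebesgue_integral_def)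
  next
    case empty
    then show ?case by (simp add: set_lebesgue_integral_def)
  next
    case (compl A)
    then have A: "A \<in> sets X" by (simp add: sets_X_pi)
    have "(\<integral>x\<in>A \<union> (inverse_limit G N - A). u x \<partial>X) = (\<integral>x\<in>A. u x \<partial>X) + (\<integral>x\<in>inverse_limit G N - A. u x \<partial>X)"
      using A sets.compl_sets[OF A] integrable_mult_indicator[OF _ u]
      by (intro set_integral_Un) (auto simp: set_integrable_def space_X)
    moreover have "A \<union> (inverse_limit G N - A) = inverse_limit G N"
      using sets.sets_into_space[OF A] by (auto simp: space_X)
    ultimately show ?case
      using compl.IH top by simp
  next
    case (union A)
    then have A: "A i \<in> sets X" for i by (auto simp: sets_X_pi)
    have "(\<integral>x\<in>(\<Union>i. A i). u x \<partial>X) = (\<Sum>i. \<integral>x\<in>A i. u x \<partial>X)"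
      using A union.hyps(1) integrable_mult_indicator[OF _ u]
      by (intro lebesgue_integral_countable_add) (auto simp: set_integrable_def disjoint_family_on_def)
    then show ?case
      using union.IH by simp
  qed
qed

lemma integral_translate_cylinder:
  fixes u :: "(nat \<Rightarrow> 'a set) \<Rightarrow> complex"
  assumes g: "g \<in> carrier G" and u: "u \<in> borel_measurable X"
    and inv: "AE x in X. u (act (inv g) x) = u x" and C: "C \<in> cosets n"
  shows "(\<integral>x\<in>cylinder n (g <# C). u x \<partial>X) = (\<integral>x\<in>cylinder n C. u x \<partial>X)"
proof -
  note ig = inv_closed[OF g]
  have gC: "g <# C \<in> cosets n"
    by (rule cosets_translate[OF g C])
  have [measurable]: "cylinder n C \<in> sets X" "cylinder n (g <# C) \<in> sets X" "u \<in> borel_measurable X"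
    "act (inv g) \<in> measurable X X"
    by (intro cylinder_sets C gC u act_measurable ig)+
  have "(\<integral>x\<in>cylinder n C. u x \<partial>X) = (\<integral>x. indicator (cylinder n C) x *\<^sub>R u x \<partial>distr X X (act (inv g)))"
    by (simp add: act_distr[OF ig] set_lebesgue_integral_def)
  also have "\<dots> = (\<integral>x. indicator (cylinder n C) (act (inv g) x) *\<^sub>R u (act (inv g) x) \<partial>X)"
    by (rule integral_distr) measurable
  also have "\<dots> = (\<integral>x. indicator (cylinder n (g <# C)) x *\<^sub>R u x \<partial>X)"
  proof (rule integral_cong_AE)
    show "AE x in X. indicator (cylinder n C) (act (inv g) x) *\<^sub>R u (act (inv g) x)
        = indicator (cylinder n (g <# C)) x *\<^sub>R u x"
      using inv AE_space
    proof eventually_elim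
      case (elim x)
      have "act (inv g) x \<in> cylinder n C \<longleftrightarrow> x \<in> cylinder n (g <# C)"
        using act_vimage_cylinder[OF ig C] elim g by (auto simp: space_X cylinder_def)
      with elim show ?case by (simp add: indicator_def)
    qed
  qed measurable
  finally show ?thesis by (simp add: set_lebesgue_integral_def)
qed

text \<open>With \<open>c' = c k\<close> and \<open>k\<close> in \<open>N n\<close>, left
  translation by \<open>c k c\<^sup>-\<^sup>1\<close> carries \<open>c\<close> to \<open>c'\<close>,
  and normality returns this element to \<open>N n\<close>: the finer cosets inside \<open>D\<close>
  form one orbit of \<open>N n\<close>.\<close>

lemma cosets_transitive:
  assumes "n \<le> m" and D: "D \<in> cosets n" and C: "C \<in> cosets m" "C \<subseteq> D" and C': "C' \<in> cosets m" "C' \<subseteq> D"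
  obtains g where "g \<in> N n" "C' = g <# C"
proof -
  obtain c c' where c: "c \<in> C" "c' \<in> C'"
    using coset_nonempty[OF C(1)] coset_nonempty[OF C'(1)] by blast
  then have G: "c \<in> carrier G" "c' \<in> carrier G"
    using cosets_subset[OF D] C C' by auto
  have "c' \<in> c <# N n"
    using coset_eq[OF D, of c] c C(2) C'(2) by auto
  then obtain k where k: "k \<in> N n" "c' = c \<otimes> k"
    by (auto simp: l_coset_def)
  have kG: "k \<in> carrier G" using k(1) by (rule N_carrier)
  define g where "g = c \<otimes> k \<otimes> inv c"
  have gN: "g \<in> N n"
    unfolding g_def by (rule normal.inv_op_closed2[OF normal_N G(1) k(1)])
  have "g \<otimes> c = c'"
    using G(1) kG by (simp add: g_def k(2) m_assoc)
  then have "c' \<in> g <# C"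
    using c(1) by (auto simp: l_coset_def)
  then have "C' = g <# C"
    using cosets_intersect[OF C'(1) cosets_translate[OF N_carrier[OF gN] C(1)]] c(2) by blast
  with gN show ?thesis by (rule that)
qed

definition step_fun :: "nat \<Rightarrow> ('a set \<Rightarrow> complex) \<Rightarrow> (nat \<Rightarrow> 'a set) \<Rightarrow> complex" where
  "step_fun n \<beta> x = \<beta> (x n)"

lemma step_fun_measurable: "step_fun n \<beta> \<in> borel_measurable X"
  unfolding step_fun_def using measurable_compose[OF coord_measurable, of "\<lambda>C. \<beta> C"] by simp

lemma step_fun_bounded: "\<exists>C. \<forall>x\<in>space X. cmod (step_fun n \<beta> x) \<le> C"
proof (intro exI ballI)
  fix x assume "x \<in> space X"
  then have "x n \<in> cosets n" by (simp add: space_X inverse_limit_coset)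
  then show "cmod (step_fun n \<beta> x) \<le> Max ((\<lambda>C. cmod (\<beta> C)) ` cosets n)"
    unfolding step_fun_def using finite_index by (intro Max_ge) auto
qed

text \<open>Ergodicity of \<open>N n\<close> on each cylinder of level \<open>n\<close>. Subtracting
  averages leaves an invariant \<open>w\<close> with integral zero over each such cylinder; the
  finer cylinders inside are permuted transitively, so they share one integral, which must vanish.
  Coarser cylinders are unions of finer ones.\<close>

lemma invariant_eq_step_fun:
  fixes u :: "(nat \<Rightarrow> 'a set) \<Rightarrow> complex"
  assumes u: "integrable X u"
    and inv: "\<And>g. g \<in> N n \<Longrightarrow> AE x in X. u (act (inv g) x) = u x"
  shows "\<exists>\<beta>. AE x in X. u x = step_fun n \<beta> x"
proof -
  \<comment> \<open>The average of \<open>u\<close> over the cylinder, whose mass is the reciprocal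
    of the number of cosets.\<close>
  define \<beta> where "\<beta> C = of_nat (card (cosets n)) * (\<integral>x\<in>cylinder n C. u x \<partial>X)" for C
  define w where "w x = u x - step_fun n \<beta> x" for x
  have "integrable X (step_fun n \<beta>)"
    using step_fun_bounded[of n \<beta>] by (auto intro!: X.integrable_const_bound AE_I2 step_fun_measurable)
  then have w: "integrable X w"
    unfolding w_def by (intro Bochner_Integration.integrable_diff u)
  have set_int: "set_integrable X (cylinder m C) v"
    if "C \<in> cosets m" "integrable X v" for m C and v :: "(nat \<Rightarrow> 'a set) \<Rightarrow> complex"
    unfolding set_integrable_def by (intro integrable_mult_indicator cylinder_sets that)
  have winv: "AE x in X. w (act (inv g) x) = w x" if g: "g \<in> N n" for g
    using inv[OF g] AE_space
  proof eventually_elim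
    case (elim x)
    then have "x n \<in> cosets n" by (simp add: space_X inverse_limit_coset)
    then have "inv g <# x n = x n"
      using coset_translate_N[OF subgroup.m_inv_closed[OF subgroup_N g]] by simp
    with elim show ?case by (simp add: w_def step_fun_def translation_def)
  qed
  have level_n: "(\<integral>x\<in>cylinder n D. w x \<partial>X) = 0" if D: "D \<in> cosets n" for D
  proof -
    have "(\<integral>x\<in>cylinder n D. step_fun n \<beta> x \<partial>X) = (\<integral>x\<in>cylinder n D. \<beta> D \<partial>X)"
      by (intro set_lebesgue_integral_cong cylinder_sets D) (auto simp: cylinder_def step_fun_def)
    also have "\<dots> = measure X (cylinder n D) *\<^sub>R \<beta> D"
    proof -
      have "integrable X (indicator (cylinder n D) :: _ \<Rightarrow> real)"
        using cylinder_sets[OF D] by (intro integrable_real_indicator) (simp_all add: X.emeasure_eq_measure)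
      then show ?thesis
        using cylinder_sets[OF D] unfolding set_lebesgue_integral_def
        by (subst integral_scaleR_left) simp_all
    qed
    also have "measure X (cylinder n D) = 1 / card (cosets n)"
      using emeasure_cylinder[OF D] by (simp add: measure_def)
    also have "\<dots> *\<^sub>R \<beta> D = (\<integral>x\<in>cylinder n D. u x \<partial>X)"
      using finite_index[of n] cosets_nonempty[of n] by (simp add: \<beta>_def scaleR_conv_of_real)
    finally show ?thesis
      unfolding w_def using set_int[OF D u] set_int[OF D \<open>integrable X (step_fun n \<beta>)\<close>] by simp
  qed
  have above: "(\<integral>x\<in>cylinder m C. w x \<partial>X) = 0" if "n \<le> m" and C: "C \<in> cosets m" for m C
  proof -
    obtain c where "c \<in> C" using coset_nonempty[OF C] by blast
    \<comment> \<open>The coset of level \<open>n\<close> around \<open>C\<close>; it contains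
      \<open>C\<close> because the subgroups decrease.\<close>
    define D where "D = c <# N n"
    have cG: "c \<in> carrier G" using cosets_subset[OF C] \<open>c \<in> C\<close> by blast
    have D: "D \<in> cosets n"
      using cG by (auto simp: LCOSETS_def D_def)
    have "N m \<subseteq> N n"
      using decseq_N \<open>n \<le> m\<close> by (simp add: decseq_def)
    then have CD: "C \<subseteq> D"
      using coset_eq[OF C \<open>c \<in> C\<close>] by (auto simp: D_def l_coset_def)
    let ?S = "{C' \<in> cosets m. C' \<subseteq> D}"
    have finS: "finite ?S" using finite_index[of m] by simp
    have "0 = (\<integral>x\<in>cylinder n D. w x \<partial>X)"
      using level_n[OF D] by simp
    also have "\<dots> = (\<Sum>C'\<in>?S. \<integral>x\<in>cylinder m C'. w x \<partial>X)"
      unfolding cylinder_split[OF \<open>n \<le> m\<close> D]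
      by (intro set_integral_finite_Union finS) (auto simp: disjoint_family_on_def cylinder_disjoint cylinder_sets intro!: set_int w)
    also have "\<dots> = (\<Sum>C'\<in>?S. \<integral>x\<in>cylinder m C. w x \<partial>X)"
    proof (rule sum.cong[OF refl])
      fix C' assume "C' \<in> ?S"
      then obtain g where g: "g \<in> N n" "C' = g <# C"
        using cosets_transitive[OF \<open>n \<le> m\<close> D C CD] by blast
      show "(\<integral>x\<in>cylinder m C'. w x \<partial>X) = (\<integral>x\<in>cylinder m C. w x \<partial>X)"
        unfolding g(2) by (rule integral_translate_cylinder[OF N_carrier[OF g(1)] borel_measurable_integrable[OF w] winv[OF g(1)] C])
    qed
    also have "\<dots> = of_nat (card ?S) * (\<integral>x\<in>cylinder m C. w x \<partial>X)"
      by simp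
    finally show ?thesis
      using finS C CD by auto
  qed
  have "AE x in X. w x = 0"
  proof (rule AE_zero_cylinders[OF w])
    fix m C assume C: "C \<in> cosets m"
    \<comment> \<open>The level \<open>m\<close> may be coarser than \<open>n\<close>, so the
      cylinder is first refined to a level at which \<open>above\<close> applies.\<close>
    define k where "k = max m n"
    have k: "m \<le> k" "n \<le> k" by (auto simp: k_def)
    have "(\<integral>x\<in>cylinder m C. w x \<partial>X) = (\<Sum>C'\<in>{C' \<in> cosets k. C' \<subseteq> C}. \<integral>x\<in>cylinder k C'. w x \<partial>X)"
      unfolding cylinder_split[OF k(1) C] using finite_index[of k]
      by (intro set_integral_finite_Union) (auto simp: disjoint_family_on_def cylinder_disjoint cylinder_sets intro!: set_int w)
    also have "\<dots> = 0"
      using above[OF k(2)] by simp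
    finally show "(\<integral>x\<in>cylinder m C. w x \<partial>X) = 0" .
  qed
  show ?thesis
  proof (rule exI[of _ \<beta>])
    show "AE x in X. u x = step_fun n \<beta> x"
      using \<open>AE x in X. w x = 0\<close> by (simp add: w_def)
  qed
qed

text \<open>If \<open>c = g k\<close> represents the coset of \<open>g\<close>, then
  \<open>g h g\<^sup>-\<^sup>1\<close> is the conjugate by \<open>c\<close> of
  \<open>k\<^sup>-\<^sup>1 h k\<close>. So finitely many conjugates of the \<open>N n\<close>-class,
  one for each coset, cover the whole class of \<open>h\<close>, which is infinite.\<close>

lemma infinite_N_class:
  assumes h: "h \<in> carrier G" "h \<noteq> \<one>"
  shows "infinite {inv g \<otimes> h \<otimes> g | g. g \<in> N n}"
proof
  let ?K = "{inv g \<otimes> h \<otimes> g | g. g \<in> N n}"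
  assume fin: "finite ?K"
  define rep where "rep C = (SOME c. c \<in> C)" for C :: "'a set"
  have rep: "rep C \<in> C" if "C \<in> cosets n" for C
    unfolding rep_def using coset_nonempty[OF that] by (simp add: some_in_eq)
  have "{g \<otimes> h \<otimes> inv g | g. g \<in> carrier G} \<subseteq> (\<lambda>(C, k). rep C \<otimes> k \<otimes> inv (rep C)) ` (cosets n \<times> ?K)"
  proof safe
    fix g assume g: "g \<in> carrier G"
    define C where "C = g <# N n"
    have C: "C \<in> cosets n"
      using g by (auto simp: C_def LCOSETS_def)
    obtain k where k: "k \<in> N n" "rep C = g \<otimes> k"
      using rep[OF C] by (auto simp: C_def l_coset_def)
    have kG: "k \<in> carrier G" using k(1) by (rule N_carrier)
    have "rep C \<otimes> (inv k \<otimes> h \<otimes> k) \<otimes> inv (rep C) = g \<otimes> h \<otimes> inv g"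
      unfolding k(2) using g h(1) kG
      by (simp add: inv_mult_group m_assoc) (simp add: m_assoc[symmetric])
    then show "g \<otimes> h \<otimes> inv g \<in> (\<lambda>(C, k). rep C \<otimes> k \<otimes> inv (rep C)) ` (cosets n \<times> ?K)"
      using C k(1) by (intro image_eqI[of _ _ "(C, inv k \<otimes> h \<otimes> k)"]) auto
  qed
  then have "finite {g \<otimes> h \<otimes> inv g | g. g \<in> carrier G}"
    by (rule finite_subset) (intro finite_imageI finite_cartesian_product finite_index fin)
  with ICC_G h show False
    by (auto simp: ICC_def)
qed

section \<open>The crossed product\<close>

abbreviation K :: "((nat \<Rightarrow> 'a set) \<times> 'a) measure" where
  "K \<equiv> crossed_base G X"

sublocale pair: pair_sigma_finite X "count_space (carrier G)"
  by (intro pair_sigma_finite.intro X.sigma_finite_measure_axioms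
      sigma_finite_measure_count_space_countable countable_G)

lemma space_K: "space K = inverse_limit G N \<times> carrier G"
  by (simp add: crossed_base_def space_pair_measure space_X)

text \<open>Countability of \<open>G\<close> enters here: measurability is checked on each fiber
  \<open>X \<times> {h}\<close> separately.\<close>

lemma measurable_K:
  assumes "\<And>h. h \<in> carrier G \<Longrightarrow> (\<lambda>x. f (x, h)) \<in> measurable X L"
  shows "f \<in> measurable K L"
proof -
  have "(\<lambda>p. f (snd p, fst p)) \<in> measurable (count_space (carrier G) \<Otimes>\<^sub>M X) L"
    using assms by (intro measurable_pair_measure_countable1 countable_G) simp
  from measurable_compose[OF measurable_pair_swap' this] show ?thesis
    by (simp add: crossed_base_def split_beta')
qed

lemma measurable_fiber:
  assumes "F \<in> measurable K L" "h \<in> carrier G"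
  shows "(\<lambda>x. F (x, h)) \<in> measurable X L"
  using measurable_compose[OF measurable_Pair2' assms(1)[unfolded crossed_base_def]] assms(2) by simp

lemma nn_integral_K:
  assumes "F \<in> borel_measurable K"
  shows "(\<integral>\<^sup>+z. F z \<partial>K) = (\<integral>\<^sup>+h. (\<integral>\<^sup>+x. F (x, h) \<partial>X) \<partial>count_space (carrier G))"
  using pair.nn_integral_snd[of F] assms unfolding crossed_base_def by simp

text \<open>\<open>\<rho>\<close> depends on \<open>h\<close> because of the map
  \<open>(x, h) \<mapsto> (h\<^sup>-\<^sup>1 x, h\<^sup>-\<^sup>1 g)\<close> behind
  \<open>flip\<close>. Fibers are mapped to fibers preserving the measure, and \<open>b\<close>
  permutes them.\<close>

lemma measure_preserving_K:
  assumes \<rho>: "\<And>h. h \<in> carrier G \<Longrightarrow> measure_preserving_self X (\<rho> h)"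
    and b: "bij_betw b (carrier G) (carrier G)"
  shows "measure_preserving_self K (\<lambda>(x, h). (\<rho> h x, b h))"
proof -
  let ?\<tau> = "\<lambda>(x, h). (\<rho> h x, b h)"
  have bG: "b h \<in> carrier G" if "h \<in> carrier G" for h
    using b that by (rule bij_betwE[rule_format])
  have \<rho>m: "\<rho> h \<in> measurable X X" and \<rho>d: "distr X X (\<rho> h) = X" if "h \<in> carrier G" for h
    using \<rho>[OF that] by (auto simp: measure_preserving_self_def)
  have \<tau>: "?\<tau> \<in> measurable K K"
  proof (rule measurable_K)
    fix h assume h: "h \<in> carrier G"
    have "(\<lambda>x. (\<rho> h x, b h)) \<in> measurable X (X \<Otimes>\<^sub>M count_space (carrier G))"
      using \<rho>m[OF h] bG[OF h] by (intro measurable_Pair measurable_const) auto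
    then show "(\<lambda>x. ?\<tau> (x, h)) \<in> measurable X K"
      by (simp add: crossed_base_def)
  qed
  have "distr K K ?\<tau> = K"
  proof (rule measure_eqI)
    fix A assume "A \<in> sets (distr K K ?\<tau>)"
    then have A: "A \<in> sets K" by simp
    have mA: "(\<lambda>z. indicator A z :: ennreal) \<in> borel_measurable K"
      using A by simp
    have "emeasure (distr K K ?\<tau>) A = (\<integral>\<^sup>+z. indicator A z \<partial>distr K K ?\<tau>)"
      using A by simp
    also have "\<dots> = (\<integral>\<^sup>+z. indicator A (?\<tau> z) \<partial>K)"
      by (rule nn_integral_distr[OF \<tau>]) (use mA in simp)
    also have "\<dots> = (\<integral>\<^sup>+h. (\<integral>\<^sup>+x. indicator A (\<rho> h x, b h) \<partial>X) \<partial>count_space (carrier G))"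
      by (subst nn_integral_K[OF measurable_compose[OF \<tau> mA]]) simp
    also have "\<dots> = (\<integral>\<^sup>+h. (\<integral>\<^sup>+x. indicator A (x, b h) \<partial>X) \<partial>count_space (carrier G))"
    proof (rule nn_integral_cong)
      fix h assume "h \<in> space (count_space (carrier G))"
      then have h: "h \<in> carrier G" by simp
      have "(\<integral>\<^sup>+x. indicator A (x, b h) \<partial>distr X X (\<rho> h)) = (\<integral>\<^sup>+x. indicator A (\<rho> h x, b h) \<partial>X)"
        by (rule nn_integral_distr[OF \<rho>m[OF h]]) (use measurable_fiber[OF mA bG[OF h]] in simp)
      then show "(\<integral>\<^sup>+x. indicator A (\<rho> h x, b h) \<partial>X) = (\<integral>\<^sup>+x. indicator A (x, b h) \<partial>X)"
        unfolding \<rho>d[OF h] by (rule sym)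
    qed
    also have "\<dots> = (\<integral>\<^sup>+h. (\<integral>\<^sup>+x. indicator A (x, h) \<partial>X) \<partial>count_space (carrier G))"
      by (rule nn_integral_bij_count_space[OF b])
    also have "\<dots> = (\<integral>\<^sup>+z. indicator A z \<partial>K)"
      by (rule nn_integral_K[OF mA, symmetric])
    also have "\<dots> = emeasure K A"
      using A by simp
    finally show "emeasure (distr K K ?\<tau>) A = emeasure K A" .
  qed simp
  with \<tau> show ?thesis
    by (simp add: measure_preserving_self_def)
qed

lemma L2_norm_K_sq:
  assumes "F \<in> L2 K"
  shows "ennreal ((L2_norm K F)\<^sup>2)
    = (\<integral>\<^sup>+h. (\<integral>\<^sup>+x. ennreal ((cmod (F (x, h)))\<^sup>2) \<partial>X) \<partial>count_space (carrier G))"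
proof -
  note [measurable] = L2_measurable[OF assms]
  show ?thesis
    unfolding nn_integral_cmod_sq[OF assms, symmetric] by (rule nn_integral_K) simp
qed

lemma L2_fiber:
  assumes F: "F \<in> L2 K" and h: "h \<in> carrier G"
  shows "(\<lambda>x. F (x, h)) \<in> L2 X" "L2_norm X (\<lambda>x. F (x, h)) \<le> L2_norm K F"
proof -
  have "(\<integral>\<^sup>+x. ennreal ((cmod (F (x, h)))\<^sup>2) \<partial>X) \<le> ennreal ((L2_norm K F)\<^sup>2)"
    unfolding L2_norm_K_sq[OF F] using h by (rule nn_integral_ge_point)
  note * = measurable_fiber[OF L2_measurable[OF F] h] this L2_norm_nonneg
  show "(\<lambda>x. F (x, h)) \<in> L2 X" "L2_norm X (\<lambda>x. F (x, h)) \<le> L2_norm K F"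
    by (rule L2I_nn_integral[OF *])+
qed

text \<open>The squared norm is the sum of the squared norms of the fibers, so vanishing can be read
  off from norms, and null sets of the product are avoided.\<close>

lemma AE_K_zeroI:
  assumes F: "F \<in> L2 K" and 0: "\<And>h. h \<in> carrier G \<Longrightarrow> AE x in X. F (x, h) = 0"
  shows "AE z in K. F z = 0"
proof -
  have "(\<integral>\<^sup>+x. ennreal ((cmod (F (x, h)))\<^sup>2) \<partial>X) = 0" if h: "h \<in> carrier G" for h
  proof -
    have "(\<integral>\<^sup>+x. ennreal ((cmod (F (x, h)))\<^sup>2) \<partial>X) = (\<integral>\<^sup>+x. 0 \<partial>X)"
      by (rule nn_integral_cong_AE) (use 0[OF h] in eventually_elim, simp)
    then show ?thesis by simp
  qed
  then have "ennreal ((L2_norm K F)\<^sup>2) = (\<integral>\<^sup>+h. 0 \<partial>count_space (carrier G))"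
    unfolding L2_norm_K_sq[OF F] by (intro nn_integral_cong) simp
  then show ?thesis
    using L2_norm_eq_0_iff[OF F] by simp
qed

lemma AE_fiber_zero:
  assumes F: "F \<in> L2 K" and 0: "AE z in K. F z = 0" and h: "h \<in> carrier G"
  shows "AE x in X. F (x, h) = 0"
proof -
  have "L2_norm K F = 0"
    using L2_norm_eq_0_iff[OF F] 0 by simp
  then have "L2_norm X (\<lambda>x. F (x, h)) = 0"
    using L2_fiber(2)[OF F h] L2_norm_nonneg[of X "\<lambda>x. F (x, h)"] by simp
  then show ?thesis
    using L2_norm_eq_0_iff[OF L2_fiber(1)[OF F h]] by simp
qed

lemma AE_K_fst:
  assumes "Measurable.pred X Q" "AE x in X. Q x"
  shows "AE z in K. Q (fst z)"
  unfolding crossed_base_def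
proof (rule pair.AE_pair_measure)
  show "{z \<in> space (X \<Otimes>\<^sub>M count_space (carrier G)). Q (fst z)} \<in> sets (X \<Otimes>\<^sub>M count_space (carrier G))"
    using assms(1) by measurable
  show "AE x in X. AE h in count_space (carrier G). Q (fst (x, h))"
    using assms(2) by eventually_elim (simp add: AE_count_space)
qed

text \<open>The vector \<open>f \<otimes> \<delta>\<^sub>g\<close>, which corresponds to the element
  \<open>f u\<^sub>g\<close> of the crossed product. The formulas for right multiplication come from
  this correspondence.\<close>

definition tensor_delta :: "((nat \<Rightarrow> 'a set) \<Rightarrow> complex) \<Rightarrow> 'a \<Rightarrow> (nat \<Rightarrow> 'a set) \<times> 'a \<Rightarrow> complex" where
  "tensor_delta f g = (\<lambda>(x, h). if h = g then f x else 0)"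

lemma tensor_delta_L2:
  assumes f: "f \<in> L2 X" and g: "g \<in> carrier G"
  shows "tensor_delta f g \<in> L2 K" "L2_norm K (tensor_delta f g) = L2_norm X f"
proof -
  have m: "tensor_delta f g \<in> borel_measurable K"
    using L2_measurable[OF f] by (intro measurable_K) (simp add: tensor_delta_def)
  have [measurable]: "(\<lambda>z. ennreal ((cmod (tensor_delta f g z))\<^sup>2)) \<in> borel_measurable K"
    using m by measurable
  have "(\<integral>\<^sup>+z. ennreal ((cmod (tensor_delta f g z))\<^sup>2) \<partial>K)
      = (\<integral>\<^sup>+h. ennreal ((L2_norm X f)\<^sup>2) * indicator {g} h \<partial>count_space (carrier G))"
  proof (subst nn_integral_K, measurable, rule nn_integral_cong)
    fix h
    show "(\<integral>\<^sup>+x. ennreal ((cmod (tensor_delta f g (x, h)))\<^sup>2) \<partial>X) = ennreal ((L2_norm X f)\<^sup>2) * indicator {g} h"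
      using nn_integral_cmod_sq[OF f] by (cases "h = g") (simp_all add: tensor_delta_def)
  qed
  also have "\<dots> = ennreal ((L2_norm X f)\<^sup>2)"
    using g by (subst nn_integral_cmult_indicator) (auto simp: emeasure_count_space)
  finally have *: "(\<integral>\<^sup>+z. ennreal ((cmod (tensor_delta f g z))\<^sup>2) \<partial>K) = ennreal ((L2_norm X f)\<^sup>2)" .
  show L: "tensor_delta f g \<in> L2 K"
    by (rule L2I_nn_integral(1)[OF m eq_refl[OF *] L2_norm_nonneg])
  show "L2_norm K (tensor_delta f g) = L2_norm X f"
    using * unfolding nn_integral_cmod_sq[OF L]
    by (simp add: L2_norm_nonneg power2_eq_iff_nonneg)
qed

lemma L2_inner_tensor_delta:
  assumes F: "F \<in> L2 K" and f: "f \<in> L2 X" and g: "g \<in> carrier G"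
  shows "L2_inner K F (tensor_delta f g) = L2_inner X (\<lambda>x. F (x, g)) f"
proof -
  have int: "integrable (X \<Otimes>\<^sub>M count_space (carrier G)) (\<lambda>(x, h). F (x, h) * cnj (tensor_delta f g (x, h)))"
    using L2_inner_integrable[OF F tensor_delta_L2(1)[OF f g]] by (simp add: crossed_base_def split_beta')
  have "L2_inner K F (tensor_delta f g)
      = (\<integral>h. (\<integral>x. F (x, h) * cnj (tensor_delta f g (x, h)) \<partial>X) \<partial>count_space (carrier G))"
    using pair.integral_snd[OF int] by (simp add: L2_inner_def crossed_base_def split_beta')
  also have "\<dots> = (\<integral>h. indicator {g} h *\<^sub>R L2_inner X (\<lambda>x. F (x, g)) f \<partial>count_space (carrier G))"
  proof (rule Bochner_Integration.integral_cong[OF refl])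
    fix h
    show "(\<integral>x. F (x, h) * cnj (tensor_delta f g (x, h)) \<partial>X) = indicator {g} h *\<^sub>R L2_inner X (\<lambda>x. F (x, g)) f"
      by (cases "h = g") (simp_all add: tensor_delta_def L2_inner_def)
  qed
  also have "\<dots> = measure (count_space (carrier G)) ({g} \<inter> carrier G) *\<^sub>R L2_inner X (\<lambda>x. F (x, g)) f"
    using g by (subst integral_scaleR_left) (auto simp: emeasure_count_space intro!: integrable_real_indicator)
  also have "\<dots> = L2_inner X (\<lambda>x. F (x, g)) f"
    using g by (simp add: measure_count_space)
  finally show ?thesis .
qed

section \<open>Bounded functions and a total set of elementary tensors\<close>

lemma L2_X_integrable: "f \<in> L2 X \<Longrightarrow> integrable X f"
  using L2_inner_integrable[of f X "\<lambda>_. 1"] by (simp add: L2_def)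

text \<open>Bounded at every point, not just almost everywhere: \<open>right_mult\<close> evaluates
  such a function along all translates at once, and a pointwise bound passes to them
  directly.\<close>

definition bounded_fun :: "((nat \<Rightarrow> 'a set) \<Rightarrow> complex) set" where
  "bounded_fun = {f \<in> borel_measurable X. \<exists>C. \<forall>x\<in>space X. cmod (f x) \<le> C}"

lemma bounded_fun_L2: "f \<in> bounded_fun \<Longrightarrow> f \<in> L2 X"
proof -
  assume "f \<in> bounded_fun"
  then obtain C where f: "f \<in> borel_measurable X" and C: "\<forall>x\<in>space X. cmod (f x) \<le> C"
    by (auto simp: bounded_fun_def)
  have "integrable X (\<lambda>x. (cmod (f x))\<^sup>2)"
  proof (rule X.integrable_const_bound)
    show "AE x in X. norm ((cmod (f x))\<^sup>2) \<le> C\<^sup>2"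
      using C by (intro AE_I2) (simp add: power_mono)
  qed (use f in measurable)
  with f show ?thesis by (simp add: L2_def)
qed

lemma bounded_fun_indicator: "A \<in> sets X \<Longrightarrow> (\<lambda>x. indicator A x) \<in> bounded_fun"
  unfolding bounded_fun_def by (auto intro!: exI[of _ 1] simp: indicator_def)

lemma bounded_fun_const: "(\<lambda>x. c) \<in> bounded_fun"
  unfolding bounded_fun_def by auto

lemma bounded_fun_add: "f \<in> bounded_fun \<Longrightarrow> g \<in> bounded_fun \<Longrightarrow> (\<lambda>x. f x + g x) \<in> bounded_fun"
proof -
  assume fg: "f \<in> bounded_fun" "g \<in> bounded_fun"
  then obtain C D where C: "\<forall>x\<in>space X. cmod (f x) \<le> C" and D: "\<forall>x\<in>space X. cmod (g x) \<le> D"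
    by (auto simp: bounded_fun_def)
  have "\<forall>x\<in>space X. cmod (f x + g x) \<le> C + D"
    using C D by (auto intro: order_trans[OF norm_triangle_ineq add_mono])
  with fg show ?thesis
    unfolding bounded_fun_def by (auto intro!: borel_measurable_add)
qed

lemma bounded_fun_mult: "f \<in> bounded_fun \<Longrightarrow> g \<in> bounded_fun \<Longrightarrow> (\<lambda>x. f x * g x) \<in> bounded_fun"
proof -
  assume fg: "f \<in> bounded_fun" "g \<in> bounded_fun"
  then obtain C D where C: "\<forall>x\<in>space X. cmod (f x) \<le> C" and D: "\<forall>x\<in>space X. cmod (g x) \<le> D"
    by (auto simp: bounded_fun_def)
  have "\<forall>x\<in>space X. cmod (f x * g x) \<le> \<bar>C\<bar> * \<bar>D\<bar>"
    using C D by (fastforce simp: norm_mult intro!: mult_mono)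
  with fg show ?thesis
    unfolding bounded_fun_def by (auto intro!: borel_measurable_times)
qed

lemma bounded_fun_cong:
  assumes "f \<in> bounded_fun" "\<And>x. x \<in> space X \<Longrightarrow> g x = f x"
  shows "g \<in> bounded_fun"
proof -
  have "g \<in> borel_measurable X \<longleftrightarrow> f \<in> borel_measurable X"
    by (rule measurable_cong) (rule assms(2))
  with assms show ?thesis by (auto simp: bounded_fun_def)
qed

lemma L2_dominated_convergence:
  assumes f: "\<And>k. f k \<in> borel_measurable X" and g: "g \<in> borel_measurable X"
    and bound: "\<And>k x. x \<in> space X \<Longrightarrow> cmod (f k x) \<le> C"
    and lim: "\<And>x. x \<in> space X \<Longrightarrow> (\<lambda>k. f k x) \<longlonglongrightarrow> g x"
  shows "(\<lambda>k. L2_norm X (\<lambda>x. f k x - g x)) \<longlonglongrightarrow> 0"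
proof -
  note [measurable] = f g
  have g_le: "cmod (g x) \<le> C" if "x \<in> space X" for x
    by (rule LIMSEQ_le_const2[OF tendsto_norm[OF lim[OF that]]]) (use bound that in blast)
  have "(\<lambda>k. \<integral>x. (cmod (f k x - g x))\<^sup>2 \<partial>X) \<longlonglongrightarrow> (\<integral>x. 0 \<partial>X)"
  proof (rule integral_dominated_convergence[where w = "\<lambda>_. (2 * C)\<^sup>2"])
    show "AE x in X. (\<lambda>k. (cmod (f k x - g x))\<^sup>2) \<longlonglongrightarrow> 0"
    proof (rule AE_I2)
      fix x assume "x \<in> space X"
      from tendsto_power[OF tendsto_norm[OF tendsto_diff[OF lim[OF this] tendsto_const[of "g x"]]], of 2]
      show "(\<lambda>k. (cmod (f k x - g x))\<^sup>2) \<longlonglongrightarrow> 0" by simp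
    qed
    show "AE x in X. norm ((cmod (f k x - g x))\<^sup>2) \<le> (2 * C)\<^sup>2" for k
    proof (rule AE_I2)
      fix x assume x: "x \<in> space X"
      have "cmod (f k x - g x) \<le> 2 * C"
        using norm_triangle_ineq4[of "f k x" "g x"] bound[OF x, of k] g_le[OF x] by simp
      then have "(cmod (f k x - g x))\<^sup>2 \<le> (2 * C)\<^sup>2"
        by (rule power_mono) simp
      then show "norm ((cmod (f k x - g x))\<^sup>2) \<le> (2 * C)\<^sup>2" by simp
    qed
  qed simp_all
  from tendsto_real_sqrt[OF this] show ?thesis
    by (simp add: L2_norm_def)
qed

lemma bounded_fun_cnj: "f \<in> bounded_fun \<Longrightarrow> (\<lambda>x. cnj (f x)) \<in> bounded_fun"
  unfolding bounded_fun_def by auto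

lemma bounded_fun_act:
  assumes "f \<in> bounded_fun" "g \<in> carrier G"
  shows "(\<lambda>x. f (act g x)) \<in> bounded_fun"
proof -
  obtain C where f: "f \<in> borel_measurable X" and C: "\<forall>x\<in>space X. cmod (f x) \<le> C"
    using assms(1) by (auto simp: bounded_fun_def)
  have "\<forall>x\<in>space X. cmod (f (act g x)) \<le> C"
    using C act_closed[OF assms(2)] by (simp add: space_X)
  then show ?thesis
    unfolding bounded_fun_def using measurable_compose[OF act_measurable[OF assms(2)] f] by blast
qed

lemma bounded_fun_step: "step_fun n \<beta> \<in> bounded_fun"
  unfolding bounded_fun_def using step_fun_measurable step_fun_bounded by blast

text \<open>Indicators in place of \<open>f\<close> already test the integral of each fiber over
  every measurable set.\<close>

lemma total_tensor_delta: "total_L2 K {tensor_delta f g | f g. f \<in> bounded_fun \<and> g \<in> carrier G}"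
  unfolding total_L2_def
proof (intro conjI ballI impI)
  show "{tensor_delta f g | f g. f \<in> bounded_fun \<and> g \<in> carrier G} \<subseteq> L2 K"
    using tensor_delta_L2(1) bounded_fun_L2 by blast
  fix z assume z: "z \<in> L2 K"
    and orth: "\<forall>u\<in>{tensor_delta f g | f g. f \<in> bounded_fun \<and> g \<in> carrier G}. L2_inner K z u = 0"
  show "AE x in K. z x = 0"
  proof (rule AE_K_zeroI[OF z])
    fix h assume h: "h \<in> carrier G"
    show "AE x in X. z (x, h) = 0"
    proof (rule X.density_zero[OF L2_X_integrable[OF L2_fiber(1)[OF z h]]])
      fix A assume A: "A \<in> sets X"
      have "0 = L2_inner K z (tensor_delta (\<lambda>x. indicator A x) h)"
        using orth bounded_fun_indicator[OF A] h by fastforce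
      also have "\<dots> = L2_inner X (\<lambda>x. z (x, h)) (\<lambda>x. indicator A x)"
        by (rule L2_inner_tensor_delta[OF z bounded_fun_L2[OF bounded_fun_indicator[OF A]] h])
      also have "\<dots> = (\<integral>x\<in>A. z (x, h) \<partial>X)"
        unfolding L2_inner_def set_lebesgue_integral_def
        by (intro Bochner_Integration.integral_cong) (auto simp: indicator_def)
      finally show "(\<integral>x\<in>A. z (x, h) \<partial>X) = 0" by simp
    qed
  qed
qed

section \<open>Left and right multiplications\<close>

definition right_translation :: "'a \<Rightarrow> ((nat \<Rightarrow> 'a set) \<times> 'a \<Rightarrow> complex) \<Rightarrow> ((nat \<Rightarrow> 'a set) \<times> 'a \<Rightarrow> complex)" where
  "right_translation g \<xi> = (\<lambda>(x, h). \<xi> (x, h \<otimes> g))"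

text \<open>With \<open>f \<otimes> \<delta>\<^sub>h\<close> read as \<open>f u\<^sub>h\<close>,
  this is right multiplication by \<open>f\<close>: as
  \<open>u\<^sub>h f = \<sigma>\<^sub>h(f) u\<^sub>h\<close>, the coefficient at \<open>h\<close> is
  multiplied by \<open>f(h\<^sup>-\<^sup>1 x)\<close>. In the same picture
  \<open>right_translation g\<close> is right multiplication by
  \<open>u\<^sub>g\<^sup>*\<close>.\<close>

definition right_mult :: "((nat \<Rightarrow> 'a set) \<Rightarrow> complex) \<Rightarrow> ((nat \<Rightarrow> 'a set) \<times> 'a \<Rightarrow> complex) \<Rightarrow> ((nat \<Rightarrow> 'a set) \<times> 'a \<Rightarrow> complex)" where
  "right_mult f \<xi> = (\<lambda>(x, h). f (act (inv h) x) * \<xi> (x, h))"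

lemma bij_left_mult: "g \<in> carrier G \<Longrightarrow> bij_betw (\<lambda>h. g \<otimes> h) (carrier G) (carrier G)"
  by (rule bij_betw_byWitness[where f' = "\<lambda>h. inv g \<otimes> h"]) (auto simp: m_assoc[symmetric])

lemma bij_right_mult: "g \<in> carrier G \<Longrightarrow> bij_betw (\<lambda>h. h \<otimes> g) (carrier G) (carrier G)"
  by (rule bij_betw_byWitness[where f' = "\<lambda>h. h \<otimes> inv g"]) (auto simp: m_assoc)

lemma bij_inv_mult: "g \<in> carrier G \<Longrightarrow> bij_betw (\<lambda>h. inv h \<otimes> g) (carrier G) (carrier G)"
  by (rule bij_betw_byWitness[where f' = "\<lambda>h. g \<otimes> inv h"])
    (auto simp: m_assoc inv_mult_group, auto simp: m_assoc[symmetric])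

lemma id_preserving: "measure_preserving_self X (\<lambda>x. x)"
  unfolding measure_preserving_self_def using distr_id[of X] by (simp add: id_def)

lemma preserving_unitary:
  "g \<in> carrier G \<Longrightarrow> measure_preserving_self K (\<lambda>(x, h). (act (inv g) x, inv g \<otimes> h))"
  by (intro measure_preserving_K act_preserving bij_left_mult inv_closed)

lemma preserving_right:
  "g \<in> carrier G \<Longrightarrow> measure_preserving_self K (\<lambda>(x, h). (x, h \<otimes> g))"
  by (intro measure_preserving_K[where \<rho> = "\<lambda>_ x. x"] id_preserving bij_right_mult)

lemma preserving_flip:
  "g \<in> carrier G \<Longrightarrow> measure_preserving_self K (\<lambda>(x, h). (act (inv h) x, inv h \<otimes> g))"
  by (intro measure_preserving_K act_preserving bij_inv_mult inv_closed)

lemma preserving_id_K: "measure_preserving_self K (\<lambda>z. z)"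
  unfolding measure_preserving_self_def using distr_id[of K] by (simp add: id_def)

lemma unitary_bounded:
  assumes "g \<in> carrier G" shows "group_unitary G act g \<in> bounded_ops K"
proof -
  have "group_unitary G act g = (\<lambda>\<xi> z. 1 * \<xi> ((\<lambda>(x, h). (act (inv g) x, inv g \<otimes> h)) z))"
    by (auto simp: fun_eq_iff group_unitary_def)
  then show ?thesis
    using bounded_ops_weighted_composition[OF preserving_unitary[OF assms], of "\<lambda>_. 1" 1] by simp
qed

lemma right_translation_bounded:
  assumes "g \<in> carrier G" shows "right_translation g \<in> bounded_ops K"
proof -
  have "right_translation g = (\<lambda>\<xi> z. 1 * \<xi> ((\<lambda>(x, h). (x, h \<otimes> g)) z))"
    by (auto simp: fun_eq_iff right_translation_def)
  then show ?thesis
    using bounded_ops_weighted_composition[OF preserving_right[OF assms], of "\<lambda>_. 1" 1] by simp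
qed

lemma right_mult_bounded:
  assumes f: "f \<in> bounded_fun" shows "right_mult f \<in> bounded_ops K"
proof -
  obtain C where fm: "f \<in> borel_measurable X" and C: "\<forall>x\<in>space X. cmod (f x) \<le> C"
    using f by (auto simp: bounded_fun_def)
  have "right_mult f = (\<lambda>\<xi> z. (\<lambda>(x, h). f (act (inv h) x)) z * \<xi> z)"
    by (auto simp: fun_eq_iff right_mult_def)
  moreover have "(\<lambda>(x, h). f (act (inv h) x)) \<in> borel_measurable K"
    by (rule measurable_K) (simp add: measurable_compose[OF act_measurable fm])
  moreover have "AE z in K. cmod ((\<lambda>(x, h). f (act (inv h) x)) z) \<le> C"
    using C act_closed by (intro AE_I2) (auto simp: space_K space_X)
  ultimately show ?thesis
    using bounded_ops_weighted_composition[OF preserving_id_K] by simp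
qed

lemma mult_op_bounded:
  assumes f: "f \<in> Linf X" shows "mult_op f \<in> bounded_ops K"
proof -
  obtain C where fm[measurable]: "f \<in> borel_measurable X" and C: "AE x in X. cmod (f x) \<le> C"
    using f by (auto simp: Linf_def)
  have "(\<lambda>z. f (fst z)) \<in> borel_measurable K"
    by (rule measurable_K) simp
  moreover have "AE z in K. cmod (f (fst z)) \<le> C"
    by (rule AE_K_fst[OF _ C]) measurable
  ultimately show ?thesis
    unfolding mult_op_eq by (rule bounded_ops_weighted_composition[OF preserving_id_K])
qed

lemma bounded_fun_Linf: "f \<in> bounded_fun \<Longrightarrow> f \<in> Linf X"
  unfolding bounded_fun_def Linf_def by (auto intro: AE_I2)

lemma right_translation_adjoint:
  assumes g: "g \<in> carrier G" shows "is_adjoint K (right_translation g) (right_translation (inv g))"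
  unfolding is_adjoint_def
proof (intro ballI)
  fix \<xi> \<eta> assume \<xi>: "\<xi> \<in> L2 K" and \<eta>: "\<eta> \<in> L2 K"
  note L2s = bounded_ops_L2[OF right_translation_bounded]
  let ?\<tau> = "\<lambda>(x, h). (x, h \<otimes> g)"
  have "L2_inner K \<xi> (right_translation (inv g) \<eta>)
      = L2_inner K (\<lambda>z. \<xi> (?\<tau> z)) (\<lambda>z. right_translation (inv g) \<eta> (?\<tau> z))"
    by (rule L2_inner_comp[OF preserving_right[OF g] \<xi> L2s[OF inv_closed[OF g] \<eta>], symmetric])
  also have "\<dots> = L2_inner K (right_translation g \<xi>) \<eta>"
    unfolding L2_inner_def using g
    by (intro Bochner_Integration.integral_cong) (auto simp: right_translation_def space_K m_assoc)
  finally show "L2_inner K (right_translation g \<xi>) \<eta> = L2_inner K \<xi> (right_translation (inv g) \<eta>)" ..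
qed

lemma right_mult_adjoint: "is_adjoint K (right_mult f) (right_mult (\<lambda>x. cnj (f x)))"
  unfolding is_adjoint_def L2_inner_def
  by (intro ballI Bochner_Integration.integral_cong) (auto simp: right_mult_def)

lemma unitary_inner:
  assumes g: "g \<in> carrier G" and "\<xi> \<in> L2 K" "\<eta> \<in> L2 K"
  shows "L2_inner K (group_unitary G act g \<xi>) (group_unitary G act g \<eta>) = L2_inner K \<xi> \<eta>"
  using L2_inner_comp[OF preserving_unitary[OF g] assms(2,3)] by (simp add: group_unitary_def split_beta')

lemma right_translation_inner:
  assumes g: "g \<in> carrier G" and "\<xi> \<in> L2 K" "\<eta> \<in> L2 K"
  shows "L2_inner K (right_translation g \<xi>) (right_translation g \<eta>) = L2_inner K \<xi> \<eta>"
  using L2_inner_comp[OF preserving_right[OF g] assms(2,3)] by (simp add: right_translation_def split_beta')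

text \<open>Closed under adjoints, so that the commutant is a von Neumann algebra; it contains the
  crossed product because left and right multiplications commute.\<close>

definition right_ops :: "(((nat \<Rightarrow> 'a set) \<times> 'a \<Rightarrow> complex) \<Rightarrow> ((nat \<Rightarrow> 'a set) \<times> 'a \<Rightarrow> complex)) set" where
  "right_ops = right_translation ` carrier G \<union> right_mult ` bounded_fun"

abbreviation left_algebra :: "(((nat \<Rightarrow> 'a set) \<times> 'a \<Rightarrow> complex) \<Rightarrow> ((nat \<Rightarrow> 'a set) \<times> 'a \<Rightarrow> complex)) set" where
  "left_algebra \<equiv> commutant K right_ops"

lemma right_ops_bounded: "right_ops \<subseteq> bounded_ops K"
  using right_translation_bounded right_mult_bounded by (auto simp: right_ops_def)

lemma von_neumann_left_algebra: "von_neumann_algebra K left_algebra"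
proof (rule von_neumann_algebra_commutant[OF right_ops_bounded])
  fix A assume "A \<in> right_ops"
  then consider g where "g \<in> carrier G" "A = right_translation g" | f where "f \<in> bounded_fun" "A = right_mult f"
    by (auto simp: right_ops_def)
  then show "\<exists>B\<in>right_ops. is_adjoint K A B"
  proof cases
    case 1
    then show ?thesis
      using right_translation_adjoint[OF 1(1)] inv_closed[OF 1(1)] by (auto simp: right_ops_def)
  next
    case 2
    then show ?thesis
      using right_mult_adjoint[of f] bounded_fun_cnj[OF 2(1)] by (auto simp: right_ops_def)
  qed
qed

lemma unitary_left:
  assumes g: "g \<in> carrier G" shows "group_unitary G act g \<in> left_algebra"
  unfolding commutant_def
proof (intro CollectI conjI ballI unitary_bounded g)
  fix A \<xi> assume "A \<in> right_ops"
  then consider k where "k \<in> carrier G" "A = right_translation k" | f where "A = right_mult f"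
    by (auto simp: right_ops_def)
  then show "AE z in K. group_unitary G act g (A \<xi>) z = A (group_unitary G act g \<xi>) z"
  proof cases
    case 1
    then show ?thesis
      using g by (intro AE_I2) (auto simp: space_K group_unitary_def right_translation_def m_assoc)
  next
    case 2
    have "act (inv (inv g \<otimes> h)) (act (inv g) x) = act (inv h) x"
      if "h \<in> carrier G" "x \<in> inverse_limit G N" for h x
      using act_mult[of "inv h \<otimes> g" "inv g" x] that g by (simp add: inv_mult_group m_assoc)
    with 2 show ?thesis
      by (intro AE_I2) (auto simp: space_K group_unitary_def right_mult_def)
  qed
qed

lemma mult_op_left:
  assumes f: "f \<in> Linf X" shows "mult_op f \<in> left_algebra"
  unfolding commutant_def
proof (intro CollectI conjI ballI mult_op_bounded f)
  fix A \<xi> assume "A \<in> right_ops"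
  then consider k where "A = right_translation k" | f where "A = right_mult f"
    by (auto simp: right_ops_def)
  then show "AE z in K. mult_op f (A \<xi>) z = A (mult_op f \<xi>) z"
    by cases (auto simp: mult_op_def right_translation_def right_mult_def mult.left_commute intro!: AE_I2)
qed

lemma crossed_product_left: "crossed_product G X act \<subseteq> left_algebra"
  unfolding crossed_product_def
  by (rule vN_generated_least[OF von_neumann_left_algebra]) (auto intro: unitary_left mult_op_left)

section \<open>Operators determined by their vacuum vector\<close>

definition vacuum :: "(nat \<Rightarrow> 'a set) \<times> 'a \<Rightarrow> complex" where
  "vacuum = tensor_delta (\<lambda>_. 1) \<one>"

lemma vacuum_L2: "vacuum \<in> L2 K"
  unfolding vacuum_def by (intro tensor_delta_L2 bounded_fun_L2 bounded_fun_const one_closed)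

text \<open>This is the identity \<open>f u\<^sub>g = u\<^sub>g (f \<circ> g)\<close> of the crossed
  product, with both factors on the right acting on \<open>vacuum\<close> from the right.\<close>

lemma tensor_delta_eq_right:
  assumes z: "z \<in> space K" and g: "g \<in> carrier G"
  shows "tensor_delta f g z = right_mult (\<lambda>x. f (act g x)) (right_translation (inv g) vacuum) z"
proof -
  obtain x h where z: "z = (x, h)" "x \<in> inverse_limit G N" "h \<in> carrier G"
    using z by (auto simp: space_K)
  have "h \<otimes> inv g = \<one> \<longleftrightarrow> h = g"
    using z(3) g by (metis inv_closed inv_equality inv_inv r_inv)
  moreover have "act g (act (inv g) x) = x"
    using act_inv_cancel(1)[OF g z(2)] .
  ultimately show ?thesis
    by (auto simp: z(1) tensor_delta_def right_mult_def right_translation_def vacuum_def)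
qed

text \<open>\<open>T\<close> commutes with the right operators that produce
  \<open>f \<otimes> \<delta>\<^sub>g\<close> from \<open>vacuum\<close>. Its values on a total set
  are thus explicit in \<open>T vacuum\<close>: the vacuum is separating.\<close>

lemma left_tensor_delta:
  assumes T: "T \<in> left_algebra" and f: "f \<in> bounded_fun" and g: "g \<in> carrier G"
  shows "AE z in K. T (tensor_delta f g) z = right_mult (\<lambda>x. f (act g x)) (right_translation (inv g) (T vacuum)) z"
proof -
  have Tb: "T \<in> bounded_ops K"
    using T commutant_subset_bounded by blast
  note fg = bounded_fun_act[OF f g]
  note rm = right_mult_bounded[OF fg] and rt = right_translation_bounded[OF inv_closed[OF g]]
  note 1 = bounded_ops_L2[OF rt vacuum_L2] and 2 = bounded_ops_L2[OF Tb vacuum_L2]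
  have "AE z in K. T (tensor_delta f g) z = T (right_mult (\<lambda>x. f (act g x)) (right_translation (inv g) vacuum)) z"
    by (rule bounded_ops_cong[OF Tb tensor_delta_L2(1)[OF bounded_fun_L2[OF f] g] bounded_ops_L2[OF rm 1]])
      (intro AE_I2 tensor_delta_eq_right g)
  moreover have "AE z in K. T (right_mult (\<lambda>x. f (act g x)) (right_translation (inv g) vacuum)) z
      = right_mult (\<lambda>x. f (act g x)) (T (right_translation (inv g) vacuum)) z"
    by (rule commutantD[OF T _ 1]) (use fg in \<open>auto simp: right_ops_def\<close>)
  moreover have "AE z in K. right_mult (\<lambda>x. f (act g x)) (T (right_translation (inv g) vacuum)) z
      = right_mult (\<lambda>x. f (act g x)) (right_translation (inv g) (T vacuum)) z"
    by (rule bounded_ops_cong[OF rm bounded_ops_L2[OF Tb 1] bounded_ops_L2[OF rt 2]])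
      (rule commutantD[OF T _ vacuum_L2], use g in \<open>auto simp: right_ops_def\<close>)
  ultimately show ?thesis
    by eventually_elim simp
qed

text \<open>
  An element \<open>T\<close> of the crossed product is a twisted convolution with the kernel \<open>T vacuum\<close>;
  \<open>flip f g\<close> moves the kernel to the other side of the inner product (see \<open>left_inner_flip\<close>).
\<close>

definition flip :: "((nat \<Rightarrow> 'a set) \<Rightarrow> complex) \<Rightarrow> 'a \<Rightarrow> ((nat \<Rightarrow> 'a set) \<times> 'a \<Rightarrow> complex) \<Rightarrow>
    ((nat \<Rightarrow> 'a set) \<times> 'a \<Rightarrow> complex)" where
  "flip f g \<xi> = (\<lambda>(x, k). f x * cnj (\<xi> (act (inv k) x, inv k \<otimes> g)))"

lemma flip_L2:
  assumes f: "f \<in> bounded_fun" and g: "g \<in> carrier G"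
  shows "\<exists>C. \<forall>\<xi>\<in>L2 K. flip f g \<xi> \<in> L2 K \<and> L2_norm K (flip f g \<xi>) \<le> C * L2_norm K \<xi>"
proof -
  obtain C where fm[measurable]: "f \<in> borel_measurable X" and C: "\<forall>x\<in>space X. cmod (f x) \<le> C"
    using f by (auto simp: bounded_fun_def)
  have "flip f g \<xi> \<in> L2 K \<and> L2_norm K (flip f g \<xi>) \<le> \<bar>C\<bar> * L2_norm K \<xi>" if \<xi>: "\<xi> \<in> L2 K" for \<xi>
  proof -
    let ?\<tau> = "\<lambda>(x, k). (act (inv k) x, inv k \<otimes> g)"
    note comp = L2_norm_comp[OF preserving_flip[OF g] \<xi>]
    have 1: "(\<lambda>z. cnj (\<xi> (?\<tau> z))) \<in> L2 K" "L2_norm K (\<lambda>z. cnj (\<xi> (?\<tau> z))) = L2_norm K \<xi>"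
      using comp L2_measurable[OF comp(1)] by (simp_all add: L2_def L2_norm_def)
    have 2: "(\<lambda>z. f (fst z)) \<in> borel_measurable K"
      by (rule measurable_K) simp
    have 3: "AE z in K. cmod (f (fst z)) \<le> C"
      using C by (intro AE_I2) (auto simp: space_K space_X)
    have "flip f g \<xi> = (\<lambda>z. f (fst z) * cnj (\<xi> (?\<tau> z)))"
      by (auto simp: flip_def fun_eq_iff)
    then show ?thesis
      using L2_mult_bounded[OF 1(1) 2 3] 1(2) by simp
  qed
  then show ?thesis by blast
qed

text \<open>The case of \<open>left_inner_flip\<close> on the total set, with an arbitrary vector
  \<open>c\<close> in the role of \<open>T vacuum\<close>. The adjoints of the two right operators
  turn \<open>f \<otimes> \<delta>\<^sub>g\<close> into the flipped vector, point by point.\<close>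

lemma right_inner_flip:
  assumes c: "c \<in> L2 K" and f: "f \<in> bounded_fun" and g: "g \<in> carrier G"
    and f1: "f1 \<in> bounded_fun" and g1: "g1 \<in> carrier G"
  shows "L2_inner K (right_mult (\<lambda>x. f1 (act g1 x)) (right_translation (inv g1) c)) (tensor_delta f g)
    = L2_inner K c (flip f g (tensor_delta f1 g1))"
proof -
  note fg1 = bounded_fun_act[OF f1 g1]
  note ig1 = inv_closed[OF g1]
  note \<zeta> = tensor_delta_L2(1)[OF bounded_fun_L2[OF f] g]
  have L: "right_mult (\<lambda>x. cnj (f1 (act g1 x))) (tensor_delta f g) \<in> L2 K"
    by (rule bounded_ops_L2[OF right_mult_bounded[OF bounded_fun_cnj[OF fg1]] \<zeta>])
  have "L2_inner K (right_mult (\<lambda>x. f1 (act g1 x)) (right_translation (inv g1) c)) (tensor_delta f g)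
      = L2_inner K (right_translation (inv g1) c) (right_mult (\<lambda>x. cnj (f1 (act g1 x))) (tensor_delta f g))"
    using right_mult_adjoint[of "\<lambda>x. f1 (act g1 x)"] bounded_ops_L2[OF right_translation_bounded[OF ig1] c] \<zeta>
    by (simp add: is_adjoint_def)
  also have "\<dots> = L2_inner K c (right_translation g1 (right_mult (\<lambda>x. cnj (f1 (act g1 x))) (tensor_delta f g)))"
    using right_translation_adjoint[OF ig1] c L g1 by (simp add: is_adjoint_def)
  also have "\<dots> = L2_inner K c (flip f g (tensor_delta f1 g1))"
    unfolding L2_inner_def
  proof (rule Bochner_Integration.integral_cong[OF refl])
    fix z assume "z \<in> space K"
    then obtain x k where z: "z = (x, k)" "x \<in> inverse_limit G N" "k \<in> carrier G"
      by (auto simp: space_K)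
    have "k \<otimes> g1 = g \<longleftrightarrow> inv k \<otimes> g = g1"
      using z(3) g g1 by (metis inv_solve_left)
    moreover have "act g1 (act (inv (k \<otimes> g1)) x) = act (inv k) x"
      using act_mult[of g1 "inv g1 \<otimes> inv k" x] z g1 by (simp add: inv_mult_group m_assoc[symmetric])
    ultimately show "c z * cnj (right_translation g1 (right_mult (\<lambda>x. cnj (f1 (act g1 x))) (tensor_delta f g)) z)
        = c z * cnj (flip f g (tensor_delta f1 g1) z)"
      by (simp add: z(1) right_translation_def right_mult_def flip_def tensor_delta_def)
  qed
  finally show ?thesis .
qed

text \<open>The right side sees \<open>T\<close> only through \<open>T vacuum\<close> and makes
  sense for every \<open>\<xi>\<close>, even where right convolution by \<open>\<xi>\<close> is
  unbounded. As \<open>flip\<close> is conjugate linear in \<open>\<xi>\<close>, the difference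
  \<open>\<psi>\<close> of both sides is linear; it is bounded and vanishes on elementary
  tensors.\<close>

lemma left_inner_flip:
  assumes T: "T \<in> left_algebra" and f: "f \<in> bounded_fun" and g: "g \<in> carrier G" and \<xi>: "\<xi> \<in> L2 K"
  shows "L2_inner K (T \<xi>) (tensor_delta f g) = L2_inner K (T vacuum) (flip f g \<xi>)"
proof -
  have Tb: "T \<in> bounded_ops K"
    using T commutant_subset_bounded by blast
  obtain C1 where C1: "\<forall>\<xi>\<in>L2 K. L2_norm K (T \<xi>) \<le> C1 * L2_norm K \<xi>"
    using bounded_ops_bound[OF Tb] by blast
  obtain C2 where C2: "\<forall>\<xi>\<in>L2 K. flip f g \<xi> \<in> L2 K \<and> L2_norm K (flip f g \<xi>) \<le> C2 * L2_norm K \<xi>"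
    using flip_L2[OF f g] by blast
  note \<zeta> = tensor_delta_L2(1)[OF bounded_fun_L2[OF f] g]
  note \<Omega> = bounded_ops_L2[OF Tb vacuum_L2]
  define \<psi> where "\<psi> \<xi> = L2_inner K (T \<xi>) (tensor_delta f g) - L2_inner K (T vacuum) (flip f g \<xi>)" for \<xi>
  have "\<psi> \<xi> = 0"
  proof (rule L2_functional_eq_0[OF total_tensor_delta _ _ _ _ \<xi>])
    show "\<psi> (\<lambda>x. \<xi> x + \<eta> x) = \<psi> \<xi> + \<psi> \<eta>" if \<xi>: "\<xi> \<in> L2 K" and \<eta>: "\<eta> \<in> L2 K" for \<xi> \<eta>
    proof -
      have "L2_inner K (T (\<lambda>x. \<xi> x + \<eta> x)) (tensor_delta f g)
          = L2_inner K (T \<xi>) (tensor_delta f g) + L2_inner K (T \<eta>) (tensor_delta f g)"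
        unfolding L2_inner_add_left[OF bounded_ops_L2[OF Tb \<xi>] bounded_ops_L2[OF Tb \<eta>] \<zeta>, symmetric]
        by (rule L2_inner_cong_AE[OF _ _ \<zeta> \<zeta> bounded_ops_add[OF Tb \<xi> \<eta>]])
          (intro L2_add bounded_ops_L2[OF Tb] \<xi> \<eta> AE_I2 refl)+
      moreover have "flip f g (\<lambda>x. \<xi> x + \<eta> x) = (\<lambda>z. flip f g \<xi> z + flip f g \<eta> z)"
        by (auto simp: flip_def fun_eq_iff distrib_left)
      ultimately show ?thesis
        using C2 \<xi> \<eta> by (simp add: \<psi>_def L2_inner_add_right[OF _ _ \<Omega>])
    qed
    show "\<psi> (\<lambda>x. c * \<xi> x) = c * \<psi> \<xi>" if \<xi>: "\<xi> \<in> L2 K" for c \<xi>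
    proof -
      have "L2_inner K (T (\<lambda>x. c * \<xi> x)) (tensor_delta f g) = c * L2_inner K (T \<xi>) (tensor_delta f g)"
        unfolding L2_inner_scale_left[symmetric]
        by (rule L2_inner_cong_AE[OF _ _ \<zeta> \<zeta> bounded_ops_scale[OF Tb \<xi>]])
          (intro L2_scale bounded_ops_L2[OF Tb] \<xi> AE_I2 refl)+
      moreover have "flip f g (\<lambda>x. c * \<xi> x) = (\<lambda>z. cnj c * flip f g \<xi> z)"
        by (auto simp: flip_def fun_eq_iff)
      ultimately show ?thesis
        by (simp add: \<psi>_def L2_inner_scale_right right_diff_distrib)
    qed
    show "cmod (\<psi> \<xi>) \<le> (C1 * L2_norm K (tensor_delta f g) + L2_norm K (T vacuum) * C2) * L2_norm K \<xi>"
      if \<xi>: "\<xi> \<in> L2 K" for \<xi>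
    proof -
      have "cmod (\<psi> \<xi>) \<le> cmod (L2_inner K (T \<xi>) (tensor_delta f g)) + cmod (L2_inner K (T vacuum) (flip f g \<xi>))"
        unfolding \<psi>_def by (rule norm_triangle_ineq4)
      also have "\<dots> \<le> L2_norm K (T \<xi>) * L2_norm K (tensor_delta f g) + L2_norm K (T vacuum) * L2_norm K (flip f g \<xi>)"
        using C2 \<xi> by (intro add_mono L2_Cauchy_Schwarz bounded_ops_L2[OF Tb \<xi>] \<zeta> \<Omega>) blast
      also have "\<dots> \<le> (C1 * L2_norm K \<xi>) * L2_norm K (tensor_delta f g) + L2_norm K (T vacuum) * (C2 * L2_norm K \<xi>)"
        using C1 C2 \<xi> by (intro add_mono mult_right_mono mult_left_mono L2_norm_nonneg) blast+
      finally show ?thesis by (simp add: algebra_simps)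
    qed
    fix u assume "u \<in> {tensor_delta f g |f g. f \<in> bounded_fun \<and> g \<in> carrier G}"
    then obtain f1 g1 where u: "u = tensor_delta f1 g1" and f1: "f1 \<in> bounded_fun" and g1: "g1 \<in> carrier G"
      by blast
    note uL = tensor_delta_L2(1)[OF bounded_fun_L2[OF f1] g1]
    have "L2_inner K (T u) (tensor_delta f g)
        = L2_inner K (right_mult (\<lambda>x. f1 (act g1 x)) (right_translation (inv g1) (T vacuum))) (tensor_delta f g)"
      unfolding u
      by (rule L2_inner_cong_AE[OF bounded_ops_L2[OF Tb uL] _ \<zeta> \<zeta> left_tensor_delta[OF T f1 g1]])
        (intro bounded_ops_L2[OF right_mult_bounded[OF bounded_fun_act[OF f1 g1]]]
          bounded_ops_L2[OF right_translation_bounded[OF inv_closed[OF g1]]] \<Omega> AE_I2 refl)+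
    also have "\<dots> = L2_inner K (T vacuum) (flip f g u)"
      unfolding u by (rule right_inner_flip[OF \<Omega> f g f1 g1])
    finally show "\<psi> u = 0"
      by (simp add: \<psi>_def)
  qed
  then show ?thesis
    by (simp add: \<psi>_def)
qed

text \<open>The operators \<open>q k\<close> need not be uniformly bounded, so \<open>q k\<close>
  applied to a fixed vector need not converge. For \<open>S\<close> in the commutant of
  \<open>\<A>\<close>, one matrix coefficient is therefore written in two ways:
  \<open>S (q k \<eta>)\<close> through the bounded right operator \<open>R\<close>, and
  \<open>q k (S \<eta>)\<close> through \<open>left_inner_flip\<close>. Both depend continuously on
  \<open>q k vacuum\<close>, so commutation with \<open>S\<close> survives in the limit.\<close>

proposition bicommutant_vacuum_closed:
  assumes \<A>: "commutant K (commutant K \<A>) = \<A>"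
    and q: "\<And>k. q k \<in> \<A>" "\<And>k. q k \<in> left_algebra" and T: "T \<in> left_algebra"
    and lim: "(\<lambda>k. L2_norm K (\<lambda>z. q k vacuum z - T vacuum z)) \<longlonglongrightarrow> 0"
  shows "T \<in> \<A>"
proof -
  have Tb: "T \<in> bounded_ops K" and qb: "q k \<in> bounded_ops K" for k
    using T q commutant_subset_bounded by blast+
  note q\<Omega> = bounded_ops_L2[OF qb vacuum_L2] and T\<Omega> = bounded_ops_L2[OF Tb vacuum_L2]
  have "AE z in K. T (S \<xi>) z = S (T \<xi>) z" if S: "S \<in> commutant K \<A>" and \<xi>: "\<xi> \<in> L2 K" for S \<xi>
  proof -
    have Sb: "S \<in> bounded_ops K"
      using S commutant_subset_bounded by blast
    show ?thesis
    proof (rule bounded_ops_eqI_total[OF total_tensor_delta bounded_ops_comp[OF Tb Sb] bounded_ops_comp[OF Sb Tb] _ \<xi>])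
      fix \<eta> assume "\<eta> \<in> {tensor_delta f g |f g. f \<in> bounded_fun \<and> g \<in> carrier G}"
      then obtain f1 g1 where \<eta>: "\<eta> = tensor_delta f1 g1" and f1: "f1 \<in> bounded_fun" and g1: "g1 \<in> carrier G"
        by blast
      have \<eta>L: "\<eta> \<in> L2 K"
        unfolding \<eta> by (rule tensor_delta_L2(1)[OF bounded_fun_L2[OF f1] g1])
      note TS = bounded_ops_L2[OF Tb bounded_ops_L2[OF Sb \<eta>L]] and ST = bounded_ops_L2[OF Sb bounded_ops_L2[OF Tb \<eta>L]]
      \<comment> \<open>On \<open>\<eta>\<close> every \<open>p\<close> in the left algebra acts as
        \<open>R (p vacuum)\<close>, with \<open>R\<close> bounded and independent of
        \<open>p\<close>.\<close>
      define R where "R c = right_mult (\<lambda>x. f1 (act g1 x)) (right_translation (inv g1) c)" for c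
      have Rb: "R \<in> bounded_ops K"
        unfolding R_def
        by (rule bounded_ops_comp[OF right_mult_bounded[OF bounded_fun_act[OF f1 g1]]
              right_translation_bounded[OF inv_closed[OF g1]]])
      have R_eq: "AE z in K. p \<eta> z = R (p vacuum) z" if "p \<in> left_algebra" for p
        unfolding \<eta> R_def by (rule left_tensor_delta[OF that f1 g1])
      have S_eq: "L2_inner K (S (p \<eta>)) \<zeta> = L2_inner K (S (R (p vacuum))) \<zeta>"
        if p: "p \<in> left_algebra" and \<zeta>: "\<zeta> \<in> L2 K" for p \<zeta>
      proof -
        have pb: "p \<in> bounded_ops K" using p commutant_subset_bounded by blast
        note L = bounded_ops_L2[OF pb \<eta>L] bounded_ops_L2[OF Rb bounded_ops_L2[OF pb vacuum_L2]]
        show ?thesis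
          by (rule L2_inner_cong_AE[OF bounded_ops_L2[OF Sb L(1)] bounded_ops_L2[OF Sb L(2)] \<zeta> \<zeta>
                bounded_ops_cong[OF Sb L R_eq[OF p]]]) simp
      qed
      have "AE z in K. T (S \<eta>) z - S (T \<eta>) z = 0"
      proof (rule total_tensor_delta[unfolded total_L2_def, THEN conjunct2, rule_format])
        show "(\<lambda>z. T (S \<eta>) z - S (T \<eta>) z) \<in> L2 K"
          by (rule L2_diff[OF TS ST])
        fix \<zeta> assume "\<zeta> \<in> {tensor_delta f g |f g. f \<in> bounded_fun \<and> g \<in> carrier G}"
        then obtain f g where \<zeta>: "\<zeta> = tensor_delta f g" and f: "f \<in> bounded_fun" and g: "g \<in> carrier G"
          by blast
        have \<zeta>L: "\<zeta> \<in> L2 K"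
          unfolding \<zeta> by (rule tensor_delta_L2(1)[OF bounded_fun_L2[OF f] g])
        have flipL: "flip f g (S \<eta>) \<in> L2 K"
          using flip_L2[OF f g] bounded_ops_L2[OF Sb \<eta>L] by blast
        have "(\<lambda>k. L2_inner K (S (R (q k vacuum))) \<zeta>) \<longlonglongrightarrow> L2_inner K (S (R (T vacuum))) \<zeta>"
          using bounded_ops_tendsto[OF bounded_ops_comp[OF Sb Rb] q\<Omega> T\<Omega> lim]
          by (intro L2_inner_tendsto_left bounded_ops_L2[OF bounded_ops_comp[OF Sb Rb]] q\<Omega> T\<Omega> \<zeta>L)
        moreover have "L2_inner K (S (R (q k vacuum))) \<zeta> = L2_inner K (q k vacuum) (flip f g (S \<eta>))" for k
        proof -
          have "L2_inner K (S (R (q k vacuum))) \<zeta> = L2_inner K (S (q k \<eta>)) \<zeta>"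
            by (rule S_eq[OF q(2) \<zeta>L, symmetric])
          also have "\<dots> = L2_inner K (q k (S \<eta>)) \<zeta>"
            by (rule L2_inner_cong_AE[OF bounded_ops_L2[OF Sb bounded_ops_L2[OF qb \<eta>L]]
                  bounded_ops_L2[OF qb bounded_ops_L2[OF Sb \<eta>L]] \<zeta>L \<zeta>L commutantD[OF S q(1) \<eta>L]]) simp
          also have "\<dots> = L2_inner K (q k vacuum) (flip f g (S \<eta>))"
            unfolding \<zeta> by (rule left_inner_flip[OF q(2) f g bounded_ops_L2[OF Sb \<eta>L]])
          finally show ?thesis .
        qed
        \<comment> \<open>\<open>S \<eta>\<close> is no elementary tensor in general, so
          \<open>R\<close> does not apply to it; only the coefficient against \<open>\<zeta>\<close>
          is shown to converge.\<close>
        moreover have "(\<lambda>k. L2_inner K (q k vacuum) (flip f g (S \<eta>))) \<longlonglongrightarrow> L2_inner K (T vacuum) (flip f g (S \<eta>))"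
          by (rule L2_inner_tendsto_left[OF q\<Omega> T\<Omega> flipL lim])
        ultimately have "L2_inner K (S (R (T vacuum))) \<zeta> = L2_inner K (T vacuum) (flip f g (S \<eta>))"
          using LIMSEQ_unique by simp
        also have "\<dots> = L2_inner K (T (S \<eta>)) \<zeta>"
          unfolding \<zeta> by (rule left_inner_flip[OF T f g bounded_ops_L2[OF Sb \<eta>L], symmetric])
        finally show "L2_inner K (\<lambda>z. T (S \<eta>) z - S (T \<eta>) z) \<zeta> = 0"
          using L2_inner_diff_left[OF TS ST \<zeta>L] S_eq[OF T \<zeta>L] by simp
      qed
      then show "AE z in K. T (S \<eta>) z = S (T \<eta>) z"
        by simp
    qed
  qed
  then have "T \<in> commutant K (commutant K \<A>)"
    using Tb by (simp add: commutant_def[of K "commutant K \<A>"])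
  with \<A> show ?thesis by simp
qed

end

section \<open>Intermediate algebras\<close>

locale intermediate_algebra = profinite_action +
  fixes P :: "(((nat \<Rightarrow> 'a set) \<times> 'a \<Rightarrow> complex) \<Rightarrow> ((nat \<Rightarrow> 'a set) \<times> 'a \<Rightarrow> complex)) set"
  assumes bicommutant_P: "commutant K (commutant K P) = P"
    and unitary_P: "\<And>g. g \<in> carrier G \<Longrightarrow> group_unitary G act g \<in> P"
    and P_left: "P \<subseteq> left_algebra"
begin

section \<open>Conjugation and the projection onto the closure of \<open>P vacuum\<close>\<close>

lemmas P_plus = bicommutant_closed(1)[OF bicommutant_P]
  and P_smult = bicommutant_closed(2)[OF bicommutant_P]
  and P_comp = bicommutant_closed(3)[OF bicommutant_P]
  and P_cong = bicommutant_closed(4)[OF bicommutant_P]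

lemma P_bounded: "p \<in> P \<Longrightarrow> p \<in> bounded_ops K"
  using P_left commutant_subset_bounded by blast

lemma P_vacuum_L2: "p \<in> P \<Longrightarrow> p vacuum \<in> L2 K"
  by (rule bounded_ops_L2[OF P_bounded vacuum_L2])

text \<open>The map \<open>T \<mapsto> u\<^sub>g T u\<^sub>g\<^sup>*\<close> on the level of vacuum
  vectors, because \<open>right_translation g\<close> is right multiplication by
  \<open>u\<^sub>g\<^sup>*\<close>.\<close>

definition conj_op :: "'a \<Rightarrow> ((nat \<Rightarrow> 'a set) \<times> 'a \<Rightarrow> complex) \<Rightarrow> ((nat \<Rightarrow> 'a set) \<times> 'a \<Rightarrow> complex)" where
  "conj_op g \<xi> = group_unitary G act g (right_translation g \<xi>)"

lemma conj_op_bounded: "g \<in> carrier G \<Longrightarrow> conj_op g \<in> bounded_ops K"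
  unfolding conj_op_def by (rule bounded_ops_comp[OF unitary_bounded right_translation_bounded])

lemma conj_op_apply: "conj_op g \<xi> (x, h) = \<xi> (act (inv g) x, inv g \<otimes> h \<otimes> g)"
  by (simp add: conj_op_def group_unitary_def right_translation_def)

lemma conj_op_inner:
  assumes g: "g \<in> carrier G" and "\<xi> \<in> L2 K" "\<eta> \<in> L2 K"
  shows "L2_inner K (conj_op g \<xi>) (conj_op g \<eta>) = L2_inner K \<xi> \<eta>"
  unfolding conj_op_def
  using unitary_inner[OF g] right_translation_inner[OF g] bounded_ops_L2[OF right_translation_bounded[OF g]] assms
  by simp

text \<open>Right translation by \<open>g\<close> and the unitary of \<open>inv g\<close> agree on
  the vacuum, and \<open>p\<close> commutes with right translations. Hence right translations
  preserve \<open>P vacuum\<close> up to null sets.\<close>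

lemma right_translation_P_vacuum:
  assumes p: "p \<in> P" and g: "g \<in> carrier G"
  shows "AE z in K. right_translation g (p vacuum) z = p (group_unitary G act (inv g) vacuum) z"
proof -
  note pb = P_bounded[OF p] and ig = inv_closed[OF g]
  have "right_translation g vacuum z = group_unitary G act (inv g) vacuum z" if "z \<in> space K" for z
  proof -
    obtain x h where z: "z = (x, h)" "x \<in> inverse_limit G N" "h \<in> carrier G"
      using \<open>z \<in> space K\<close> by (auto simp: space_K)
    have "h \<otimes> g = \<one> \<longleftrightarrow> g \<otimes> h = \<one>"
      using z(3) g inv_comm by blast
    then show ?thesis
      using g by (simp add: z(1) right_translation_def group_unitary_def vacuum_def tensor_delta_def)
  qed
  then have "AE z in K. p (right_translation g vacuum) z = p (group_unitary G act (inv g) vacuum) z"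
    by (intro bounded_ops_cong[OF pb bounded_ops_L2[OF right_translation_bounded[OF g] vacuum_L2]
          bounded_ops_L2[OF unitary_bounded[OF ig] vacuum_L2]] AE_I2) simp
  moreover have "AE z in K. p (right_translation g vacuum) z = right_translation g (p vacuum) z"
    by (rule commutantD[OF _ _ vacuum_L2]) (use p P_left g in \<open>auto simp: right_ops_def\<close>)
  ultimately show ?thesis
    by eventually_elim simp
qed

lemma conj_op_P_vacuum:
  assumes p: "p \<in> P" and g: "g \<in> carrier G"
  obtains q where "q \<in> P" "AE z in K. conj_op g (p vacuum) z = q vacuum z"
proof
  note ig = inv_closed[OF g]
  show "(\<lambda>\<xi>. group_unitary G act g (p (group_unitary G act (inv g) \<xi>))) \<in> P"
    by (rule P_comp[OF unitary_P[OF g] P_comp[OF p unitary_P[OF ig]]])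
  show "AE z in K. conj_op g (p vacuum) z = group_unitary G act g (p (group_unitary G act (inv g) vacuum)) z"
    unfolding conj_op_def
    by (rule bounded_ops_cong[OF unitary_bounded[OF g] _ _ right_translation_P_vacuum[OF p g]])
      (intro bounded_ops_L2[OF right_translation_bounded[OF g]] P_vacuum_L2 p
        bounded_ops_L2[OF P_bounded[OF p]] bounded_ops_L2[OF unitary_bounded[OF ig]] vacuum_L2)+
qed

lemma subspace_P_vacuum: "subspace_L2 K {p vacuum | p. p \<in> P}"
proof (rule subspace_L2_orbit[OF _ _ vacuum_L2])
  show "P \<subseteq> bounded_ops K" using P_bounded by blast
  show "P \<noteq> {}" using unitary_P by blast
qed (auto intro: P_plus P_smult)

text \<open>Invariance makes the norm of the fiber constant along the \<open>N n\<close>-class of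
  \<open>h\<close>; the class is infinite, and the squared fiber norms are summable.\<close>

lemma invariant_vector_support:
  assumes w: "w \<in> L2 K" and inv: "\<And>g. g \<in> N n \<Longrightarrow> AE z in K. conj_op g w z = w z"
    and h: "h \<in> carrier G" "h \<noteq> \<one>"
  shows "AE x in X. w (x, h) = 0"
proof -
  define s where "s k = (L2_norm X (\<lambda>x. w (x, k)))\<^sup>2" for k
  define S where "S = {inv g \<otimes> h \<otimes> g | g. g \<in> N n}"
  have CG: "S \<subseteq> carrier G"
    unfolding S_def using h(1) N_carrier by auto
  have s_const: "s k = s h" if kC: "k \<in> S" for k
  proof -
    obtain g where g: "g \<in> N n" "k = inv g \<otimes> h \<otimes> g"
      using kC by (auto simp: S_def)
    have gG: "g \<in> carrier G" using g(1) by (rule N_carrier)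
    have kG: "k \<in> carrier G" using kC CG by blast
    have "AE z in K. conj_op g w z - w z = 0"
      using inv[OF g(1)] by eventually_elim simp
    then have "AE x in X. conj_op g w (x, h) - w (x, h) = 0"
      by (rule AE_fiber_zero[OF L2_diff[OF bounded_ops_L2[OF conj_op_bounded[OF gG] w] w] _ h(1)])
    then have "AE x in X. w (act (inv g) x, k) = w (x, h)"
      by eventually_elim (simp add: conj_op_apply g(2))
    then have "L2_norm X (\<lambda>x. w (act (inv g) x, k)) = L2_norm X (\<lambda>x. w (x, h))"
      by (rule L2_norm_cong_AE[rotated 2])
        (intro L2_measurable L2_norm_comp(1)[OF act_preserving[OF inv_closed[OF gG]] L2_fiber(1)[OF w kG]] L2_fiber(1)[OF w h(1)])+
    then show ?thesis
      using L2_norm_comp(2)[OF act_preserving[OF inv_closed[OF gG]] L2_fiber(1)[OF w kG]] by (simp add: s_def)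
  qed
  \<comment> \<open>A positive \<open>s h\<close> would make the sum over \<open>S\<close> infinite,
    against the finite norm of \<open>w\<close>.\<close>
  have "ennreal (s h) * \<infinity> = ennreal (s h) * emeasure (count_space (carrier G)) S"
    using infinite_N_class[OF h, of n] CG by (simp add: emeasure_count_space S_def)
  also have "\<dots> = (\<integral>\<^sup>+k. ennreal (s h) * indicator S k \<partial>count_space (carrier G))"
    using CG by (subst nn_integral_cmult_indicator) auto
  also have "\<dots> \<le> (\<integral>\<^sup>+k. (\<integral>\<^sup>+x. ennreal ((cmod (w (x, k)))\<^sup>2) \<partial>X) \<partial>count_space (carrier G))"
  proof (rule nn_integral_mono)
    fix k assume "k \<in> space (count_space (carrier G))"
    then have k: "k \<in> carrier G" by simp
    show "ennreal (s h) * indicator S k \<le> (\<integral>\<^sup>+x. ennreal ((cmod (w (x, k)))\<^sup>2) \<partial>X)"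
    proof (cases "k \<in> S")
      case True
      then show ?thesis
        using s_const[OF True] nn_integral_cmod_sq[OF L2_fiber(1)[OF w k]] by (simp add: s_def)
    next
      case False
      then show ?thesis by simp
    qed
  qed
  also have "\<dots> = ennreal ((L2_norm K w)\<^sup>2)"
    by (rule L2_norm_K_sq[OF w, symmetric])
  finally have "s h = 0"
    by (cases "s h = 0") (auto simp: s_def ennreal_mult_top top_unique)
  then show ?thesis
    using L2_norm_eq_0_iff[OF L2_fiber(1)[OF w h(1)]] by (simp add: s_def)
qed

lemma mult_op_vacuum: "mult_op f vacuum = tensor_delta f \<one>"
  by (auto simp: fun_eq_iff mult_op_def vacuum_def tensor_delta_def)

text \<open>
  The conditional expectation of \<open>L\<^sup>\<infinity>(G / N n)\<close> onto \<open>P\<close>: \<open>N n\<close> fixes the cylinder pointwise, hence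
  conjugation by \<open>N n\<close> fixes the projection of its indicator onto the closure of \<open>P vacuum\<close>.
\<close>

lemma cylinder_projection:
  assumes C: "C \<in> cosets n"
  shows "\<exists>\<beta>. mult_op (step_fun n \<beta>) \<in> P \<and> (\<forall>p\<in>P.
    L2_inner K (tensor_delta (\<lambda>x. indicator (cylinder n C) x - step_fun n \<beta> x) \<one>) (p vacuum) = 0)"
proof -
  define f :: "(nat \<Rightarrow> 'a set) \<Rightarrow> complex" where "f x = indicator (cylinder n C) x" for x
  have fb: "f \<in> bounded_fun"
    unfolding f_def by (rule bounded_fun_indicator[OF cylinder_sets[OF C]])
  define F where "F = tensor_delta f \<one>"
  have F: "F \<in> L2 K"
    unfolding F_def by (intro tensor_delta_L2 bounded_fun_L2 fb one_closed)
  obtain w v where w: "w \<in> L2 K" and v: "\<forall>k. v k \<in> {p vacuum | p. p \<in> P}"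
    and lim: "(\<lambda>k. L2_norm K (\<lambda>x. v k x - w x)) \<longlonglongrightarrow> 0"
    and orth: "\<forall>u\<in>{p vacuum | p. p \<in> P}. L2_inner K (\<lambda>x. F x - w x) u = 0"
    using L2_projection[OF subspace_P_vacuum F] by blast
  have orthP: "L2_inner K (\<lambda>x. F x - w x) (p vacuum) = 0" if "p \<in> P" for p
    using orth that by blast
  have "\<forall>k. \<exists>p. p \<in> P \<and> v k = p vacuum"
    using v by blast
  then obtain p where p: "\<And>k. p k \<in> P" and vp: "\<And>k. v k = p k vacuum"
    by metis
  have pL: "p k vacuum \<in> L2 K" for k
    by (rule P_vacuum_L2[OF p])
  note lim = lim[unfolded vp]
  have [simp]: "inv g \<otimes> h \<otimes> g = \<one> \<longleftrightarrow> h = \<one>" if "g \<in> carrier G" "h \<in> carrier G" for g h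
  proof
    assume "inv g \<otimes> h \<otimes> g = \<one>"
    then have "g \<otimes> (inv g \<otimes> h \<otimes> g) \<otimes> inv g = g \<otimes> \<one> \<otimes> inv g" by simp
    moreover have "g \<otimes> (inv g \<otimes> h \<otimes> g) \<otimes> inv g = h"
      using that by (simp add: m_assoc) (simp add: m_assoc[symmetric])
    ultimately show "h = \<one>" using that by simp
  qed (use that in simp)
  \<comment> \<open>\<open>F\<close> is fixed by the conjugation and the closure of
    \<open>P vacuum\<close> is stable under it, so \<open>w\<close> and \<open>conj_op g w\<close>
    are projections of the same vector. Their difference \<open>y\<close> is orthogonal to
    \<open>P vacuum\<close>, yet built from two limits of such vectors, hence zero.\<close>
  have invariant: "AE z in K. conj_op g w z = w z" if g: "g \<in> N n" for g
  proof -
    have gG: "g \<in> carrier G" using g by (rule N_carrier)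
    note igG = inv_closed[OF gG]
    note Ad = bounded_ops_L2[OF conj_op_bounded[OF gG]]
    have F_inv: "conj_op g F z = F z" if "z \<in> space K" for z
    proof -
      obtain x h where z: "z = (x, h)" "x \<in> inverse_limit G N" "h \<in> carrier G"
        using \<open>z \<in> space K\<close> by (auto simp: space_K)
      have "inv g \<otimes> h \<otimes> g = \<one> \<longleftrightarrow> h = \<one>"
        using gG z(3) by simp
      moreover have "act (inv g) x \<in> cylinder n C \<longleftrightarrow> x \<in> cylinder n C"
        using coset_translate_N[OF subgroup.m_inv_closed[OF subgroup_N g] inverse_limit_coset[OF z(2)]]
          act_closed[OF igG z(2)] z(2) by (simp add: cylinder_def translation_def)
      ultimately show ?thesis
        by (simp add: z(1) conj_op_apply F_def tensor_delta_def f_def indicator_def)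
    qed
    define y where "y z = w z - conj_op g w z" for z
    have y: "y \<in> L2 K"
      unfolding y_def by (intro L2_diff w Ad)
    have y_orth: "L2_inner K y (q vacuum) = 0" if q: "q \<in> P" for q
    proof -
      \<comment> \<open>As conjugation preserves inner products, it can be moved off the first
        argument, at the price of replacing \<open>q\<close> by its conjugate under
        \<open>inv g\<close>.\<close>
      obtain q' where q': "q' \<in> P" "AE z in K. conj_op (inv g) (q vacuum) z = q' vacuum z"
        using conj_op_P_vacuum[OF q igG] by blast
      note Adi = bounded_ops_L2[OF conj_op_bounded[OF igG] P_vacuum_L2[OF q]]
      have undo: "conj_op g (conj_op (inv g) (q vacuum)) z = q vacuum z" if "z \<in> space K" for z
      proof -
        obtain x h where z: "z = (x, h)" "x \<in> inverse_limit G N" "h \<in> carrier G"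
          using \<open>z \<in> space K\<close> by (auto simp: space_K)
        have "g \<otimes> (inv g \<otimes> h \<otimes> g) \<otimes> inv g = h"
          using gG z(3) by (simp add: m_assoc) (simp add: m_assoc[symmetric])
        then show ?thesis
          using gG act_inv_cancel(1)[OF gG z(2)] by (simp add: z(1) conj_op_apply)
      qed
      have "L2_inner K (conj_op g (\<lambda>z. F z - w z)) (q vacuum)
          = L2_inner K (conj_op g (\<lambda>z. F z - w z)) (conj_op g (conj_op (inv g) (q vacuum)))"
        by (rule L2_inner_cong_AE[OF Ad[OF L2_diff[OF F w]] Ad[OF L2_diff[OF F w]] P_vacuum_L2[OF q] Ad[OF Adi]])
          (auto intro!: AE_I2 simp: undo)
      also have "\<dots> = L2_inner K (\<lambda>z. F z - w z) (conj_op (inv g) (q vacuum))"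
        by (rule conj_op_inner[OF gG L2_diff[OF F w] Adi])
      also have "\<dots> = L2_inner K (\<lambda>z. F z - w z) (q' vacuum)"
        by (rule L2_inner_cong_AE[OF L2_diff[OF F w] L2_diff[OF F w] Adi P_vacuum_L2[OF q'(1)] _ q'(2)]) simp
      also have "\<dots> = 0"
        by (rule orthP[OF q'(1)])
      finally have 1: "L2_inner K (conj_op g (\<lambda>z. F z - w z)) (q vacuum) = 0" .
      have "L2_inner K (conj_op g (\<lambda>z. F z - w z)) (q vacuum)
          = L2_inner K (\<lambda>z. F z - conj_op g w z) (q vacuum)"
      proof (rule L2_inner_cong_AE[OF Ad[OF L2_diff[OF F w]] L2_diff[OF F Ad[OF w]] P_vacuum_L2[OF q] P_vacuum_L2[OF q]])
        show "AE z in K. conj_op g (\<lambda>z. F z - w z) z = F z - conj_op g w z"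
        proof (rule AE_I2)
          fix z assume "z \<in> space K"
          from F_inv[OF this] show "conj_op g (\<lambda>z. F z - w z) z = F z - conj_op g w z"
            by (cases z) (simp add: conj_op_apply)
        qed
      qed simp
      with 1 have "L2_inner K (\<lambda>z. F z - conj_op g w z) (q vacuum) = 0" by simp
      moreover have "y = (\<lambda>z. (F z - conj_op g w z) - (F z - w z))"
        by (auto simp: y_def)
      ultimately show ?thesis
        using L2_inner_diff_left[OF L2_diff[OF F Ad[OF w]] L2_diff[OF F w] P_vacuum_L2[OF q]] orthP[OF q] by simp
    qed
    have "L2_inner K y w = 0"
      by (rule L2_inner_orthogonal_limit[OF pL w lim y y_orth[OF p]])
    moreover have "L2_inner K y (conj_op g w) = 0"
    proof (rule L2_inner_orthogonal_limit[OF Ad[OF pL] Ad[OF w] bounded_ops_tendsto[OF conj_op_bounded[OF gG] pL w lim] y])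
      fix k
      obtain q where q: "q \<in> P" "AE z in K. conj_op g (p k vacuum) z = q vacuum z"
        using conj_op_P_vacuum[OF p gG] by blast
      have "L2_inner K y (conj_op g (p k vacuum)) = L2_inner K y (q vacuum)"
        by (rule L2_inner_cong_AE[OF y y Ad[OF pL] P_vacuum_L2[OF q(1)] _ q(2)]) simp
      then show "L2_inner K y (conj_op g (p k vacuum)) = 0"
        using y_orth[OF q(1)] by simp
    qed
    ultimately have "L2_inner K y y = 0"
      using L2_inner_diff_right[OF w Ad[OF w] y] by (simp flip: y_def)
    from L2_inner_self_eq_0[OF y this] show ?thesis
      by eventually_elim (simp add: y_def)
  qed
  \<comment> \<open>Over the identity, conjugation moves only the point of \<open>X\<close>, so this
    fiber is an \<open>N n\<close>-invariant function.\<close>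
  have fiber_inv: "AE x in X. w (act (inv g) x, \<one>) = w (x, \<one>)" if g: "g \<in> N n" for g
  proof -
    have gG: "g \<in> carrier G" using g by (rule N_carrier)
    have "AE z in K. conj_op g w z - w z = 0"
      using invariant[OF g] by eventually_elim simp
    then have "AE x in X. conj_op g w (x, \<one>) - w (x, \<one>) = 0"
      by (rule AE_fiber_zero[OF L2_diff[OF bounded_ops_L2[OF conj_op_bounded[OF gG] w] w] _ one_closed])
    then show ?thesis
      by eventually_elim (use gG in \<open>simp add: conj_op_apply\<close>)
  qed
  have "\<exists>\<beta>. AE x in X. w (x, \<one>) = step_fun n \<beta> x"
    by (rule invariant_eq_step_fun[OF L2_X_integrable[OF L2_fiber(1)[OF w one_closed]] fiber_inv])
  then obtain \<beta> where \<beta>: "AE x in X. w (x, \<one>) = step_fun n \<beta> x" ..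
  define b where "b = step_fun n \<beta>"
  have bb: "b \<in> bounded_fun"
    unfolding b_def by (rule bounded_fun_step)
  note bL = tensor_delta_L2(1)[OF bounded_fun_L2[OF bb] one_closed]
  have "AE z in K. w z - tensor_delta b \<one> z = 0"
  proof (rule AE_K_zeroI[OF L2_diff[OF w bL]])
    fix h assume h: "h \<in> carrier G"
    show "AE x in X. w (x, h) - tensor_delta b \<one> (x, h) = 0"
    proof (cases "h = \<one>")
      case True
      then show ?thesis
        using \<beta> by (simp add: tensor_delta_def b_def)
    next
      case False
      then show ?thesis
        using invariant_vector_support[OF w invariant h False] by (simp add: tensor_delta_def)
    qed
  qed
  then have w_eq: "AE z in K. w z = tensor_delta b \<one> z"
    by simp
  \<comment> \<open>A step function is bounded, so \<open>w\<close> is the vacuum vector of an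
    operator in the left algebra; closedness then applies to the operators
    \<open>p k\<close>.\<close>
  have "mult_op b \<in> P"
  proof (rule bicommutant_vacuum_closed[OF bicommutant_P])
    show "p k \<in> P" "p k \<in> left_algebra" for k
      using p P_left by blast+
    show "mult_op b \<in> left_algebra"
      by (rule mult_op_left[OF bounded_fun_Linf[OF bb]])
    have "L2_norm K (\<lambda>x. p k vacuum x - w x) = L2_norm K (\<lambda>x. p k vacuum x - tensor_delta b \<one> x)" for k
      by (rule L2_norm_cong_AE[OF L2_measurable[OF L2_diff[OF pL w]] L2_measurable[OF L2_diff[OF pL bL]]])
        (use w_eq in eventually_elim, simp)
    with lim show "(\<lambda>k. L2_norm K (\<lambda>z. p k vacuum z - mult_op b vacuum z)) \<longlonglongrightarrow> 0"
      by (simp add: mult_op_vacuum)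
  qed
  moreover have "L2_inner K (tensor_delta (\<lambda>x. f x - b x) \<one>) (q vacuum) = 0" if q: "q \<in> P" for q
  proof -
    have "tensor_delta (\<lambda>x. f x - b x) \<one> = (\<lambda>z. F z - tensor_delta b \<one> z)"
      by (auto simp: F_def tensor_delta_def fun_eq_iff)
    moreover have "L2_inner K (\<lambda>z. F z - tensor_delta b \<one> z) (q vacuum) = L2_inner K (\<lambda>z. F z - w z) (q vacuum)"
    proof (rule L2_inner_cong_AE[OF L2_diff[OF F bL] L2_diff[OF F w] P_vacuum_L2[OF q] P_vacuum_L2[OF q]])
      show "AE z in K. F z - tensor_delta b \<one> z = F z - w z"
        using w_eq by eventually_elim simp
    qed simp
    ultimately have "L2_inner K (tensor_delta (\<lambda>x. f x - b x) \<one>) (q vacuum) = L2_inner K (\<lambda>z. F z - w z) (q vacuum)"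
      by simp
    with orthP[OF q] show ?thesis by simp
  qed
  ultimately show ?thesis
    unfolding b_def f_def by blast
qed

section \<open>Multiplication operators in \<open>P\<close>\<close>

lemma mult_op_P_cong:
  assumes "mult_op f \<in> P" "g \<in> Linf X" "AE x in X. g x = f x" "f \<in> borel_measurable X"
  shows "mult_op g \<in> P"
proof (rule P_cong[OF assms(1) mult_op_bounded[OF assms(2)]])
  fix \<xi> :: "(nat \<Rightarrow> 'a set) \<times> 'a \<Rightarrow> complex"
  have [measurable]: "g \<in> borel_measurable X" "f \<in> borel_measurable X"
    using assms(2,4) by (auto simp: Linf_def)
  have "Measurable.pred X (\<lambda>x. g x = f x)"
    unfolding pred_def by measurable
  then have "AE z in K. g (fst z) = f (fst z)"
    by (rule AE_K_fst[OF _ assms(3)])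
  then show "AE z in K. mult_op g \<xi> z = mult_op f \<xi> z"
    by eventually_elim (simp add: mult_op_def split_beta')
qed

lemma mult_op_P_cong_space:
  assumes f: "mult_op f \<in> P" "f \<in> bounded_fun" and eq: "\<And>x. x \<in> space X \<Longrightarrow> g x = f x"
  shows "mult_op g \<in> P"
proof (rule mult_op_P_cong[OF f(1)])
  show "g \<in> Linf X"
    by (rule bounded_fun_Linf[OF bounded_fun_cong[OF f(2) eq]])
  show "f \<in> borel_measurable X"
    using f(2) by (simp add: bounded_fun_def)
qed (auto intro: AE_I2 eq)

lemma mult_op_P_add: "mult_op f \<in> P \<Longrightarrow> mult_op g \<in> P \<Longrightarrow> mult_op (\<lambda>x. f x + g x) \<in> P"
  using P_plus[of "mult_op f" "mult_op g"] by (simp add: mult_op_eq distrib_right)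

lemma mult_op_P_mult: "mult_op f \<in> P \<Longrightarrow> mult_op g \<in> P \<Longrightarrow> mult_op (\<lambda>x. f x * g x) \<in> P"
  using P_comp[of "mult_op f" "mult_op g"] by (simp add: mult_op_eq mult.assoc)

lemma mult_op_P_scale: "mult_op f \<in> P \<Longrightarrow> mult_op (\<lambda>x. c * f x) \<in> P"
  using P_smult[of "mult_op f" c] by (simp add: mult_op_eq mult.assoc)

lemma mult_op_P_const: "mult_op (\<lambda>x. c) \<in> P"
  using P_smult[OF identity_bicommutant[OF bicommutant_P], of c] by (simp add: mult_op_eq)

text \<open>\<open>f \<mapsto> mult_op f vacuum\<close> is an isometry on square integrable
  functions, so convergence in norm suffices, without a common bound on the
  \<open>f k\<close>.\<close>

lemma mult_op_P_limit:
  assumes f: "\<And>k. f k \<in> bounded_fun" "\<And>k. mult_op (f k) \<in> P" and g: "g \<in> bounded_fun"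
    and lim: "(\<lambda>k. L2_norm X (\<lambda>x. f k x - g x)) \<longlonglongrightarrow> 0"
  shows "mult_op g \<in> P"
proof (rule bicommutant_vacuum_closed[OF bicommutant_P f(2)])
  show "mult_op (f k) \<in> left_algebra" for k
    using f(2) P_left by blast
  show "mult_op g \<in> left_algebra"
    by (rule mult_op_left[OF bounded_fun_Linf[OF g]])
  have "(\<lambda>z. mult_op (f k) vacuum z - mult_op g vacuum z) = tensor_delta (\<lambda>x. f k x - g x) \<one>" for k
    unfolding mult_op_vacuum by (auto simp: tensor_delta_def fun_eq_iff)
  then have "L2_norm K (\<lambda>z. mult_op (f k) vacuum z - mult_op g vacuum z) = L2_norm X (\<lambda>x. f k x - g x)" for k
    using tensor_delta_L2(2)[OF L2_diff[OF bounded_fun_L2[OF f(1)] bounded_fun_L2[OF g]] one_closed] by simp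
  with lim show "(\<lambda>k. L2_norm K (\<lambda>z. mult_op (f k) vacuum z - mult_op g vacuum z)) \<longlonglongrightarrow> 0"
    by simp
qed

section \<open>The sigma-algebra of \<open>P\<close> and the factor \<open>Y\<close>\<close>

definition P_sets :: "(nat \<Rightarrow> 'a set) set set" where
  "P_sets = {A \<in> sets X. mult_op (\<lambda>x. indicator A x) \<in> P}"

lemma P_sets_Int: "A \<in> P_sets \<Longrightarrow> B \<in> P_sets \<Longrightarrow> A \<inter> B \<in> P_sets"
proof -
  assume "A \<in> P_sets" "B \<in> P_sets"
  moreover have "indicator (A \<inter> B) = (\<lambda>x. indicator A x * indicator B x :: complex)"
    by (rule ext) (rule indicator_inter_arith)
  ultimately show ?thesis
    using mult_op_P_mult[of "\<lambda>x. indicator A x" "\<lambda>x. indicator B x"] by (auto simp: P_sets_def)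
qed

lemma P_sets_Compl:
  assumes "A \<in> P_sets"
  shows "space X - A \<in> P_sets"
proof -
  have A: "A \<in> sets X" and mA: "mult_op (\<lambda>x. indicator A x) \<in> P"
    using assms by (auto simp: P_sets_def)
  have "mult_op (\<lambda>x. 1 + (-1) * indicator A x) \<in> P"
    by (intro mult_op_P_add mult_op_P_const mult_op_P_scale mA)
  then have "mult_op (\<lambda>x. indicator (space X - A) x) \<in> P"
  proof (rule mult_op_P_cong_space)
    show "(\<lambda>x. 1 + (-1) * indicator A x) \<in> bounded_fun"
      by (intro bounded_fun_add bounded_fun_const bounded_fun_mult bounded_fun_indicator A)
  qed (auto simp: indicator_def)
  with A show ?thesis by (auto simp: P_sets_def)
qed

text \<open>Intersections and complements are products and affine combinations in \<open>P\<close>;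
  a countable union is the \<open>L\<^sup>2\<close> limit of its finite partial unions.\<close>

lemma sigma_algebra_P_sets: "sigma_algebra (space X) P_sets"
proof -
  have alg: "algebra (space X) P_sets"
    unfolding algebra_iff_Int
  proof (intro conjI ballI)
    show "P_sets \<subseteq> Pow (space X)"
      using sets.space_closed[of X] by (auto simp: P_sets_def)
    show "{} \<in> P_sets"
    proof -
      have "indicator {} = (\<lambda>x :: nat \<Rightarrow> 'a set. 0 :: complex)" by (rule ext) simp
      then show ?thesis using mult_op_P_const[of 0] by (simp add: P_sets_def)
    qed
  qed (auto intro: P_sets_Int P_sets_Compl)
  show ?thesis
    unfolding sigma_algebra_iff
  proof (intro conjI alg allI impI)
    fix A :: "nat \<Rightarrow> (nat \<Rightarrow> 'a set) set" assume A: "range A \<subseteq> P_sets"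
    have fin: "(\<Union>i<k. A i) \<in> P_sets" for k
      using A by (intro ring_of_sets.finite_UN[OF algebra.axioms(1)[OF alg]]) auto
    have finX: "(\<Union>i<k. A i) \<in> sets X" for k
      using fin[of k] by (simp add: P_sets_def)
    have UX: "(\<Union>i. A i) \<in> sets X"
      using A by (auto simp: P_sets_def)
    have "mult_op (\<lambda>x. indicator (\<Union>i. A i) x) \<in> P"
    proof (rule mult_op_P_limit)
      show "(\<lambda>x. indicator (\<Union>i<k. A i) x) \<in> bounded_fun" for k
        by (rule bounded_fun_indicator[OF finX])
      show "mult_op (\<lambda>x. indicator (\<Union>i<k. A i) x) \<in> P" for k
        using fin[of k] by (simp add: P_sets_def)
      show "(\<lambda>x. indicator (\<Union>i. A i) x) \<in> bounded_fun"
        by (rule bounded_fun_indicator[OF UX])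
      show "(\<lambda>k. L2_norm X (\<lambda>x. indicator (\<Union>i<k. A i) x - indicator (\<Union>i. A i) x)) \<longlonglongrightarrow> 0"
      proof (rule L2_dominated_convergence[where C = 1])
        show "(\<lambda>x. indicator (\<Union>i<k. A i) x :: complex) \<in> borel_measurable X" for k
          using finX by simp
        show "(\<lambda>x. indicator (\<Union>i. A i) x :: complex) \<in> borel_measurable X"
          using UX by simp
        show "(\<lambda>k. indicator (\<Union>i<k. A i) x) \<longlonglongrightarrow> (indicator (\<Union>i. A i) x :: complex)" for x
          by (rule LIMSEQ_indicator_UN)
      qed (simp add: indicator_def)
    qed
    with UX show "(\<Union>i. A i) \<in> P_sets" by (simp add: P_sets_def)
  qed
qed

text \<open>Coarsening the sigma-algebra on the same points makes functions on \<open>Y\<close>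
  literally functions on \<open>X\<close>, and the identity serves as factor map.\<close>

definition Y :: "(nat \<Rightarrow> 'a set) measure" where
  "Y = restr_to_subalg X (sigma (space X) P_sets)"

lemma P_sets_Pow: "P_sets \<subseteq> Pow (space X)"
  using sets.space_closed[of X] by (auto simp: P_sets_def)

lemma sets_sigma_P_sets: "sets (sigma (space X) P_sets) = P_sets"
  using sigma_algebra.sigma_sets_eq[OF sigma_algebra_P_sets] P_sets_Pow by simp

lemma subalgebra_P_sets: "subalgebra X (sigma (space X) P_sets)"
  unfolding subalgebra_def sets_sigma_P_sets using P_sets_Pow by (auto simp: P_sets_def space_measure_of_conv)

lemma space_Y: "space Y = space X"
  by (simp add: Y_def space_restr_to_subalg)

lemma sets_Y: "sets Y = P_sets"
  by (simp add: Y_def sets_restr_to_subalg[OF subalgebra_P_sets] sets_sigma_P_sets)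

lemma emeasure_Y: "A \<in> P_sets \<Longrightarrow> emeasure Y A = emeasure X A"
  unfolding Y_def by (rule emeasure_restr_to_subalg[OF subalgebra_P_sets]) (simp only: sets_sigma_P_sets)

lemma measurable_Y_X:
  assumes "f \<in> measurable Y L" shows "f \<in> measurable X L"
  using assms unfolding measurable_def sets_Y space_Y P_sets_def by auto

lemma prob_space_Y: "prob_space Y"
  unfolding Y_def by (rule prob_space_restr_to_subalg[OF subalgebra_P_sets prob_space_X])

text \<open>\<open>u\<^sub>g\<^sup>* 1\<^sub>A u\<^sub>g\<close> is multiplication by the indicator
  of \<open>g\<^sup>-\<^sup>1 A\<close>, and \<open>P\<close> contains the unitaries.\<close>

lemma act_vimage_P_sets:
  assumes A: "A \<in> P_sets" and g: "g \<in> carrier G"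
  shows "act g -` A \<inter> space X \<in> P_sets"
proof -
  have AX: "A \<in> sets X" and mA: "mult_op (\<lambda>x. indicator A x) \<in> P"
    using A by (auto simp: P_sets_def)
  note ig = inv_closed[OF g]
  have B: "act g -` A \<inter> space X \<in> sets X"
    by (rule measurable_sets[OF act_measurable[OF g] AX])
  have "(\<lambda>\<xi>. group_unitary G act (inv g) (mult_op (\<lambda>x. indicator A x) (group_unitary G act g \<xi>))) \<in> P"
    by (rule P_comp[OF unitary_P[OF ig] P_comp[OF mA unitary_P[OF g]]])
  then have "mult_op (\<lambda>x. indicator (act g -` A \<inter> space X) x) \<in> P"
  proof (rule P_cong[OF _ mult_op_bounded[OF bounded_fun_Linf[OF bounded_fun_indicator[OF B]]]])
    fix \<xi> :: "(nat \<Rightarrow> 'a set) \<times> 'a \<Rightarrow> complex"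
    show "AE z in K. mult_op (\<lambda>x. indicator (act g -` A \<inter> space X) x) \<xi> z
        = group_unitary G act (inv g) (mult_op (\<lambda>x. indicator A x) (group_unitary G act g \<xi>)) z"
    proof (rule AE_I2)
      fix z assume "z \<in> space K"
      then obtain x h where z: "z = (x, h)" "x \<in> inverse_limit G N" "h \<in> carrier G"
        by (auto simp: space_K)
      have "inv g \<otimes> (g \<otimes> h) = h"
        using g z(3) by (simp add: m_assoc[symmetric])
      then show "mult_op (\<lambda>x. indicator (act g -` A \<inter> space X) x) \<xi> z
          = group_unitary G act (inv g) (mult_op (\<lambda>x. indicator A x) (group_unitary G act g \<xi>)) z"
        using g z(2) act_inv_cancel(2)[OF g z(2)]
        by (simp add: z(1) mult_op_def group_unitary_def indicator_def space_X)
    qed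
  qed
  with B show ?thesis by (simp add: P_sets_def)
qed

lemma simple_function_P:
  assumes s: "simple_function Y s"
  shows "mult_op s \<in> P" "s \<in> bounded_fun"
proof -
  let ?t = "\<lambda>x. \<Sum>y\<in>s ` space X. y * indicator (s -` {y} \<inter> space X) x"
  have fin: "finite (s ` space X)" and lev: "s -` {y} \<inter> space X \<in> P_sets" for y
    using simple_functionD[OF s] by (auto simp: space_Y sets_Y)
  have "mult_op (\<lambda>x. \<Sum>y\<in>S. y * indicator (s -` {y} \<inter> space X) x) \<in> P
      \<and> (\<lambda>x. \<Sum>y\<in>S. y * indicator (s -` {y} \<inter> space X) x) \<in> bounded_fun" if "finite S" for S
    using that
  proof induction
    case empty
    show ?case using mult_op_P_const[of 0] bounded_fun_const[of 0] by simp
  next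
    case (insert y S)
    have m: "mult_op (\<lambda>x. y * indicator (s -` {y} \<inter> space X) x) \<in> P"
      using lev[of y] by (intro mult_op_P_scale) (simp add: P_sets_def)
    have b: "(\<lambda>x. y * indicator (s -` {y} \<inter> space X) x) \<in> bounded_fun"
      using lev[of y] by (intro bounded_fun_mult bounded_fun_const bounded_fun_indicator) (simp add: P_sets_def)
    show ?case
      unfolding sum.insert[OF insert.hyps]
      by (rule conjI[OF mult_op_P_add[OF m conjunct1[OF insert.IH]] bounded_fun_add[OF b conjunct2[OF insert.IH]]])
  qed
  from this[OF fin] have t: "mult_op ?t \<in> P" "?t \<in> bounded_fun" by blast+
  have eq: "s x = ?t x" if x: "x \<in> space X" for x
  proof -
    have "?t x = (\<Sum>y\<in>s ` space X. if s x = y then y else 0)"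
      using x by (intro sum.cong) (auto simp: indicator_def)
    also have "\<dots> = s x"
      using fin x by (simp add: sum.delta')
    finally show ?thesis ..
  qed
  show "mult_op s \<in> P"
    by (rule mult_op_P_cong_space[OF t eq])
  show "s \<in> bounded_fun"
    by (rule bounded_fun_cong[OF t(2) eq])
qed

lemma AE_Y_X: "AE x in Y. Q x \<Longrightarrow> AE x in X. Q x"
  unfolding Y_def by (rule AE_restr_to_subalg[OF subalgebra_P_sets])

lemma Linf_Y_X:
  assumes "f \<in> Linf Y"
  shows "f \<in> Linf X"
proof -
  obtain C where "f \<in> borel_measurable Y" "AE x in Y. cmod (f x) \<le> C"
    using assms by (auto simp: Linf_def)
  then have "f \<in> borel_measurable X" "AE x in X. cmod (f x) \<le> C"
    using measurable_Y_X AE_Y_X by simp_all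
  then show ?thesis
    unfolding Linf_def by blast
qed

lemma Linf_Y_P:
  assumes f: "f \<in> Linf Y"
  shows "mult_op f \<in> P"
proof -
  obtain C where fm[measurable]: "f \<in> borel_measurable Y" and C: "AE x in Y. cmod (f x) \<le> C"
    using f by (auto simp: Linf_def)
  \<comment> \<open>Cutting off on a null set gives a bound at every point, as
    \<open>bounded_fun\<close> and the dominated convergence lemma demand.\<close>
  define f' where "f' x = (if cmod (f x) \<le> C then f x else 0)" for x
  have [measurable]: "f' \<in> borel_measurable Y"
    unfolding f'_def by measurable
  have f'_le: "cmod (f' x) \<le> \<bar>C\<bar>" for x
    by (auto simp: f'_def)
  have "AE x in X. cmod (f x) \<le> C"
    using C by (rule AE_Y_X)
  then have eq: "AE x in X. f x = f' x"
    by eventually_elim (simp add: f'_def)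
  have f'm: "f' \<in> borel_measurable X"
    by (rule measurable_Y_X) measurable
  have f'b: "f' \<in> bounded_fun"
    unfolding bounded_fun_def using f'm f'_le by blast
  \<comment> \<open>Approximation around the base point 0: the simple functions stay within twice
    the modulus of \<open>f'\<close>, which yields the common bound
    \<open>2 * \<bar>C\<bar>\<close>.\<close>
  obtain s where s: "\<forall>i. simple_function Y (s i)" "\<forall>x\<in>space Y. (\<lambda>i. s i x) \<longlonglongrightarrow> f' x"
    "\<forall>i. \<forall>x\<in>space Y. dist (s i x) 0 \<le> 2 * dist (f' x) 0"
    using borel_measurable_implies_sequence_metric[of f' Y 0] by auto
  have "mult_op f' \<in> P"
  proof (rule mult_op_P_limit[OF _ _ f'b])
    show "s i \<in> bounded_fun" "mult_op (s i) \<in> P" for i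
      using simple_function_P s(1) by blast+
    show "(\<lambda>i. L2_norm X (\<lambda>x. s i x - f' x)) \<longlonglongrightarrow> 0"
    proof (rule L2_dominated_convergence[OF _ f'm])
      show "s i \<in> borel_measurable X" for i
        using simple_function_P(2) s(1) by (auto simp: bounded_fun_def)
      show "cmod (s i x) \<le> 2 * \<bar>C\<bar>" if "x \<in> space X" for i x
      proof -
        have "cmod (s i x) \<le> 2 * cmod (f' x)"
          using s(3)[rule_format, of x i] that by (simp add: space_Y)
        with f'_le[of x] show ?thesis by simp
      qed
      show "(\<lambda>i. s i x) \<longlonglongrightarrow> f' x" if "x \<in> space X" for x
        using s(2) that by (simp add: space_Y)
    qed
  qed
  from mult_op_P_cong[OF this Linf_Y_X[OF f] eq f'm] show ?thesis .
qed

text \<open>The indicator of a level set is a Lagrange interpolation polynomial in the function.\<close>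

lemma finite_range_P_Linf_Y:
  assumes b: "mult_op b \<in> P" "b \<in> bounded_fun" and fin: "finite (b ` space X)"
  shows "b \<in> Linf Y"
proof -
  have "b -` {c} \<inter> space X \<in> P_sets" if c: "c \<in> b ` space X" for c
  proof -
    have "mult_op (\<lambda>x. \<Prod>d\<in>S. (1 / (c - d)) * (b x + - d)) \<in> P
        \<and> (\<lambda>x. \<Prod>d\<in>S. (1 / (c - d)) * (b x + - d)) \<in> bounded_fun" if "finite S" for S
      using that
    proof induction
      case empty
      show ?case using mult_op_P_const[of 1] bounded_fun_const[of 1] by simp
    next
      case (insert d S)
      have "mult_op (\<lambda>x. (1 / (c - d)) * (b x + - d)) \<in> P"
        by (intro mult_op_P_scale mult_op_P_add b mult_op_P_const)
      moreover have "(\<lambda>x. (1 / (c - d)) * (b x + - d)) \<in> bounded_fun"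
        by (intro bounded_fun_mult bounded_fun_add bounded_fun_const b)
      ultimately show ?case
        using insert mult_op_P_mult bounded_fun_mult unfolding prod.insert[OF insert.hyps] by blast
    qed
    from this[of "b ` space X - {c}"] fin
    have L: "mult_op (\<lambda>x. \<Prod>d\<in>b ` space X - {c}. (1 / (c - d)) * (b x + - d)) \<in> P"
      "(\<lambda>x. \<Prod>d\<in>b ` space X - {c}. (1 / (c - d)) * (b x + - d)) \<in> bounded_fun" by blast+
    have "mult_op (\<lambda>x. indicator (b -` {c} \<inter> space X) x) \<in> P"
    proof (rule mult_op_P_cong_space[OF L])
      fix x assume x: "x \<in> space X"
      show "indicator (b -` {c} \<inter> space X) x = (\<Prod>d\<in>b ` space X - {c}. (1 / (c - d)) * (b x + - d))"
      proof (cases "b x = c")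
        case True
        then have "(\<Prod>d\<in>b ` space X - {c}. (1 / (c - d)) * (b x + - d)) = 1"
          by (intro prod.neutral) auto
        with True x show ?thesis by simp
      next
        case False
        have "(\<Prod>d\<in>b ` space X - {c}. (1 / (c - d)) * (b x + - d)) = 0"
          using fin x False by (intro prod_zero) auto
        with False show ?thesis by simp
      qed
    qed
    moreover have "b -` {c} \<inter> space X \<in> sets X"
      using b(2) by (intro measurable_sets[of b X borel]) (auto simp: bounded_fun_def)
    ultimately show ?thesis by (simp add: P_sets_def)
  qed
  then have "simple_function Y b"
    unfolding simple_function_def space_Y sets_Y using fin by blast
  then have "b \<in> borel_measurable Y"
    by (rule borel_measurable_simple_function)
  moreover obtain C where "\<forall>x\<in>space Y. cmod (b x) \<le> C"
    using b(2) by (auto simp: bounded_fun_def space_Y)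
  then have "AE x in Y. cmod (b x) \<le> C"
    by (intro AE_I2) simp
  ultimately show ?thesis
    unfolding Linf_def by blast
qed

text \<open>Links \<open>cylinder_projection\<close> to \<open>Y\<close>: the projected indicators
  are measurable for the smaller sigma-algebra.\<close>

lemma step_fun_P_Linf_Y:
  assumes "mult_op (step_fun n \<beta>) \<in> P"
  shows "step_fun n \<beta> \<in> Linf Y"
proof (rule finite_range_P_Linf_Y[OF assms bounded_fun_step])
  have "step_fun n \<beta> ` space X \<subseteq> \<beta> ` cosets n"
    by (auto simp: step_fun_def space_X inverse_limit_coset)
  then show "finite (step_fun n \<beta> ` space X)"
    by (rule finite_subset) (intro finite_imageI finite_index)
qed

section \<open>Generation of \<open>P\<close> by the group and the functions on
  \<open>Y\<close>\<close>

lemma unitary_tensor_delta: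
  assumes "z \<in> space K" "h \<in> carrier G"
  shows "mult_op b (group_unitary G act h vacuum) z = tensor_delta b h z"
proof -
  obtain x k where z: "z = (x, k)" "k \<in> carrier G"
    using assms(1) by (auto simp: space_K)
  have "inv h \<otimes> k = \<one> \<longleftrightarrow> k = h"
    using z(2) assms(2) by (metis inv_closed inv_equality inv_inv l_inv)
  then show ?thesis
    by (simp add: z(1) mult_op_def group_unitary_def vacuum_def tensor_delta_def)
qed

text \<open>Right translation by \<open>h\<close> is isometric, moves
  \<open>f \<otimes> \<delta>\<^sub>h\<close> to \<open>f \<otimes> \<delta>\<^sub>1\<close>, and
  preserves \<open>P vacuum\<close> up to null sets, so orthogonality at the identity spreads to
  every \<open>h\<close>.\<close>

lemma tensor_delta_inner_P:
  assumes f: "f \<in> L2 X" and orth: "\<And>p. p \<in> P \<Longrightarrow> L2_inner K (tensor_delta f \<one>) (p vacuum) = 0"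
    and p: "p \<in> P" and h: "h \<in> carrier G"
  shows "L2_inner K (tensor_delta f h) (p vacuum) = 0"
proof -
  note ih = inv_closed[OF h]
  note f1 = tensor_delta_L2(1)[OF f one_closed] and fh = tensor_delta_L2(1)[OF f h]
  have pu: "(\<lambda>\<xi>. p (group_unitary G act (inv h) \<xi>)) \<in> P"
    by (rule P_comp[OF p unitary_P[OF ih]])
  note R = bounded_ops_L2[OF right_translation_bounded[OF h]]
  have "right_translation h (tensor_delta f h) z = tensor_delta f \<one> z" if "z \<in> space K" for z
    using that h by (auto simp: space_K right_translation_def tensor_delta_def)
  then have "L2_inner K (right_translation h (tensor_delta f h)) (right_translation h (p vacuum))
      = L2_inner K (tensor_delta f \<one>) (p (group_unitary G act (inv h) vacuum))"
    by (intro L2_inner_cong_AE[OF R[OF fh] f1 R[OF P_vacuum_L2[OF p]] P_vacuum_L2[OF pu] _ right_translation_P_vacuum[OF p h]] AE_I2)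
  also have "\<dots> = 0"
    by (rule orth[OF pu])
  finally show ?thesis
    using right_translation_inner[OF h fh P_vacuum_L2[OF p]] by simp
qed

text \<open>Split the test vector \<open>1\<^sub>C \<otimes> \<delta>\<^sub>h\<close> along the
  projection \<open>b\<close> of the indicator. The part \<open>b \<otimes> \<delta>\<^sub>h\<close>
  is the vacuum vector of an operator in \<open>P \<inter> \<A>\<close>, and the rest is orthogonal
  to \<open>P vacuum\<close>. The component \<open>y\<close> of \<open>p vacuum\<close> orthogonal
  to \<open>(P \<inter> \<A>) vacuum\<close> is thus orthogonal to all test vectors, so
  \<open>p vacuum\<close> is a limit of vectors from \<open>\<A>\<close>.\<close>

lemma P_subset_generated:
  assumes \<A>: "von_neumann_algebra K \<A>" and Lin: "mult_op ` Linf Y \<subseteq> \<A>"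
    and uni: "group_unitary G act ` carrier G \<subseteq> \<A>"
  shows "P \<subseteq> \<A>"
proof
  fix p assume p: "p \<in> P"
  have bic: "commutant K (commutant K \<A>) = \<A>"
    using \<A> by (simp add: von_neumann_algebra_def)
  note pL = P_vacuum_L2[OF p]
  \<comment> \<open>Projecting with \<open>P \<inter> \<A>\<close> instead of \<open>\<A>\<close>
    keeps \<open>w\<close> in the closure of \<open>P vacuum\<close> and the approximating operators
    in the left algebra.\<close>
  have "subspace_L2 K {q vacuum | q. q \<in> P \<inter> \<A>}"
  proof (rule subspace_L2_orbit[OF _ _ vacuum_L2])
    show "P \<inter> \<A> \<subseteq> bounded_ops K" using P_bounded by blast
    show "P \<inter> \<A> \<noteq> {}" using unitary_P uni one_closed by blast
  qed (auto intro: P_plus P_smult bicommutant_closed(1,2)[OF bic])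
  from L2_projection[OF this pL] obtain w v where w: "w \<in> L2 K"
    and v: "\<forall>k. v k \<in> {q vacuum | q. q \<in> P \<inter> \<A>}"
    and lim: "(\<lambda>k. L2_norm K (\<lambda>x. v k x - w x)) \<longlonglongrightarrow> 0"
    and orth: "\<forall>u\<in>{q vacuum | q. q \<in> P \<inter> \<A>}. L2_inner K (\<lambda>x. p vacuum x - w x) u = 0"
    by blast
  have "\<forall>k. \<exists>q. q \<in> P \<inter> \<A> \<and> v k = q vacuum"
    using v by blast
  then obtain q where q: "\<And>k. q k \<in> P \<inter> \<A>" and vq: "\<And>k. v k = q k vacuum"
    by metis
  have qP: "q k \<in> P" and qA: "q k \<in> \<A>" for k
    using q by auto
  note qL = P_vacuum_L2[OF qP]
  note lim = lim[unfolded vq]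
  define y where "y z = p vacuum z - w z" for z
  have y: "y \<in> L2 K"
    unfolding y_def by (intro L2_diff pL w)
  have y_orth: "L2_inner K y (r vacuum) = 0" if "r \<in> P" "r \<in> \<A>" for r
    using orth that unfolding y_def by blast
  have "AE z in K. y z = 0"
  proof (rule AE_K_zeroI[OF y])
    fix h assume h: "h \<in> carrier G"
    note yh = L2_fiber(1)[OF y h]
    show "AE x in X. y (x, h) = 0"
    proof (rule AE_zero_cylinders[OF L2_X_integrable[OF yh]])
      fix n C assume C: "C \<in> cosets n"
      obtain \<beta> where bP: "mult_op (step_fun n \<beta>) \<in> P"
        and b_orth: "\<forall>p\<in>P. L2_inner K (tensor_delta (\<lambda>x. indicator (cylinder n C) x - step_fun n \<beta> x) \<one>) (p vacuum) = 0"
        using cylinder_projection[OF C] by blast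
      define b where "b = step_fun n \<beta>"
      define f :: "(nat \<Rightarrow> 'a set) \<Rightarrow> complex" where "f x = indicator (cylinder n C) x" for x
      have fb: "f \<in> L2 X"
        unfolding f_def by (rule bounded_fun_L2[OF bounded_fun_indicator[OF cylinder_sets[OF C]]])
      have bb: "b \<in> L2 X"
        unfolding b_def by (rule bounded_fun_L2[OF bounded_fun_step])
      note tL = tensor_delta_L2(1)[OF _ h]
      have "L2_inner K y (tensor_delta b h) = 0"
      proof -
        let ?r = "\<lambda>\<xi>. mult_op b (group_unitary G act h \<xi>)"
        have r: "?r \<in> P" "?r \<in> \<A>"
          using P_comp[OF bP unitary_P[OF h]] bicommutant_closed(3)[OF bic, of "mult_op b" "group_unitary G act h"]
            Lin uni step_fun_P_Linf_Y[OF bP] h by (auto simp: b_def)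
        have "L2_inner K y (tensor_delta b h) = L2_inner K y (?r vacuum)"
          by (rule L2_inner_cong_AE[OF y y tL[OF bb] P_vacuum_L2[OF r(1)]])
            (auto intro!: AE_I2 unitary_tensor_delta[symmetric] h)
        then show ?thesis
          using y_orth[OF r] by simp
      qed
      \<comment> \<open>\<open>y\<close> is the difference of \<open>p vacuum\<close> and a limit of
        vectors in \<open>P vacuum\<close>, so it is orthogonal to whatever is orthogonal to
        \<open>P vacuum\<close>.\<close>
      moreover have "L2_inner K y (\<lambda>z. tensor_delta f h z - tensor_delta b h z) = 0"
      proof -
        have d: "tensor_delta (\<lambda>x. f x - b x) h = (\<lambda>z. tensor_delta f h z - tensor_delta b h z)"
          by (auto simp: tensor_delta_def fun_eq_iff)
        note dL = tL[OF L2_diff[OF fb bb]]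
        have P0: "L2_inner K (tensor_delta (\<lambda>x. f x - b x) h) (r vacuum) = 0" if "r \<in> P" for r
          by (rule tensor_delta_inner_P[OF L2_diff[OF fb bb] _ that h]) (use b_orth in \<open>simp add: f_def b_def\<close>)
        have "L2_inner K (tensor_delta (\<lambda>x. f x - b x) h) w = 0"
          by (rule L2_inner_orthogonal_limit[OF qL w lim dL P0[OF qP]])
        then have "L2_inner K (tensor_delta (\<lambda>x. f x - b x) h) y = 0"
          unfolding y_def using L2_inner_diff_right[OF pL w dL] P0[OF p] by simp
        then show ?thesis
          unfolding d using L2_inner_cnj[of K y] by simp
      qed
      ultimately have "L2_inner K y (tensor_delta f h) = 0"
        using L2_inner_diff_right[OF tL[OF fb] tL[OF bb] y] by simp
      then have "L2_inner X (\<lambda>x. y (x, h)) f = 0"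
        using L2_inner_tensor_delta[OF y fb h] by simp
      moreover have "L2_inner X (\<lambda>x. y (x, h)) f = (\<integral>x\<in>cylinder n C. y (x, h) \<partial>X)"
        unfolding L2_inner_def set_lebesgue_integral_def f_def
        by (intro Bochner_Integration.integral_cong) (auto simp: indicator_def)
      ultimately show "(\<integral>x\<in>cylinder n C. y (x, h) \<partial>X) = 0" by simp
    qed
  qed
  then have y0: "AE z in K. w z = p vacuum z"
    by eventually_elim (simp add: y_def)
  show "p \<in> \<A>"
  proof (rule bicommutant_vacuum_closed[OF bic qA])
    show "q k \<in> left_algebra" for k
      using qP P_left by blast
    show "p \<in> left_algebra"
      using p P_left by blast
    have "L2_norm K (\<lambda>z. q k vacuum z - w z) = L2_norm K (\<lambda>z. q k vacuum z - p vacuum z)" for k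
      by (rule L2_norm_cong_AE[OF L2_measurable[OF L2_diff[OF qL w]] L2_measurable[OF L2_diff[OF qL pL]]])
        (use y0 in eventually_elim, simp)
    with lim show "(\<lambda>k. L2_norm K (\<lambda>z. q k vacuum z - p vacuum z)) \<longlonglongrightarrow> 0" by simp
  qed
qed

lemma comp_identity: "{f \<circ> (\<lambda>x. x) | f. f \<in> F} = F"
  by (auto simp: comp_def)

proposition P_eq_factor_crossed_product:
  assumes "von_neumann_algebra K P"
  shows "P = factor_crossed_product G X act Y (\<lambda>x. x)"
  unfolding factor_crossed_product_def comp_identity
proof
  show "P \<subseteq> vN_generated K (mult_op ` Linf Y \<union> group_unitary G act ` carrier G)"
    unfolding vN_generated_def using P_subset_generated by blast
  show "vN_generated K (mult_op ` Linf Y \<union> group_unitary G act ` carrier G) \<subseteq> P"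
    by (rule vN_generated_least[OF assms]) (auto intro: Linf_Y_P unitary_P)
qed

section \<open>The action on \<open>Y\<close> and the factor map\<close>

text \<open>\<open>group_action\<close> maps into the group of extensional bijections of the space,
  hence the restriction.\<close>

definition Y_act :: "'a \<Rightarrow> (nat \<Rightarrow> 'a set) \<Rightarrow> (nat \<Rightarrow> 'a set)" where
  "Y_act g = restrict (act g) (space X)"

lemma Y_act_Bij:
  assumes g: "g \<in> carrier G"
  shows "Y_act g \<in> Bij (space X)"
proof -
  have "bij_betw (act g) (space X) (space X)"
    by (rule bij_betw_byWitness[where f' = "act (inv g)"])
      (auto simp: space_X act_inv_cancel g intro: act_closed[OF g] act_closed[OF inv_closed[OF g]])
  then have "bij_betw (Y_act g) (space X) (space X)"
    unfolding Y_act_def by (subst bij_betw_cong[of _ _ "act g"]) auto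
  then show ?thesis
    by (simp add: Bij_def Y_act_def)
qed

lemma Y_act_measurable:
  assumes g: "g \<in> carrier G"
  shows "Y_act g \<in> measurable Y Y"
proof (rule measurableI)
  show "Y_act g x \<in> space Y" if "x \<in> space Y" for x
    using that act_closed[OF g] by (simp add: Y_act_def space_Y space_X)
  show "Y_act g -` A \<inter> space Y \<in> sets Y" if "A \<in> sets Y" for A
  proof -
    have "Y_act g -` A \<inter> space Y = act g -` A \<inter> space X"
      by (auto simp: Y_act_def space_Y)
    then show ?thesis
      using act_vimage_P_sets[OF _ g, of A] that by (simp add: sets_Y)
  qed
qed

lemma Y_act_distr:
  assumes g: "g \<in> carrier G"
  shows "distr Y Y (Y_act g) = Y"
proof (rule measure_eqI)
  fix A assume "A \<in> sets (distr Y Y (Y_act g))"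
  then have A: "A \<in> P_sets" by (simp add: sets_Y)
  then have AX: "A \<in> sets X" by (simp add: P_sets_def)
  have "emeasure (distr Y Y (Y_act g)) A = emeasure Y (Y_act g -` A \<inter> space Y)"
    using A by (intro emeasure_distr Y_act_measurable g) (simp add: sets_Y)
  also have "Y_act g -` A \<inter> space Y = act g -` A \<inter> space X"
    by (auto simp: Y_act_def space_Y)
  also have "emeasure Y \<dots> = emeasure X (act g -` A \<inter> space X)"
    by (rule emeasure_Y[OF act_vimage_P_sets[OF A g]])
  also have "\<dots> = emeasure (distr X X (act g)) A"
    by (rule emeasure_distr[OF act_measurable[OF g] AX, symmetric])
  also have "\<dots> = emeasure Y A"
    unfolding act_distr[OF g] by (rule emeasure_Y[OF A, symmetric])
  finally show "emeasure (distr Y Y (Y_act g)) A = emeasure Y A" .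
qed simp

lemma pmp_action_Y: "pmp_action G Y Y_act"
  unfolding pmp_action_def
proof (intro conjI ballI prob_space_Y Y_act_measurable Y_act_distr)
  show "group_action G (space Y) Y_act"
    unfolding group_action_def group_hom_def group_hom_axioms_def
  proof (intro conjI group_BijGroup is_group homI)
    show "Y_act g \<in> carrier (BijGroup (space Y))" if "g \<in> carrier G" for g
      using Y_act_Bij[OF that] by (simp add: BijGroup_def space_Y)
    show "Y_act (g \<otimes> h) = Y_act g \<otimes>\<^bsub>BijGroup (space Y)\<^esub> Y_act h" if "g \<in> carrier G" "h \<in> carrier G" for g h
      using Y_act_Bij that act_mult act_closed
      by (auto simp: BijGroup_def space_Y compose_def Y_act_def space_X fun_eq_iff restrict_def)
  qed
qed

lemma factor_map_Y: "factor_map G X act Y Y_act (\<lambda>x. x)"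
  unfolding factor_map_def
proof (intro conjI ballI)
  show m: "(\<lambda>x. x) \<in> measurable X Y"
    by (rule measurable_Y_X) simp
  show "distr X Y (\<lambda>x. x) = Y"
  proof (rule measure_eqI)
    fix A assume "A \<in> sets (distr X Y (\<lambda>x. x))"
    then have A: "A \<in> P_sets" by (simp add: sets_Y)
    then have AX: "A \<in> sets X" by (simp add: P_sets_def)
    have "emeasure (distr X Y (\<lambda>x. x)) A = emeasure X ((\<lambda>x. x) -` A \<inter> space X)"
      using A by (intro emeasure_distr m) (simp add: sets_Y)
    also have "(\<lambda>x. x) -` A \<inter> space X = A"
      using sets.sets_into_space[OF AX] by auto
    also have "emeasure X A = emeasure Y A"
      by (rule emeasure_Y[OF A, symmetric])
    finally show "emeasure (distr X Y (\<lambda>x. x)) A = emeasure Y A" .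
  qed simp
qed (simp add: Y_act_def)

end

theorem corollary3p11:
  fixes G :: "('g, 'm) monoid_scheme"
    and N :: "nat \<Rightarrow> 'g set"
    and X :: "(nat \<Rightarrow> 'g set) measure"
    and P :: "(((nat \<Rightarrow> 'g set) \<times> 'g \<Rightarrow> complex) \<Rightarrow> ((nat \<Rightarrow> 'g set) \<times> 'g \<Rightarrow> complex)) set"
  assumes "group G"
    and "countable (carrier G)"
    and "residually_finite G"
    and "ICC G"
    and "\<And>n. N n \<lhd> G"
    and "\<And>n. finite (lcosets\<^bsub>G\<^esub> (N n))"
    and "decseq N"
    and "(\<Inter>n. N n) = {\<one>\<^bsub>G\<^esub>}"
    and "inverse_limit_space G N X"
    and "von_neumann_algebra (crossed_base G X) P"
    and "group_vN G X (translation G) \<subseteq> P"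
    and "P \<subseteq> crossed_product G X (translation G)"
  shows "\<exists>(Y :: (nat \<Rightarrow> 'g set) measure) \<beta> \<pi>.
           pmp_action G Y \<beta> \<and>
           factor_map G X (translation G) Y \<beta> \<pi> \<and>
           P = factor_crossed_product G X (translation G) Y \<pi>"
proof -
  interpret profinite_action G N X
    using assms(1,2,4-7,9) by (simp add: profinite_action_def profinite_action_axioms_def)
  have "intermediate_algebra G N X P"
  proof (intro intermediate_algebra.intro intermediate_algebra_axioms.intro profinite_action_axioms)
    show "commutant K (commutant K P) = P"
      using assms(10) by (simp add: von_neumann_algebra_def)
    show "group_unitary G act g \<in> P" if "g \<in> carrier G" for g
      using assms(11) vN_generated_superset that unfolding group_vN_def by blast
    show "P \<subseteq> left_algebra"
      using assms(12) crossed_product_left by blast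
  qed
  then interpret intermediate_algebra G N X P .
  show ?thesis
    using pmp_action_Y factor_map_Y P_eq_factor_crossed_product[OF assms(10)] by blast
qed

end
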